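(* Let $s_1,\dots,s_n\in(0,1)$ and $p_1,\dots,p_n>1$ satisfy $\overline{sp}<n$ and $p_{\max}<p^{\ast}$. Then there exists a nontrivial nonnegative (weak) solution $u\in\mathcal{D}^{\vec{s},\vec{p}}(\mathbb{R}^n)$ of $$\sum_{i=1}^n(-\partial_{ii})^{s_i}_{p_i}u=|u|^{p^{\ast}-2}u\quad\text{in }\mathbb{R}^n .$$
   Context: Given $s_1,\dots,s_n\in(0,1)$ and $p_1,\dots,p_n>1$, define $$\bar{s}=\Big(\frac1n\sum_{i=1}^n\frac1{s_i}\Big)^{-1},\quad \overline{sp}=\Big(\frac1n\sum_{i=1}^n\frac1{s_ip_i}\Big)^{-1},\quad p^{\ast}=\frac{n\,\overline{sp}/\bar{s}}{n-\overline{sp}},\quad p_{\max}=\max\{p_1,\dots,p_n\}.$$ Let $e_i$ be the $i$-th standard unit vector of $\mathbb{R}^n$. The homogeneous anisotropic Sobolev space is $$\mathcal{D}^{\vec{s},\vec{p}}(\mathbb{R}^n)=\Big\{u\in L^{p^{\ast}}(\mathbb{R}^n):\ \sum_{i=1}^n\int_{\mathbb{R}^n}\int_{\mathbb{R}}s_i(1-s_i)\frac{|u(x)-u(x+he_i)|^{p_i}}{|h|^{1+s_ip_i}}\,dh\,dx<\infty\Big\}.$$ The nonlocal anisotropic operator of mixed order is given by $$\sum_{i=1}^n(-\partial_{ii})^{s_i}_{p_i}u(x)=\sum_{i=1}^ns_i(1-s_i)\int_{\mathbb{R}}\frac{|u(x)-u(x+he_i)|^{p_i-2}(u(x)-u(x+he_i))}{|h|^{1+s_ip_i}}\,dh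 .$$ A function $u\in\mathcal{D}^{\vec{s},\vec{p}}(\mathbb{R}^n)$ is a (weak) solution of the equation if for every $\varphi\in\mathcal{D}^{\vec{s},\vec{p}}(\mathbb{R}^n)$ $$\sum_{i=1}^n\frac{s_i(1-s_i)}2\int_{\mathbb{R}^n}\int_{\mathbb{R}}\frac{|u(x)-u(x+he_i)|^{p_i-2}(u(x)-u(x+he_i))(\varphi(x)-\varphi(x+he_i))}{|h|^{1+s_ip_i}}\,dh\,dx=\int_{\mathbb{R}^n}|u|^{p^{\ast}-2}u\,\varphi\,dx .$$ Nontrivial means that $u$ is not a.e. equal to $0$; nonnegative means $u\ge0$ a.e. *)

theory Defs
  imports "HOL-Analysis.Analysis"
begin

text \<open>
  The ambient space is \<open>real ^ 'n\<close>, so that \<open>n = CARD('n) \<ge> 1\<close>, and the exponents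
  \<open>s\<close>, \<open>p\<close> are indexed by the coordinates. The \<open>i\<close>-th standard unit vector is \<open>axis i 1\<close>.
\<close>

definition s_bar :: "('n::finite \<Rightarrow> real) \<Rightarrow> real" where
  "s_bar s = inverse (1 / real CARD('n) * (\<Sum>i\<in>UNIV. 1 / s i))"

definition sp_bar :: "('n::finite \<Rightarrow> real) \<Rightarrow> ('n \<Rightarrow> real) \<Rightarrow> real" where
  "sp_bar s p = inverse (1 / real CARD('n) * (\<Sum>i\<in>UNIV. 1 / (s i * p i)))"

definition p_star :: "('n::finite \<Rightarrow> real) \<Rightarrow> ('n \<Rightarrow> real) \<Rightarrow> real" where
  "p_star s p = (real CARD('n) * sp_bar s p / s_bar s) / (real CARD('n) - sp_bar s p)"

definition p_max :: "('n::finite \<Rightarrow> real) \<Rightarrow> real" where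
  "p_max p = Max (range p)"

text \<open>
  Elements of \<open>L\<^sup>q\<close> are represented by Borel functions; every class modulo null sets
  contains one, and all notions below are invariant under changes on null sets.
\<close>

definition Lq :: "real \<Rightarrow> (real ^ 'n::finite \<Rightarrow> real) set" where
  "Lq q = {u. u \<in> borel_measurable borel \<and> integrable lborel (\<lambda>x. \<bar>u x\<bar> powr q)}"

text \<open>
  At \<open>h = 0\<close> the quotients below are 0 by the convention for division; this concerns
  a null set of \<open>h\<close> only.
\<close>

definition aniso_energy ::
  "('n::finite \<Rightarrow> real) \<Rightarrow> ('n \<Rightarrow> real) \<Rightarrow> (real ^ 'n \<Rightarrow> real) \<Rightarrow> ennreal" where
  "aniso_energy s p u =
    (\<Sum>i\<in>UNIV. \<integral>\<^sup>+x. \<integral>\<^sup>+h.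
       ennreal (s i * (1 - s i) * (\<bar>u x - u (x + h *\<^sub>R axis i 1)\<bar> powr p i
                                   / \<bar>h\<bar> powr (1 + s i * p i))) \<partial>lborel \<partial>lborel)"

definition aniso_space ::
  "('n::finite \<Rightarrow> real) \<Rightarrow> ('n \<Rightarrow> real) \<Rightarrow> (real ^ 'n \<Rightarrow> real) set" where
  "aniso_space s p = {u \<in> Lq (p_star s p). aniso_energy s p u < \<infinity>}"

text \<open>
  The function \<open>\<bar>t\<bar>\<^sup>q\<^sup>-\<^sup>2 t\<close>, with value 0 at \<open>t = 0\<close> for every \<open>q > 1\<close>
  (also for \<open>q \<le> 2\<close>, because \<open>0 powr a = 0\<close>).
\<close>

definition signed_power :: "real \<Rightarrow> real \<Rightarrow> real" where
  "signed_power q t = \<bar>t\<bar> powr (q - 2) * t"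

text \<open>
  The left-hand side of the weak formulation. For \<open>u\<close> and \<open>\<phi>\<close> in the space
  \<open>aniso_space s p\<close> the integrand is absolutely integrable in \<open>(x, h)\<close> by Hoelder's
  inequality, so the value 0 of the Bochner integral for non-integrable functions occurs
  only in the inner integral, for \<open>x\<close> in a null set.
\<close>

definition aniso_form ::
  "('n::finite \<Rightarrow> real) \<Rightarrow> ('n \<Rightarrow> real) \<Rightarrow> (real ^ 'n \<Rightarrow> real) \<Rightarrow> (real ^ 'n \<Rightarrow> real) \<Rightarrow> real" where
  "aniso_form s p u \<phi> =
    (\<Sum>i\<in>UNIV. s i * (1 - s i) / 2 *
       (LINT x|lborel. LINT h|lborel.
          signed_power (p i) (u x - u (x + h *\<^sub>R axis i 1)) * (\<phi> x - \<phi> (x + h *\<^sub>R axis i 1))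
          / \<bar>h\<bar> powr (1 + s i * p i)))"

text \<open>
  Weak solutions of the critical equation, in which the operator is the sum over \<open>i\<close> of
  the fractional \<open>p\<^sub>i\<close>-Laplacians of order \<open>s\<^sub>i\<close> in direction \<open>i\<close> and the right-hand
  side is \<open>\<bar>u\<bar>\<^sup>q\<^sup>-\<^sup>2 u\<close> with \<open>q = p_star s p\<close>.
\<close>

definition weak_solution ::
  "('n::finite \<Rightarrow> real) \<Rightarrow> ('n \<Rightarrow> real) \<Rightarrow> (real ^ 'n \<Rightarrow> real) \<Rightarrow> bool" where
  "weak_solution s p u \<longleftrightarrow>
    u \<in> aniso_space s p \<and>
    (\<forall>\<phi>\<in>aniso_space s p.
       aniso_form s p u \<phi> = (LINT x|lborel. signed_power (p_star s p) (u x) * \<phi> x))"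

end

theory Submission
  imports Defs
begin

text \<open>
  With \<open>J u = (\<Sum>i. s\<^sub>i (1 - s\<^sub>i) E\<^sub>i u / (2 p\<^sub>i))\<close>, where \<open>E\<^sub>i\<close> is the Gagliardo energy in direction \<open>i\<close>,
  the solution is a rescaled minimizer of \<open>J\<close> on \<open>\<integral>\<bar>u\<bar>\<^sup>q = 1\<close>, \<open>q = p\<^sup>*\<close>. Anisotropic dilations of
  the variable show that the infimum \<open>S\<close> satisfies \<open>J u \<ge> S (\<integral>\<bar>u\<bar>\<^sup>q)\<^sup>\<theta>\<close> with some \<open>\<theta> < 1\<close>, and
  that the Lagrange multiplier can be scaled away.

  Compactness rests on a refined Sobolev inequality. Let \<open>M\<close> be the supremum of \<open>\<bar>A\<^sub>a u\<bar> / a\<close> over all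
  averages \<open>A\<^sub>a u\<close> on boxes with sides \<open>a powr (- (q - p\<^sub>i) / (s\<^sub>i p\<^sub>i))\<close>, hence of volume \<open>a powr (- q)\<close>. On
  \<open>{\<bar>u\<bar> > v}\<close> and with \<open>a = v / (2 M)\<close> one has \<open>\<bar>u - A\<^sub>a u\<bar> > v / 2\<close>; telescoping \<open>u - A\<^sub>a u\<close> over the
  coordinates and integrating the resulting bounds on the level sets over \<open>v\<close> gives
  \<open>\<integral>\<bar>u\<bar>\<^sup>q \<le> (\<Sum>i. C\<^sub>i M powr (q - p\<^sub>i) E\<^sub>i u)\<close>. So a minimizing sequence does not vanish: after an
  energy-invariant dilation and a translation its averages over the unit box stay away from 0. A
  subsequence converges almost everywhere to some \<open>u \<noteq> 0\<close>, and the Brezis-Lieb lemma together with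
  \<open>m\<^sup>\<theta> + (1 - m)\<^sup>\<theta> > 1\<close> for \<open>0 < m < 1\<close> forces \<open>\<integral>\<bar>u\<bar>\<^sup>q = 1\<close>.
\<close>

section \<open>Powers and \<open>L\<^sup>p\<close> functions\<close>

text \<open>Multiplying u by a constant changes the energies by the different powers p_i, so the
  amplitude cannot be used to normalize a minimizer. Dilating x_i by t powr (1 / (s_i p_i)) changes
  every energy by the same factor t powr (1 - \<alpha>) and the mass by t powr (- \<alpha>), whence
  \<theta> = 1 - 1 / \<alpha>; that \<alpha> > 1 is the hypothesis on \<open>sp_bar\<close>.
  Amplitude and dilation together contain a one-parameter group which, like the translations,
  preserves the mass and all energies. Its existence is the identity \<open>exponent_sum\<close>,
  and it is the reason why compactness fails. The boxes of the refined inequality are the images of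
  the unit cube under this group and the translations, so M is invariant as well. As p_i < q, the
  factors M powr (q - p_i) are small for small M; this is what excludes vanishing. Minimality is
  always used in the form S (mass u) powr \<theta> <= J u on the whole space, without a
  constraint.\<close>

lemma powr_abs_add_le:
  fixes a b p :: real
  assumes "0 < p"
  shows "\<bar>a + b\<bar> powr p \<le> 2 powr p * (\<bar>a\<bar> powr p + \<bar>b\<bar> powr p)"
proof -
  have "\<bar>a + b\<bar> powr p \<le> (2 * max \<bar>a\<bar> \<bar>b\<bar>) powr p"
    using assms by (intro powr_mono2) auto
  also have "\<dots> = 2 powr p * max \<bar>a\<bar> \<bar>b\<bar> powr p"
    by (simp add: powr_mult)
  also have "max \<bar>a\<bar> \<bar>b\<bar> powr p \<le> \<bar>a\<bar> powr p + \<bar>b\<bar> powr p"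
    by (auto simp: max_def)
  finally show ?thesis
    by simp
qed

text \<open>Replacing the smaller of \<open>a\<close>, \<open>b\<close> by the larger turns the
  product into one of the two powers. This variant of Young's inequality avoids the conjugate
  exponent; it serves only for integrability and domination, where the constant does not
  matter.\<close>

lemma powr_Young:
  fixes a b p :: real
  assumes "1 < p" "0 \<le> a" "0 \<le> b"
  shows "a powr (p - 1) * b \<le> a powr p + b powr p"
proof -
  have *: "t powr (p - 1) * t = t powr p" if "0 \<le> t" for t
    using that powr_mult_base[of t "p - 1"] by (simp add: mult.commute)
  show ?thesis
  proof (cases "a \<le> b")
    case True
    then have "a powr (p - 1) * b \<le> b powr (p - 1) * b"
      using assms by (intro mult_right_mono powr_mono2) auto
    then show ?thesis
      using *[of b] assms by (simp add: add_increasing)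
  next
    case False
    then have "a powr (p - 1) * b \<le> a powr (p - 1) * a"
      using assms by (intro mult_left_mono) auto
    then show ?thesis
      using *[of a] assms by (simp add: add_increasing2)
  qed
qed

text \<open>With \<open>d\<close> as a free parameter this replaces Jensen's and Hoelder's inequalities below.\<close>

lemma le_add_powr:
  fixes t d p :: real
  assumes "1 < p" "0 \<le> t" "0 < d"
  shows "t \<le> d + d powr (1 - p) * t powr p"
proof (cases "t \<le> d")
  case True
  then show ?thesis by (simp add: add_increasing2)
next
  case False
  then have "d powr (1 - p) * t powr p = (t / d) powr (p - 1) * t"
    using assms by (simp add: powr_divide powr_diff field_simps)
  moreover have "1 \<le> (t / d) powr (p - 1)"
    using False assms by (intro ge_one_powr_ge_zero) auto
  then have "t \<le> (t / d) powr (p - 1) * t"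
    using assms mult_right_mono[of 1 "(t / d) powr (p - 1)" t] by simp
  ultimately show ?thesis
    using assms by linarith
qed

lemma powr_diff_le_nonneg:
  fixes x y p :: real
  assumes "1 < p" "0 \<le> x" "x \<le> y"
  shows "y powr p - x powr p \<le> p * y powr (p - 1) * (y - x)"
proof (cases "x = y")
  case False
  then have xy: "x < y" using assms by simp
  have "\<exists>l z. x < z \<and> z < y \<and> DERIV (\<lambda>z. z powr p) z :> l \<and> y powr p - x powr p = (y - x) * l"
  proof (rule MVT[OF xy])
    show "continuous_on {x..y} (\<lambda>z. z powr p)"
      using assms by (intro continuous_on_powr' continuous_intros) auto
    show "(\<lambda>z. z powr p) differentiable (at z)" if "x < z" for z
      using has_real_derivative_powr[of z p] that assms
      by (auto simp: real_differentiable_def)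
  qed
  then obtain l z where lz: "x < z" "z < y" "DERIV (\<lambda>z. z powr p) z :> l" "y powr p - x powr p = (y - x) * l"
    by blast
  have "l = p * z powr (p - 1)"
    using DERIV_unique[OF lz(3)] has_real_derivative_powr[of z p] lz assms by auto
  with lz have z: "x < z" "z < y" "y powr p - x powr p = (y - x) * (p * z powr (p - 1))"
    by auto
  have "z powr (p - 1) \<le> y powr (p - 1)"
    using z assms by (intro powr_mono2) auto
  then show ?thesis
    using z(3) xy assms by (simp add: mult.commute mult.left_commute mult_left_mono)
qed simp

lemma powr_abs_diff_le:
  fixes a b p :: real
  assumes "1 < p"
  shows "\<bar>\<bar>a + b\<bar> powr p - \<bar>a\<bar> powr p\<bar> \<le> p * (\<bar>a\<bar> + \<bar>b\<bar>) powr (p - 1) * \<bar>b\<bar>"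
proof -
  have *: "y powr p - x powr p \<le> p * (\<bar>a\<bar> + \<bar>b\<bar>) powr (p - 1) * \<bar>b\<bar>"
    if "0 \<le> x" "x \<le> y" "y \<le> \<bar>a\<bar> + \<bar>b\<bar>" "y - x \<le> \<bar>b\<bar>" for x y
  proof -
    have "y powr p - x powr p \<le> p * y powr (p - 1) * (y - x)"
      using that assms by (intro powr_diff_le_nonneg) auto
    also have "\<dots> \<le> p * (\<bar>a\<bar> + \<bar>b\<bar>) powr (p - 1) * \<bar>b\<bar>"
      using that assms by (intro mult_mono powr_mono2) auto
    finally show ?thesis .
  qed
  show ?thesis
  proof (cases "\<bar>a\<bar> \<le> \<bar>a + b\<bar>")
    case True
    then have "\<bar>a\<bar> powr p \<le> \<bar>a + b\<bar> powr p"
      using assms by (intro powr_mono2) auto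
    then show ?thesis
      using *[of "\<bar>a\<bar>" "\<bar>a + b\<bar>"] True by auto
  next
    case False
    then have "\<bar>a + b\<bar> powr p \<le> \<bar>a\<bar> powr p"
      using assms by (intro powr_mono2) auto
    then show ?thesis
      using *[of "\<bar>a + b\<bar>" "\<bar>a\<bar>"] False by auto
  qed
qed

text \<open>The pointwise estimate behind the Brezis-Lieb lemma. If \<open>b\<close> is small
  relative to \<open>a\<close>, the mean value bound is absorbed by the term with \<open>e\<close>;
  otherwise \<open>a\<close> is at most a multiple of \<open>b\<close> and everything goes into the
  term with \<open>C\<close>.\<close>

lemma powr_abs_diff_eps:
  fixes p e :: real
  assumes "1 < p" "0 < e"
  obtains C where "0 \<le> C"
    "\<And>a b. \<bar>\<bar>a + b\<bar> powr p - \<bar>a\<bar> powr p\<bar> \<le> e * \<bar>a\<bar> powr p + C * \<bar>b\<bar> powr p"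
proof -
  \<comment> \<open>The entry 1 gives |a| + |b| <= 2 |a| in the first case; the other entry makes p
    * 2 powr (p - 1) * d at most \<open>e\<close>.\<close>
  define d where "d = min 1 (e / (p * 2 powr (p - 1)))"
  define C where "C = p * (1 / d + 1) powr (p - 1)"
  have d: "0 < d" "d \<le> 1" "p * 2 powr (p - 1) * d \<le> e"
    using assms by (auto simp: d_def min_def field_simps)
  show thesis
  proof
    show "0 \<le> C"
      using assms by (simp add: C_def)
    show "\<bar>\<bar>a + b\<bar> powr p - \<bar>a\<bar> powr p\<bar> \<le> e * \<bar>a\<bar> powr p + C * \<bar>b\<bar> powr p" for a b :: real
    proof (cases "\<bar>b\<bar> \<le> d * \<bar>a\<bar>")
      case True
      have "\<bar>b\<bar> \<le> \<bar>a\<bar>"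
        using True d mult_right_mono[of d 1 "\<bar>a\<bar>"] by simp
      then have "p * (\<bar>a\<bar> + \<bar>b\<bar>) powr (p - 1) * \<bar>b\<bar> \<le> p * (2 * \<bar>a\<bar>) powr (p - 1) * (d * \<bar>a\<bar>)"
        using assms True by (intro mult_mono powr_mono2) auto
      also have "\<dots> = (p * 2 powr (p - 1) * d) * (\<bar>a\<bar> * \<bar>a\<bar> powr (p - 1))"
        by (simp add: powr_mult)
      also have "\<dots> \<le> e * (\<bar>a\<bar> * \<bar>a\<bar> powr (p - 1))"
        using d by (intro mult_right_mono) auto
      also have "\<bar>a\<bar> * \<bar>a\<bar> powr (p - 1) = \<bar>a\<bar> powr p"
        by (simp add: powr_mult_base)
      finally show ?thesis
        using powr_abs_diff_le[OF assms(1), of a b] \<open>0 \<le> C\<close>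
        by (meson add_increasing2 mult_nonneg_nonneg order_trans powr_ge_zero)
    next
      case False
      then have "\<bar>a\<bar> + \<bar>b\<bar> \<le> (1 / d + 1) * \<bar>b\<bar>"
        using d by (simp add: field_simps)
      then have "p * (\<bar>a\<bar> + \<bar>b\<bar>) powr (p - 1) * \<bar>b\<bar> \<le> p * ((1 / d + 1) * \<bar>b\<bar>) powr (p - 1) * \<bar>b\<bar>"
        using assms by (intro mult_mono powr_mono2) auto
      also have "\<dots> = C * (\<bar>b\<bar> * \<bar>b\<bar> powr (p - 1))"
        using d by (simp add: powr_mult C_def)
      also have "\<bar>b\<bar> * \<bar>b\<bar> powr (p - 1) = \<bar>b\<bar> powr p"
        by (simp add: powr_mult_base)
      finally show ?thesis
        using powr_abs_diff_le[OF assms(1), of a b] assms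
        by (smt (verit) mult_nonneg_nonneg powr_ge_zero)
    qed
  qed
qed

lemma abs_signed_power:
  "1 < p \<Longrightarrow> \<bar>signed_power p t\<bar> = \<bar>t\<bar> powr (p - 1)"
  using powr_mult_base[of "\<bar>t\<bar>" "p - 2"]
  by (simp add: signed_power_def abs_mult mult.commute)

lemma has_real_derivative_abs_powr:
  fixes a b p :: real
  assumes "1 < p"
  shows "((\<lambda>t. \<bar>a + t * b\<bar> powr p) has_real_derivative p * signed_power p a * b) (at 0)"
proof -
  have powr_abs: "((\<lambda>t. \<bar>t\<bar> powr p) has_real_derivative p * signed_power p a) (at a)"
  proof -
    consider "a > 0" | "a < 0" | "a = 0" by linarith
    then show ?thesis
    proof cases
      case 1
      have "((\<lambda>t. t powr p) has_real_derivative p * a powr (p - 1)) (at a)"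
        using 1 by (rule has_real_derivative_powr)
      moreover have "\<forall>\<^sub>F t in nhds a. t powr p = \<bar>t\<bar> powr p"
        using 1 by (intro eventually_nhds_in_open[of "{0<..}" a, THEN eventually_mono]) auto
      moreover have "a powr (p - 1) = signed_power p a"
        using 1 powr_mult_base[of a "p - 2"] by (simp add: signed_power_def mult.commute)
      ultimately show ?thesis
        using DERIV_cong_ev[OF refl, of "\<lambda>t. t powr p" "\<lambda>t. \<bar>t\<bar> powr p"] by simp
    next
      case 2
      have "((\<lambda>t. (- t) powr p) has_real_derivative - (p * (- a) powr (p - 1))) (at a)"
        using 2 by (auto intro!: derivative_eq_intros)
      moreover have "\<forall>\<^sub>F t in nhds a. (- t) powr p = \<bar>t\<bar> powr p"
        using 2 by (intro eventually_nhds_in_open[of "{..<0}" a, THEN eventually_mono]) auto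
      moreover have "(- a) powr (p - 1) = - signed_power p a"
        using 2 powr_mult_base[of "- a" "p - 2"] by (simp add: signed_power_def mult.commute)
      ultimately show ?thesis
        using DERIV_cong_ev[OF refl, of "\<lambda>t. (- t) powr p" "\<lambda>t. \<bar>t\<bar> powr p"] by simp
    next
      \<comment> \<open>At 0 the difference quotient has absolute value |h| powr (p - 1), which
        tends to 0 because p > 1.\<close>
      case 3
      have "((\<lambda>h::real. \<bar>h\<bar> powr (p - 1)) \<longlongrightarrow> 0) (at 0)"
      proof (rule tendsto_eq_intros)
        show "((\<lambda>h::real. \<bar>h\<bar>) \<longlongrightarrow> 0) (at 0)"
          by (rule tendsto_eq_intros | simp)+
      qed (use assms in auto)
      then have "((\<lambda>h::real. norm (\<bar>h\<bar> powr p / h)) \<longlongrightarrow> 0) (at 0)"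
      proof (rule Lim_transform_eventually)
        have "\<bar>h\<bar> powr (p - 1) = norm (\<bar>h\<bar> powr p / h)" if "h \<noteq> 0" for h :: real
          using that powr_mult_base[of "\<bar>h\<bar>" "p - 1"] by (simp add: divide_simps mult.commute)
        then show "\<forall>\<^sub>F h::real in at 0. \<bar>h\<bar> powr (p - 1) = norm (\<bar>h\<bar> powr p / h)"
          by (auto simp: eventually_at_filter)
      qed
      then have "((\<lambda>h::real. \<bar>h\<bar> powr p / h) \<longlongrightarrow> 0) (at 0)"
        by (rule tendsto_norm_zero_cancel)
      then show ?thesis
        using 3 by (auto simp: has_field_derivative_iff signed_power_def)
    qed
  qed
  have "((\<lambda>t. a + t * b) has_real_derivative b) (at 0)"
    by (auto intro!: derivative_eq_intros)
  with DERIV_chain2[of "\<lambda>t. \<bar>t\<bar> powr p" "p * signed_power p a" "\<lambda>t. a + t * b" 0 b UNIV] powr_abs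
  show ?thesis by simp
qed

section \<open>The spaces \<open>Lp\<close>: Fatou's lemma, the Brezis-Lieb lemma, differentiation
  of integrals of powers\<close>

definition Lp :: "'a measure \<Rightarrow> real \<Rightarrow> ('a \<Rightarrow> real) set" where
  "Lp M p = {f \<in> borel_measurable M. integrable M (\<lambda>x. \<bar>f x\<bar> powr p)}"

lemma LpD:
  assumes "f \<in> Lp M p"
  shows "f \<in> borel_measurable M" "integrable M (\<lambda>x. \<bar>f x\<bar> powr p)"
  using assms by (auto simp: Lp_def)

lemma Lp_lincomb:
  assumes "f \<in> Lp M p" "g \<in> Lp M p" "0 < p"
  shows "(\<lambda>x. f x + c * g x) \<in> Lp M p"
proof -
  note [measurable] = LpD[OF assms(1)] LpD[OF assms(2)]
  have "integrable M (\<lambda>x. \<bar>f x + c * g x\<bar> powr p)"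
  proof (rule Bochner_Integration.integrable_bound)
    show "integrable M (\<lambda>x. 2 powr p * (\<bar>f x\<bar> powr p + \<bar>c\<bar> powr p * \<bar>g x\<bar> powr p))"
      using LpD(2)[OF assms(1)] LpD(2)[OF assms(2)] by simp
    show "AE x in M. norm (\<bar>f x + c * g x\<bar> powr p)
        \<le> norm (2 powr p * (\<bar>f x\<bar> powr p + \<bar>c\<bar> powr p * \<bar>g x\<bar> powr p))"
      using powr_abs_add_le[OF assms(3), of "f x" "c * g x" for x]
      by (auto simp: abs_mult powr_mult intro!: AE_I2)
  qed measurable
  then show ?thesis
    by (simp add: Lp_def)
qed

lemma Lp_diff:
  assumes "f \<in> Lp M p" "g \<in> Lp M p" "0 < p"
  shows "(\<lambda>x. f x - g x) \<in> Lp M p"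
  using Lp_lincomb[OF assms, of "-1"] by simp

lemma integrable_signed_power_mult:
  assumes "f \<in> Lp M p" "g \<in> Lp M p" "1 < p"
  shows "integrable M (\<lambda>x. signed_power p (f x) * g x)"
proof (rule Bochner_Integration.integrable_bound)
  note [measurable] = LpD[OF assms(1)] LpD[OF assms(2)]
  show "integrable M (\<lambda>x. \<bar>f x\<bar> powr p + \<bar>g x\<bar> powr p)"
    by (intro Bochner_Integration.integrable_add LpD(2) assms)
  show "(\<lambda>x. signed_power p (f x) * g x) \<in> borel_measurable M"
    unfolding signed_power_def by measurable
  show "AE x in M. norm (signed_power p (f x) * g x) \<le> norm (\<bar>f x\<bar> powr p + \<bar>g x\<bar> powr p)"
    using powr_Young[OF assms(3), of "\<bar>f x\<bar>" "\<bar>g x\<bar>" for x] assms(3)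
    by (auto simp: abs_mult abs_signed_power intro!: AE_I2)
qed

text \<open>Puts the almost everywhere limit of a sequence with bounded mass and energies back into
  the space; it is applied both to functions and to their difference quotients.\<close>

lemma Lp_Fatou:
  fixes f :: "nat \<Rightarrow> 'a \<Rightarrow> real"
  assumes "\<And>k. f k \<in> Lp M p" "g \<in> borel_measurable M" "0 < p"
    and lim: "AE x in M. (\<lambda>k. f k x) \<longlonglongrightarrow> g x"
    and bound: "\<And>k. (LINT x|M. \<bar>f k x\<bar> powr p) \<le> K"
  shows "g \<in> Lp M p" "(LINT x|M. \<bar>g x\<bar> powr p) \<le> K"
proof -
  note [measurable] = LpD(1)[OF assms(1)] assms(2)
  have K: "0 \<le> K"
    using bound[of 0] by (meson Bochner_Integration.integral_nonneg order_trans powr_ge_zero)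
  have "(\<integral>\<^sup>+x. ennreal (\<bar>g x\<bar> powr p) \<partial>M) = (\<integral>\<^sup>+x. liminf (\<lambda>k. ennreal (\<bar>f k x\<bar> powr p)) \<partial>M)"
  proof (rule nn_integral_cong_AE)
    show "AE x in M. ennreal (\<bar>g x\<bar> powr p) = liminf (\<lambda>k. ennreal (\<bar>f k x\<bar> powr p))"
      using lim
    proof eventually_elim
      case (elim x)
      then have "(\<lambda>k. \<bar>f k x\<bar> powr p) \<longlonglongrightarrow> \<bar>g x\<bar> powr p"
        using assms(3) by (intro tendsto_powr' tendsto_rabs tendsto_const) auto
      then have "(\<lambda>k. ennreal (\<bar>f k x\<bar> powr p)) \<longlonglongrightarrow> ennreal (\<bar>g x\<bar> powr p)"
        by (rule tendsto_ennrealI)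
      then show ?case
        by (rule lim_imp_Liminf[OF sequentially_bot, symmetric])
    qed
  qed
  also have "\<dots> \<le> liminf (\<lambda>k. \<integral>\<^sup>+x. ennreal (\<bar>f k x\<bar> powr p) \<partial>M)"
    by (rule nn_integral_liminf) measurable
  also have "\<dots> \<le> liminf (\<lambda>k. ennreal K)"
    by (intro Liminf_mono always_eventually allI)
       (use bound LpD(2)[OF assms(1)] in \<open>simp add: nn_integral_eq_integral ennreal_leI\<close>)
  also have "\<dots> = ennreal K"
    by (simp add: Liminf_const)
  finally have *: "(\<integral>\<^sup>+x. ennreal (\<bar>g x\<bar> powr p) \<partial>M) \<le> ennreal K" .
  have int: "integrable M (\<lambda>x. \<bar>g x\<bar> powr p)"
    using * by (intro integrableI_nonneg) (auto simp: less_top[symmetric] top_unique)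
  then show "g \<in> Lp M p"
    by (simp add: Lp_def)
  show "(LINT x|M. \<bar>g x\<bar> powr p) \<le> K"
    using * int K by (simp add: nn_integral_eq_integral ennreal_le_iff)
qed

text \<open>The defect |f|^p - |f - g|^p - |g|^p need not be dominated by a fixed function, but its
  excess over e' |f - g|^p is dominated by a multiple of |g|^p. Dominated convergence removes this
  excess, and the rest is at most e' times a bounded quantity.\<close>

lemma Brezis_Lieb:
  fixes f :: "nat \<Rightarrow> 'a \<Rightarrow> real"
  assumes f: "\<And>k. f k \<in> Lp M p" and g: "g \<in> Lp M p" and p: "1 < p"
    and lim: "AE x in M. (\<lambda>k. f k x) \<longlonglongrightarrow> g x"
    and bound: "\<And>k. (LINT x|M. \<bar>f k x\<bar> powr p) \<le> K"
  shows "(\<lambda>k. (LINT x|M. \<bar>f k x\<bar> powr p) - (LINT x|M. \<bar>f k x - g x\<bar> powr p))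
           \<longlonglongrightarrow> (LINT x|M. \<bar>g x\<bar> powr p)"
proof -
  note [measurable] = LpD(1)[OF f] LpD(1)[OF g]
  define r where "r k x = f k x - g x" for k x
  have r: "r k \<in> Lp M p" for k
    unfolding r_def using f g p by (intro Lp_diff) auto
  note [measurable] = LpD(1)[OF r]
  note ints = LpD(2)[OF f] LpD(2)[OF g] LpD(2)[OF r]
  define R where "R k x = \<bar>f k x\<bar> powr p - \<bar>r k x\<bar> powr p - \<bar>g x\<bar> powr p" for k x
  have R_int: "integrable M (R k)" for k
    unfolding R_def by (intro Bochner_Integration.integrable_diff ints)
  note [measurable] = borel_measurable_integrable[OF R_int]
  define K' where "K' = 2 powr p * (K + (LINT x|M. \<bar>g x\<bar> powr p))"
  have K': "(LINT x|M. \<bar>r k x\<bar> powr p) \<le> K'" for k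
  proof -
    have "(LINT x|M. \<bar>r k x\<bar> powr p) \<le> (LINT x|M. 2 powr p * (\<bar>f k x\<bar> powr p + \<bar>g x\<bar> powr p))"
      using powr_abs_add_le[of p "f k x" "- g x" for x] p
      by (intro integral_mono ints integrable_mult_right Bochner_Integration.integrable_add) (auto simp: r_def)
    also have "\<dots> = 2 powr p * ((LINT x|M. \<bar>f k x\<bar> powr p) + (LINT x|M. \<bar>g x\<bar> powr p))"
      by (simp add: ints)
    also have "\<dots> \<le> K'"
      using bound[of k] unfolding K'_def by simp
    finally show ?thesis .
  qed
  have "0 \<le> K'"
    using K'[of 0] by (meson Bochner_Integration.integral_nonneg order_trans powr_ge_zero)
  have "(\<lambda>k. LINT x|M. \<bar>R k x\<bar>) \<longlonglongrightarrow> 0"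
  proof (rule LIMSEQ_I)
    fix e :: real assume "0 < e"
    \<comment> \<open>\<open>K'\<close> bounds the integrals of |r k|^p, so they contribute less
      than e / 2; the summand 1 covers the case that \<open>K'\<close> is 0.\<close>
    define e' where "e' = e / (2 * (K' + 1))"
    have e': "0 < e'" "e' * K' < e / 2"
      using \<open>0 < e\<close> \<open>0 \<le> K'\<close> by (auto simp: e'_def field_simps)
    obtain C where C: "0 \<le> C"
      "\<And>a b. \<bar>\<bar>a + b\<bar> powr p - \<bar>a\<bar> powr p\<bar> \<le> e' * \<bar>a\<bar> powr p + C * \<bar>b\<bar> powr p"
      using powr_abs_diff_eps[OF p e'(1)] by metis
    define W where "W k x = max 0 (\<bar>R k x\<bar> - e' * \<bar>r k x\<bar> powr p)" for k x
    have W_meas[measurable]: "W k \<in> borel_measurable M" for k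
      unfolding W_def by measurable
    have max_bound: "\<bar>max 0 (\<bar>a - b - c\<bar> - d)\<bar> \<le> h + c"
      if "\<bar>a - b\<bar> \<le> d + h" "0 \<le> h" "0 \<le> c" for a b c d h :: real
      using that by linarith
    have W_bound: "\<bar>W k x\<bar> \<le> (C + 1) * \<bar>g x\<bar> powr p" for k x
    proof -
      have "\<bar>\<bar>r k x + g x\<bar> powr p - \<bar>r k x\<bar> powr p\<bar> \<le> e' * \<bar>r k x\<bar> powr p + C * \<bar>g x\<bar> powr p"
        by (rule C)
      then show ?thesis
        using C(1) max_bound[of "\<bar>f k x\<bar> powr p"] by (simp add: W_def R_def r_def distrib_right)
    qed
    have "(\<lambda>k. LINT x|M. W k x) \<longlonglongrightarrow> (LINT x|M. 0)"
    proof (rule integral_dominated_convergence)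
      show "integrable M (\<lambda>x. (C + 1) * \<bar>g x\<bar> powr p)"
        by (intro integrable_mult_right ints)
      show "AE x in M. (\<lambda>k. W k x) \<longlonglongrightarrow> 0"
        using lim
      proof eventually_elim
        case (elim x)
        have r0: "(\<lambda>k. r k x) \<longlonglongrightarrow> 0"
          unfolding r_def using elim by (simp add: LIM_zero)
        have fp: "(\<lambda>k. \<bar>f k x\<bar> powr p) \<longlonglongrightarrow> \<bar>g x\<bar> powr p"
          using elim p by (intro tendsto_powr' tendsto_rabs tendsto_const) auto
        have rp: "(\<lambda>k. \<bar>r k x\<bar> powr p) \<longlonglongrightarrow> \<bar>0\<bar> powr p"
          using r0 p by (intro tendsto_powr' tendsto_rabs tendsto_const) auto
        have "(\<lambda>k. max 0 (\<bar>R k x\<bar> - e' * \<bar>r k x\<bar> powr p))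
            \<longlonglongrightarrow> max 0 (\<bar>\<bar>g x\<bar> powr p - \<bar>0\<bar> powr p - \<bar>g x\<bar> powr p\<bar> - e' * \<bar>0\<bar> powr p)"
          unfolding R_def by (intro tendsto_intros fp rp)
        then show ?case
          using p by (simp add: W_def)
      qed
      show "AE x in M. norm (W k x) \<le> (C + 1) * \<bar>g x\<bar> powr p" for k
        using W_bound by simp
    qed measurable
    then obtain k0 where k0: "\<And>k. k \<ge> k0 \<Longrightarrow> norm ((LINT x|M. W k x) - 0) < e / 2"
      using LIMSEQ_D[of "\<lambda>k. LINT x|M. W k x" 0 "e/2"] \<open>0 < e\<close> by auto
    have W_int: "integrable M (W k)" for k
      by (rule Bochner_Integration.integrable_bound[OF integrable_mult_right[OF ints(2), of "C + 1"]])
         (use W_bound C(1) in \<open>auto simp: abs_mult\<close>)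
    show "\<exists>k0. \<forall>k\<ge>k0. norm ((LINT x|M. \<bar>R k x\<bar>) - 0) < e"
    proof (intro exI allI impI)
      fix k assume "k \<ge> k0"
      have "(LINT x|M. \<bar>R k x\<bar>) \<le> (LINT x|M. W k x + e' * \<bar>r k x\<bar> powr p)"
        by (intro integral_mono integrable_abs R_int Bochner_Integration.integrable_add
            W_int integrable_mult_right ints) (auto simp: W_def)
      also have "\<dots> = (LINT x|M. W k x) + e' * (LINT x|M. \<bar>r k x\<bar> powr p)"
        by (simp add: W_int ints)
      also have "\<dots> \<le> (LINT x|M. W k x) + e' * K'"
        using K' e' by simp
      also have "\<dots> < e"
        using k0[OF \<open>k \<ge> k0\<close>] e' by auto
      finally show "norm ((LINT x|M. \<bar>R k x\<bar>) - 0) < e"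
        by simp
    qed
  qed
  then have "(\<lambda>k. LINT x|M. R k x) \<longlonglongrightarrow> 0"
    by (rule tendsto_rabs_zero_cancel[OF tendsto_sandwich[OF _ _ tendsto_const], rotated 2])
       (auto intro!: always_eventually integral_abs_bound)
  then have "(\<lambda>k. (LINT x|M. R k x) + (LINT x|M. \<bar>g x\<bar> powr p)) \<longlonglongrightarrow> 0 + (LINT x|M. \<bar>g x\<bar> powr p)"
    by (intro tendsto_intros)
  then show ?thesis
    by (simp add: R_def ints r_def[symmetric])
qed

text \<open>Dominated convergence for the difference quotients: for |t| <= 1 they are bounded by a
  fixed combination of |f|^p and |g|^p. This gives the directional derivatives of the mass and of
  each energy.\<close>

lemma has_real_derivative_integral_abs_powr:
  assumes f: "f \<in> Lp M p" and g: "g \<in> Lp M p" and p: "1 < p"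
  shows "((\<lambda>t. LINT x|M. \<bar>f x + t * g x\<bar> powr p) has_real_derivative
           p * (LINT x|M. signed_power p (f x) * g x)) (at 0)"
proof -
  note [measurable] = LpD(1)[OF f] LpD(1)[OF g]
  have ft: "integrable M (\<lambda>x. \<bar>f x + t * g x\<bar> powr p)" for t
    using Lp_lincomb[OF f g, of t] p by (auto simp: Lp_def)
  note fi = LpD(2)[OF f] and gi = LpD(2)[OF g]
  define Q where "Q t x = (\<bar>f x + t * g x\<bar> powr p - \<bar>f x\<bar> powr p) / t" for t x
  have Q_int: "(LINT x|M. Q t x) = ((LINT x|M. \<bar>f x + t * g x\<bar> powr p) - (LINT x|M. \<bar>f x\<bar> powr p)) / t" for t
    unfolding Q_def by (simp add: ft fi)
  have Q_meas[measurable]: "Q t \<in> borel_measurable M" for t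
    unfolding Q_def by measurable
  have Q_bound: "\<bar>Q t x\<bar> \<le> p * (2 powr p * (\<bar>f x\<bar> powr p + \<bar>g x\<bar> powr p) + \<bar>g x\<bar> powr p)"
    if "\<bar>t\<bar> \<le> 1" "t \<noteq> 0" for t x
  proof -
    have "\<bar>Q t x\<bar> \<le> p * (\<bar>f x\<bar> + \<bar>t * g x\<bar>) powr (p - 1) * \<bar>t * g x\<bar> / \<bar>t\<bar>"
      using powr_abs_diff_le[OF p, of "f x" "t * g x"] that
      by (simp add: Q_def divide_right_mono)
    also have "\<dots> = p * ((\<bar>f x\<bar> + \<bar>t * g x\<bar>) powr (p - 1) * \<bar>g x\<bar>)"
      using that by (simp add: abs_mult)
    also have "\<dots> \<le> p * ((\<bar>f x\<bar> + \<bar>g x\<bar>) powr (p - 1) * \<bar>g x\<bar>)"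
      using that p mult_right_mono[of "\<bar>t\<bar>" 1 "\<bar>g x\<bar>"]
      by (intro mult_left_mono mult_right_mono powr_mono2) (auto simp: abs_mult)
    also have "\<dots> \<le> p * ((\<bar>f x\<bar> + \<bar>g x\<bar>) powr p + \<bar>g x\<bar> powr p)"
      using p by (intro mult_left_mono powr_Young) auto
    also have "\<dots> \<le> p * (2 powr p * (\<bar>f x\<bar> powr p + \<bar>g x\<bar> powr p) + \<bar>g x\<bar> powr p)"
      using powr_abs_add_le[of p "\<bar>f x\<bar>" "\<bar>g x\<bar>"] p by (intro mult_left_mono) auto
    finally show ?thesis .
  qed
  have "((\<lambda>t. LINT x|M. Q t x) \<longlongrightarrow> p * (LINT x|M. signed_power p (f x) * g x)) (at 0)"
    unfolding tendsto_at_iff_sequentially comp_def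
  proof (intro allI impI)
    fix X :: "nat \<Rightarrow> real" assume X: "\<forall>i. X i \<in> UNIV - {0}" "X \<longlonglongrightarrow> 0"
    \<comment> \<open>The dominating function is valid only for |t| <= 1, hence the shift of the
      sequence by \<open>i0\<close>.\<close>
    from order_tendstoD(2)[OF tendsto_rabs[OF X(2)], of 1]
    obtain i0 where i0: "\<And>i. i \<ge> i0 \<Longrightarrow> \<bar>X i\<bar> < 1"
      by (auto simp: eventually_sequentially)
    have "(\<lambda>i. LINT x|M. Q (X (i + i0)) x) \<longlonglongrightarrow> (LINT x|M. p * signed_power p (f x) * g x)"
    proof (rule integral_dominated_convergence)
      show "integrable M (\<lambda>x. p * (2 powr p * (\<bar>f x\<bar> powr p + \<bar>g x\<bar> powr p) + \<bar>g x\<bar> powr p))"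
        by (intro integrable_mult_right Bochner_Integration.integrable_add fi gi)
      show "AE x in M. norm (Q (X (i + i0)) x)
          \<le> p * (2 powr p * (\<bar>f x\<bar> powr p + \<bar>g x\<bar> powr p) + \<bar>g x\<bar> powr p)" for i
        using i0[of "i + i0"] X(1) Q_bound[of "X (i + i0)"] by (auto simp: less_imp_le)
      show "AE x in M. (\<lambda>i. Q (X (i + i0)) x) \<longlonglongrightarrow> p * signed_power p (f x) * g x"
      proof (intro AE_I2)
        fix x
        have "((\<lambda>t. Q t x) \<longlongrightarrow> p * signed_power p (f x) * g x) (at 0)"
          using has_real_derivative_abs_powr[OF p, of "f x" "g x"]
          by (simp add: has_field_derivative_iff Q_def)
        then have "(\<lambda>i. Q (X i) x) \<longlonglongrightarrow> p * signed_power p (f x) * g x"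
          using X by (auto simp: tendsto_at_iff_sequentially comp_def)
        then show "(\<lambda>i. Q (X (i + i0)) x) \<longlonglongrightarrow> p * signed_power p (f x) * g x"
          by (rule LIMSEQ_ignore_initial_segment)
      qed
    qed (auto simp: signed_power_def)
    then have "(\<lambda>i. LINT x|M. Q (X i) x) \<longlonglongrightarrow> (LINT x|M. p * signed_power p (f x) * g x)"
      by (rule LIMSEQ_offset)
    then show "(\<lambda>i. LINT x|M. Q (X i) x) \<longlonglongrightarrow> p * (LINT x|M. signed_power p (f x) * g x)"
      by (simp add: mult.assoc)
  qed
  then show ?thesis
    by (simp add: has_field_derivative_iff Q_int)
qed

section \<open>Coordinatewise scaling and telescoping over the coordinates\<close>

text \<open>Diagonal maps serve both as the anisotropic dilations of functions and as
  parametrizations of boxes with unequal sides by a fixed cube.\<close>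

definition cscale :: "('n::finite \<Rightarrow> real) \<Rightarrow> real ^ 'n \<Rightarrow> real ^ 'n" where
  "cscale b x = (\<chi> i. b i * x $ i)"

lemma cscale_measurable[measurable]: "cscale b \<in> borel_measurable borel"
  unfolding cscale_def
  by (intro borel_measurable_continuous_onI continuous_on_vec_lambda continuous_intros)

lemma borel_measurable_vec_nth[measurable (raw)]:
  fixes f :: "'a \<Rightarrow> real ^ 'n::finite"
  assumes "f \<in> borel_measurable M"
  shows "(\<lambda>x. f x $ i) \<in> borel_measurable M"
  using measurable_compose[OF assms borel_measurable_continuous_onI[of "\<lambda>x. x $ i"]]
  by (simp add: continuous_on_component)

lemma cscale_add: "cscale b (x + y) = cscale b x + cscale b y"
  by (simp add: cscale_def vec_eq_iff algebra_simps)

lemma cscale_axis: "cscale b (h *\<^sub>R axis i 1) = (b i * h) *\<^sub>R axis i 1"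
  by (simp add: cscale_def vec_eq_iff axis_def)

lemma cscale_cscale: "cscale a (cscale b x) = cscale (\<lambda>i. a i * b i) x"
  by (simp add: cscale_def vec_eq_iff)

lemma bij_betw_axis_Basis: "bij_betw (\<lambda>i. axis i 1) UNIV (Basis :: (real ^ 'n::finite) set)"
  by (auto simp: bij_betw_def inj_on_def axis_eq_axis Basis_vec_def)

lemma prod_Basis_cart:
  fixes f :: "real ^ 'n::finite \<Rightarrow> 'b::comm_monoid_mult"
  shows "(\<Prod>j\<in>Basis. f j) = (\<Prod>i\<in>UNIV. f (axis i 1))"
  using prod.reindex_bij_betw[OF bij_betw_axis_Basis, of f] by simp

lemma sum_Basis_cart:
  fixes f :: "real ^ 'n::finite \<Rightarrow> 'b::comm_monoid_add"
  shows "(\<Sum>j\<in>Basis. f j) = (\<Sum>i\<in>UNIV. f (axis i 1))"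
  using sum.reindex_bij_betw[OF bij_betw_axis_Basis, of f] by simp

lemma lborel_cscale:
  fixes b :: "'n::finite \<Rightarrow> real"
  assumes b: "\<And>i. 0 < b i"
  shows "lborel = density (distr lborel borel (\<lambda>x. t + cscale b x)) (\<lambda>_. ennreal (\<Prod>i\<in>UNIV. b i))"
proof -
  define c where "c j = (\<chi> i. b i) \<bullet> j" for j :: "real ^ 'n"
  have c_axis: "c (axis i 1) = b i" for i
    by (simp add: c_def inner_axis)
  have "lborel = density (distr lborel borel (\<lambda>x. t + (\<Sum>j\<in>Basis. (c j * (x \<bullet> j)) *\<^sub>R j)))
      (\<lambda>_. (\<Prod>j\<in>Basis. \<bar>c j\<bar>))"
    using b by (intro lborel_affine_euclidean) (auto simp: Basis_vec_def c_axis less_imp_neq[symmetric])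
  moreover have "(\<Sum>j\<in>Basis. (c j * (x \<bullet> j)) *\<^sub>R j) = cscale b x" for x :: "real ^ 'n"
    unfolding sum_Basis_cart c_axis
    by (simp add: cart_eq_inner_axis[symmetric] cscale_def vec_eq_iff)
       (simp add: axis_def if_distrib cong: if_cong)
  moreover have "(\<Prod>j\<in>Basis. \<bar>c j\<bar>) = (\<Prod>i\<in>UNIV. b i)"
    unfolding prod_Basis_cart c_axis using b by (simp add: less_imp_le)
  ultimately show ?thesis
    by simp
qed

lemma nn_integral_cscale:
  fixes b :: "'n::finite \<Rightarrow> real"
  assumes b: "\<And>i. 0 < b i" and [measurable]: "f \<in> borel_measurable borel"
  shows "(\<integral>\<^sup>+x. f (t + cscale b x) \<partial>lborel) = ennreal (1 / (\<Prod>i\<in>UNIV. b i)) * (\<integral>\<^sup>+x. f x \<partial>lborel)"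
proof -
  have pos: "0 < (\<Prod>i\<in>UNIV. b i)"
    using b by (intro prod_pos) auto
  have inv_mult: "ennreal (1 / c) * ennreal c = 1" if "0 < c" for c
    using that by (simp add: ennreal_mult[symmetric])
  have "(\<integral>\<^sup>+x. f x \<partial>lborel) = ennreal (\<Prod>i\<in>UNIV. b i) * (\<integral>\<^sup>+x. f (t + cscale b x) \<partial>lborel)"
    by (subst lborel_cscale[of b t, OF b]) (simp add: nn_integral_density nn_integral_distr nn_integral_cmult)
  moreover have "ennreal (1 / (\<Prod>i\<in>UNIV. b i)) * ennreal (\<Prod>i\<in>UNIV. b i) = 1"
    by (rule inv_mult[OF pos])
  ultimately show ?thesis
    by (simp add: mult.assoc[symmetric])
qed

lemma nn_integral_translate:
  fixes f :: "'a::euclidean_space \<Rightarrow> ennreal"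
  assumes [measurable]: "f \<in> borel_measurable borel"
  shows "(\<integral>\<^sup>+x. f (x + t) \<partial>lborel) = (\<integral>\<^sup>+x. f x \<partial>lborel)"
  by (subst (2) lborel_distr_plus[of t, symmetric]) (simp add: nn_integral_distr add.commute)

lemma nn_integral_cbox_component:
  fixes g :: "real \<Rightarrow> ennreal" and i :: "'n::finite"
  assumes [measurable]: "g \<in> borel_measurable borel"
  shows "(\<integral>\<^sup>+h\<in>cbox (-1) (1::real^'n). g (h $ i) \<partial>lborel)
       = 2 ^ (CARD('n) - 1) * (\<integral>\<^sup>+t\<in>{-1..1}. g t \<partial>lborel)"
proof -
  \<comment> \<open>Only the factor of coordinate i carries \<open>g\<close>, so the integrand is a
    product over the coordinates; each of the others contributes the length 2 of [-1, 1].\<close>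
  define F where "F j t = (if j = axis i 1 then g t else 1) * indicator {-1..1} t" for j :: "real ^ 'n" and t
  have "(\<integral>\<^sup>+h\<in>cbox (-1) (1::real^'n). g (h $ i) \<partial>lborel) = (\<integral>\<^sup>+h. (\<Prod>j\<in>Basis. F j (h \<bullet> j)) \<partial>lborel)"
  proof (intro nn_integral_cong)
    fix h :: "real ^ 'n"
    have "(\<Prod>j\<in>Basis. F j (h \<bullet> j)) = (\<Prod>k\<in>UNIV. (if k = i then g (h $ k) else 1)) * (\<Prod>k\<in>UNIV. indicator {-1..1} (h $ k))"
      unfolding prod_Basis_cart F_def by (simp add: prod.distrib axis_eq_axis inner_axis cong: if_cong)
    also have "(\<Prod>k\<in>UNIV. indicator {-1..1} (h $ k) :: ennreal) = indicator (cbox (-1) 1) h"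
      by (auto simp: indicator_def mem_box_cart)
    finally show "g (h $ i) * indicator (cbox (-1) 1) h = (\<Prod>j\<in>Basis. F j (h \<bullet> j))"
      by (simp add: prod.delta)
  qed
  also have "\<dots> = (\<Prod>j\<in>(Basis :: (real^'n) set). \<integral>\<^sup>+t. F j t \<partial>lborel)"
    by (rule nn_integral_lborel_prod) (auto simp: F_def)
  also have "\<dots> = (\<Prod>k\<in>(UNIV :: 'n set). if k = i then (\<integral>\<^sup>+t\<in>{-1..1}. g t \<partial>lborel) else 2)"
    unfolding prod_Basis_cart by (intro prod.cong) (auto simp: F_def[abs_def] axis_eq_axis)
  also have "\<dots> = (\<integral>\<^sup>+t\<in>{-1..1}. g t \<partial>lborel) * (\<Prod>k\<in>UNIV - {i}. 2)"
    by (subst prod.remove[of _ i]) auto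
  finally show ?thesis
    by (simp add: mult.commute)
qed

lemma emeasure_cbox_unit: "emeasure lborel (cbox (-1) (1::real^'n::finite)) = 2 ^ CARD('n)"
proof -
  \<comment> \<open>The integrand is constant, so any coordinate may be named.\<close>
  have "emeasure lborel (cbox (-1) (1::real^'n)) = (\<integral>\<^sup>+h\<in>cbox (-1) (1::real^'n). (\<lambda>_. 1) (h $ undefined) \<partial>lborel)"
    by simp
  also have "\<dots> = 2 ^ (CARD('n) - 1) * 2"
    by (subst nn_integral_cbox_component) auto
  also have "\<dots> = 2 ^ Suc (CARD('n) - 1)"
    by (rule power_Suc2[symmetric])
  finally show ?thesis
    by simp
qed

section \<open>Telescoping along the coordinate axes\<close>

definition coord_restrict :: "'n::finite set \<Rightarrow> real ^ 'n \<Rightarrow> real ^ 'n" where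
  "coord_restrict I y = (\<chi> i. if i \<in> I then y $ i else 0)"

lemma coord_restrict_measurable[measurable]:
  fixes I :: "'n::finite set"
  shows "coord_restrict I \<in> borel_measurable borel"
proof -
  have "continuous_on UNIV (coord_restrict I)"
    unfolding coord_restrict_def
  proof (intro continuous_on_vec_lambda)
    show "continuous_on UNIV (\<lambda>y::real^'n. if i \<in> I then y $ i else 0)" for i
      by (cases "i \<in> I") (auto intro!: continuous_intros)
  qed
  then show ?thesis
    by (rule borel_measurable_continuous_onI)
qed

text \<open>One walks from x to x + y by changing one coordinate at a time; \<open>P i\<close> is
  the set of coordinates already changed when coordinate i is about to move. It depends on none of
  u, x, y, so the starting point of each move is x plus a vector depending on y alone.\<close>

lemma coordinate_path:
  obtains P :: "'n::finite \<Rightarrow> 'n set" where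
    "\<And>u :: real ^ 'n \<Rightarrow> real. \<And>x y. \<bar>u x - u (x + y)\<bar> \<le>
       (\<Sum>i\<in>UNIV. \<bar>u (x + coord_restrict (P i) y) - u (x + coord_restrict (P i) y + y $ i *\<^sub>R axis i 1)\<bar>)"
proof -
  have "\<exists>P :: 'n \<Rightarrow> 'n set. \<forall>u :: real ^ 'n \<Rightarrow> real. \<forall>x y. \<bar>u x - u (x + coord_restrict I y)\<bar> \<le>
       (\<Sum>i\<in>I. \<bar>u (x + coord_restrict (P i) y) - u (x + coord_restrict (P i) y + y $ i *\<^sub>R axis i 1)\<bar>)"
    if "finite I" for I
    using that
  proof induction
    case empty
    then show ?case
      by (simp add: coord_restrict_def zero_vec_def[symmetric])
  next
    case (insert j I)
    then obtain P where P: "\<And>u :: real ^ 'n \<Rightarrow> real. \<And>x y. \<bar>u x - u (x + coord_restrict I y)\<bar> \<le>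
       (\<Sum>i\<in>I. \<bar>u (x + coord_restrict (P i) y) - u (x + coord_restrict (P i) y + y $ i *\<^sub>R axis i 1)\<bar>)"
      by blast
    \<comment> \<open>The new coordinate \<open>j\<close> is moved last, starting where all of
      \<open>I\<close> has been moved; the witness is \<open>P(j := I)\<close>.\<close>
    show ?case
    proof (intro exI allI)
      fix u :: "real ^ 'n \<Rightarrow> real" and x y :: "real ^ 'n"
      let ?t = "\<lambda>P i. \<bar>u (x + coord_restrict (P i) y) - u (x + coord_restrict (P i) y + y $ i *\<^sub>R axis i 1)\<bar>"
      have step: "coord_restrict (insert j I) y = coord_restrict I y + y $ j *\<^sub>R axis j 1"
        using insert by (auto simp: coord_restrict_def vec_eq_iff axis_def)
      have "\<bar>u x - u (x + coord_restrict (insert j I) y)\<bar>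
          \<le> \<bar>u x - u (x + coord_restrict I y)\<bar> + ?t (P(j := I)) j"
        by (simp add: step add.assoc)
      also have "\<dots> \<le> (\<Sum>i\<in>I. ?t P i) + ?t (P(j := I)) j"
        using P by simp
      also have "(\<Sum>i\<in>I. ?t P i) = (\<Sum>i\<in>I. ?t (P(j := I)) i)"
        using insert by (intro sum.cong) auto
      finally show "\<bar>u x - u (x + coord_restrict (insert j I) y)\<bar> \<le> (\<Sum>i\<in>insert j I. ?t (P(j := I)) i)"
        using insert by (simp add: add.commute)
    qed
  qed
  from this[of UNIV] obtain P :: "'n \<Rightarrow> 'n set" where
    "\<And>u :: real ^ 'n \<Rightarrow> real. \<And>x y. \<bar>u x - u (x + coord_restrict UNIV y)\<bar> \<le>
       (\<Sum>i\<in>UNIV. \<bar>u (x + coord_restrict (P i) y) - u (x + coord_restrict (P i) y + y $ i *\<^sub>R axis i 1)\<bar>)"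
    by auto
  moreover have "coord_restrict UNIV y = y" for y :: "real ^ 'n"
    by (simp add: coord_restrict_def)
  ultimately show thesis
    by (intro that) simp
qed

text \<open>The p-th power of the L^p modulus of continuity in direction i at step h.\<close>

definition dir_mod :: "'n::finite \<Rightarrow> real \<Rightarrow> (real ^ 'n \<Rightarrow> real) \<Rightarrow> real \<Rightarrow> ennreal" where
  "dir_mod i p u h = (\<integral>\<^sup>+x. ennreal (\<bar>u x - u (x + h *\<^sub>R axis i 1)\<bar> powr p) \<partial>lborel)"

lemma dir_mod_measurable[measurable]:
  assumes [measurable]: "u \<in> borel_measurable borel"
  shows "dir_mod i p u \<in> borel_measurable borel"
  unfolding dir_mod_def by measurable

text \<open>Increments in different directions are measured in different exponents, so
  \<open>le_add_powr\<close> linearizes the powers with a common \<open>d\<close>. The functions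
  \<open>\<Phi> i\<close> collect the p_i-th powers and do not depend on \<open>d\<close>, which can
  thus be adapted afterwards to a level of u or to a mesh. The cube [-1, 1]^n, rather than [0, 1]^n,
  also contains a grid cell as seen from any of its points.\<close>

lemma box_average_telescope:
  fixes u :: "real ^ 'n::finite \<Rightarrow> real" and p l :: "'n \<Rightarrow> real"
  assumes [measurable]: "u \<in> borel_measurable borel" and p: "\<And>i. 1 < p i"
  obtains \<Phi> :: "'n \<Rightarrow> real ^ 'n \<Rightarrow> ennreal" where
    "\<And>i. \<Phi> i \<in> borel_measurable borel"
    "\<And>d x. 0 < d \<Longrightarrow> (\<integral>\<^sup>+h\<in>cbox (-1) 1. ennreal \<bar>u x - u (x + cscale l h)\<bar> \<partial>lborel)
        \<le> (\<Sum>i\<in>UNIV. ennreal (d * 2 ^ CARD('n)) + ennreal (d powr (1 - p i)) * \<Phi> i x)"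
    "\<And>i. (\<integral>\<^sup>+x. \<Phi> i x \<partial>lborel)
        = 2 ^ (CARD('n) - 1) * (\<integral>\<^sup>+t\<in>{-1..1}. dir_mod i (p i) u (l i * t) \<partial>lborel)"
proof -
  obtain P :: "'n \<Rightarrow> 'n set" where P: "\<And>u :: real ^ 'n \<Rightarrow> real. \<And>x y. \<bar>u x - u (x + y)\<bar> \<le>
       (\<Sum>i\<in>UNIV. \<bar>u (x + coord_restrict (P i) y) - u (x + coord_restrict (P i) y + y $ i *\<^sub>R axis i 1)\<bar>)"
    using coordinate_path by blast
  define D where "D i x h = \<bar>u (x + coord_restrict (P i) (cscale l h))
      - u (x + coord_restrict (P i) (cscale l h) + (l i * h $ i) *\<^sub>R axis i 1)\<bar>" for i x h
  have D_meas[measurable]: "(\<lambda>(x, h). D i x h) \<in> borel_measurable (borel \<Otimes>\<^sub>M borel)" for i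
    unfolding D_def by measurable
  have D_meas'[measurable]: "D i x \<in> borel_measurable borel" for i x
    unfolding D_def by measurable
  define \<Phi> where "\<Phi> i x = (\<integral>\<^sup>+h\<in>cbox (-1) 1. ennreal (D i x h powr p i) \<partial>lborel)" for i x
  show thesis
  proof
    show "\<Phi> i \<in> borel_measurable borel" for i
      unfolding \<Phi>_def by measurable
    show "(\<integral>\<^sup>+h\<in>cbox (-1) 1. ennreal \<bar>u x - u (x + cscale l h)\<bar> \<partial>lborel)
        \<le> (\<Sum>i\<in>UNIV. ennreal (d * 2 ^ CARD('n)) + ennreal (d powr (1 - p i)) * \<Phi> i x)" if "0 < d" for d x
    proof -
      have "(\<integral>\<^sup>+h\<in>cbox (-1) 1. ennreal \<bar>u x - u (x + cscale l h)\<bar> \<partial>lborel)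
          \<le> (\<integral>\<^sup>+h. (\<Sum>i\<in>UNIV. (ennreal d + ennreal (d powr (1 - p i)) * ennreal (D i x h powr p i))
               * indicator (cbox (-1) 1) h) \<partial>lborel)"
      proof (rule nn_integral_mono)
        fix h :: "real ^ 'n"
        have "\<bar>u x - u (x + cscale l h)\<bar> \<le> (\<Sum>i\<in>UNIV. D i x h)"
          using P[of u x "cscale l h"] by (simp add: D_def cscale_def)
        also have "\<dots> \<le> (\<Sum>i\<in>UNIV. d + d powr (1 - p i) * D i x h powr p i)"
          by (intro sum_mono le_add_powr p that) (simp add: D_def)
        finally have "ennreal \<bar>u x - u (x + cscale l h)\<bar>
            \<le> (\<Sum>i\<in>UNIV. ennreal (d + d powr (1 - p i) * D i x h powr p i))"
          using that by (subst sum_ennreal) (auto intro!: ennreal_leI add_nonneg_nonneg)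
        also have "\<dots> = (\<Sum>i\<in>UNIV. ennreal d + ennreal (d powr (1 - p i)) * ennreal (D i x h powr p i))"
          using that by (simp add: ennreal_plus ennreal_mult)
        finally show "ennreal \<bar>u x - u (x + cscale l h)\<bar> * indicator (cbox (-1) 1) h
            \<le> (\<Sum>i\<in>UNIV. (ennreal d + ennreal (d powr (1 - p i)) * ennreal (D i x h powr p i))
               * indicator (cbox (-1) 1) h)"
          by (auto simp: indicator_def)
      qed
      also have "\<dots> = (\<Sum>i\<in>UNIV. ennreal d * 2 ^ CARD('n) + ennreal (d powr (1 - p i)) * \<Phi> i x)"
        unfolding \<Phi>_def
        by (subst nn_integral_sum)
           (auto simp: distrib_right nn_integral_add nn_integral_cmult mult.assoc emeasure_cbox_unit nn_integral_cmult_indicator)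
      finally show ?thesis
        using that by (simp add: ennreal_mult ennreal_power[symmetric])
    qed
    show "(\<integral>\<^sup>+x. \<Phi> i x \<partial>lborel)
        = 2 ^ (CARD('n) - 1) * (\<integral>\<^sup>+t\<in>{-1..1}. dir_mod i (p i) u (l i * t) \<partial>lborel)" for i
    proof -
      have "(\<integral>\<^sup>+x. \<Phi> i x \<partial>lborel)
          = (\<integral>\<^sup>+h. (\<integral>\<^sup>+x. ennreal (D i x h powr p i) * indicator (cbox (-1) 1) h \<partial>lborel) \<partial>lborel)"
        unfolding \<Phi>_def by (rule lborel_pair.Fubini') measurable
      also have "\<dots> = (\<integral>\<^sup>+h\<in>cbox (-1) 1. dir_mod i (p i) u (l i * h $ i) \<partial>lborel)"
      proof (intro nn_integral_cong)
        \<comment> \<open>For fixed \<open>h\<close> the intermediate point is a translate of x, so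
          it disappears when integrated over x.\<close>
        fix h :: "real ^ 'n"
        have "(\<integral>\<^sup>+x. ennreal (D i x h powr p i) \<partial>lborel) = dir_mod i (p i) u (l i * h $ i)"
          unfolding D_def dir_mod_def
          using nn_integral_translate[of "\<lambda>x. ennreal (\<bar>u x - u (x + (l i * h $ i) *\<^sub>R axis i 1)\<bar> powr p i)"
              "coord_restrict (P i) (cscale l h)"]
          by simp
        then show "(\<integral>\<^sup>+x. ennreal (D i x h powr p i) * indicator (cbox (-1) 1) h \<partial>lborel)
            = dir_mod i (p i) u (l i * h $ i) * indicator (cbox (-1) 1) h"
          by (simp add: nn_integral_multc)
      qed
      also have "\<dots> = 2 ^ (CARD('n) - 1) * (\<integral>\<^sup>+t\<in>{-1..1}. dir_mod i (p i) u (l i * t) \<partial>lborel)"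
        by (rule nn_integral_cbox_component[of "\<lambda>t. dir_mod i (p i) u (l i * t)"]) measurable
      finally show ?thesis .
    qed
  qed
qed

section \<open>Level sets and box averages\<close>

text \<open>The Gagliardo energy in direction i without the factor s (1 - s). The integration in h
  is outermost because the estimates below act on \<open>dir_mod\<close> at fixed h;
  \<open>nn_integral_quot\<close> and \<open>aniso_energy_eq\<close> relate this to
  \<open>aniso_energy\<close>.\<close>

definition dir_energy :: "'n::finite \<Rightarrow> real \<Rightarrow> real \<Rightarrow> (real ^ 'n \<Rightarrow> real) \<Rightarrow> ennreal" where
  "dir_energy i s p u = (\<integral>\<^sup>+h. dir_mod i p u h * ennreal (1 / \<bar>h\<bar> powr (1 + s * p)) \<partial>lborel)"

lemma nn_integral_powr_from_0:
  fixes c \<gamma> :: real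
  assumes "0 < \<gamma>" "0 \<le> c"
  shows "(\<integral>\<^sup>+x. (if 0 < x \<and> x \<le> c then ennreal (x powr (\<gamma> - 1)) else 0) \<partial>lborel) = ennreal (c powr \<gamma> / \<gamma>)"
proof -
  have "((\<lambda>x. x powr (\<gamma> - 1)) has_integral (c powr (\<gamma> - 1 + 1) / (\<gamma> - 1 + 1))) {0..c}"
    using assms by (intro has_integral_powr_from_0) auto
  then have "(\<integral>\<^sup>+x. ennreal (indicator {0..c} x * x powr (\<gamma> - 1)) \<partial>lborel) = ennreal (c powr \<gamma> / \<gamma>)"
    by (subst nn_integral_has_integral_lebesgue) auto
  moreover have "(\<integral>\<^sup>+x. (if 0 < x \<and> x \<le> c then ennreal (x powr (\<gamma> - 1)) else 0) \<partial>lborel)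
      = (\<integral>\<^sup>+x. ennreal (indicator {0..c} x * x powr (\<gamma> - 1)) \<partial>lborel)"
    by (intro nn_integral_cong) (auto simp: indicator_def)
  ultimately show ?thesis by simp
qed

lemma nn_integral_interval_scale:
  fixes g :: "real \<Rightarrow> ennreal"
  assumes [measurable]: "g \<in> borel_measurable borel" and l: "0 < l"
  shows "(\<integral>\<^sup>+t\<in>{-1..1}. g (l * t) \<partial>lborel) = ennreal (1 / l) * (\<integral>\<^sup>+r\<in>{-l..l}. g r \<partial>lborel)"
proof -
  have ind: "indicator {-l..l} (l * t) = (indicator {-1..1} t :: ennreal)" for t
  proof -
    have "- l \<le> l * t \<longleftrightarrow> l * (- 1) \<le> l * t" "l * t \<le> l \<longleftrightarrow> l * t \<le> l * 1"
      by auto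
    then show ?thesis
      using l by (simp only: mult_le_cancel_left_pos indicator_def atLeastAtMost_iff)
  qed
  have "(\<integral>\<^sup>+r\<in>{-l..l}. g r \<partial>lborel) = ennreal l * (\<integral>\<^sup>+t\<in>{-1..1}. g (l * t) \<partial>lborel)"
    using l by (subst nn_integral_real_affine[where c = l and t = 0]) (auto simp: ind)
  then show ?thesis
    using l by (simp add: mult.assoc[symmetric] ennreal_mult[symmetric])
qed

text \<open>For fixed r the condition |r| <= (v / M) powr (- \<beta>) is an upper bound for the
  level v. After exchanging the integrals, the inner one is that of a power of v, and \<beta> is the
  exponent for which the resulting power of |r| is the kernel of the energy.\<close>

lemma level_energy:
  fixes g :: "real \<Rightarrow> ennreal" and q s p M :: real
  assumes [measurable]: "g \<in> borel_measurable borel"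
    and "0 < s" "1 < p" "p < q" "0 < M"
  defines "\<beta> \<equiv> (q - p) / (s * p)"
  shows "(\<integral>\<^sup>+v. (if 0 < v then ennreal (v powr (q - 1 - p))
            * (\<integral>\<^sup>+t\<in>{-1..1}. g ((v / M) powr (- \<beta>) * t) \<partial>lborel) else 0) \<partial>lborel)
       \<le> ennreal (M powr (q - p) / (q - p + \<beta>)) * (\<integral>\<^sup>+r. g r * ennreal (1 / \<bar>r\<bar> powr (1 + s * p)) \<partial>lborel)"
proof -
  have \<beta>: "0 < \<beta>" and sp: "(q - p) / \<beta> = s * p"
    using assms by (auto simp: \<beta>_def)
  have "(\<integral>\<^sup>+v. (if 0 < v then ennreal (v powr (q - 1 - p))
            * (\<integral>\<^sup>+t\<in>{-1..1}. g ((v / M) powr (- \<beta>) * t) \<partial>lborel) else 0) \<partial>lborel)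
      = (\<integral>\<^sup>+v. (\<integral>\<^sup>+r. (if 0 < v \<and> \<bar>r\<bar> \<le> (v / M) powr (- \<beta>)
            then ennreal (v powr (q - 1 - p) * (v / M) powr \<beta>) * g r else 0) \<partial>lborel) \<partial>lborel)"
  proof (intro nn_integral_cong)
    fix v :: real
    show "(if 0 < v then ennreal (v powr (q - 1 - p))
            * (\<integral>\<^sup>+t\<in>{-1..1}. g ((v / M) powr (- \<beta>) * t) \<partial>lborel) else 0)
      = (\<integral>\<^sup>+r. (if 0 < v \<and> \<bar>r\<bar> \<le> (v / M) powr (- \<beta>)
            then ennreal (v powr (q - 1 - p) * (v / M) powr \<beta>) * g r else 0) \<partial>lborel)"
    proof (cases "0 < v")
      case True
      define l where "l = (v / M) powr (- \<beta>)"
      have l: "0 < l" "1 / l = (v / M) powr \<beta>"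
        using True assms(5) by (auto simp: l_def powr_minus divide_simps)
      have "ennreal (v powr (q - 1 - p)) * (\<integral>\<^sup>+t\<in>{-1..1}. g (l * t) \<partial>lborel)
          = ennreal (v powr (q - 1 - p) * (v / M) powr \<beta>) * (\<integral>\<^sup>+r\<in>{-l..l}. g r \<partial>lborel)"
        using l by (subst nn_integral_interval_scale) (auto simp: ennreal_mult mult.assoc)
      also have "\<dots> = (\<integral>\<^sup>+r. ennreal (v powr (q - 1 - p) * (v / M) powr \<beta>) * (g r * indicator {-l..l} r) \<partial>lborel)"
        by (rule nn_integral_cmult[symmetric]) measurable
      also have "\<dots> = (\<integral>\<^sup>+r. (if \<bar>r\<bar> \<le> l then ennreal (v powr (q - 1 - p) * (v / M) powr \<beta>) * g r else 0) \<partial>lborel)"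
        by (intro nn_integral_cong) (auto simp: indicator_def)
      finally show ?thesis
        using True by (simp add: l_def)
    qed simp
  qed
  also have "\<dots> = (\<integral>\<^sup>+r. (\<integral>\<^sup>+v. (if 0 < v \<and> \<bar>r\<bar> \<le> (v / M) powr (- \<beta>)
            then ennreal (v powr (q - 1 - p) * (v / M) powr \<beta>) * g r else 0) \<partial>lborel) \<partial>lborel)"
    by (rule lborel_pair.Fubini') measurable
  also have "\<dots> \<le> (\<integral>\<^sup>+r. ennreal (M powr (q - p) / (q - p + \<beta>)) * (g r * ennreal (1 / \<bar>r\<bar> powr (1 + s * p))) \<partial>lborel)"
  proof (rule nn_integral_mono_AE)
    \<comment> \<open>At r = 0 the kernel on the right is 0 by the convention for division, so the
      comparison is made off this null set.\<close>
    have "AE r in lborel. r \<noteq> (0::real)"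
      by (rule AE_lborel_singleton)
    then show "AE r in lborel. (\<integral>\<^sup>+v. (if 0 < v \<and> \<bar>r\<bar> \<le> (v / M) powr (- \<beta>)
            then ennreal (v powr (q - 1 - p) * (v / M) powr \<beta>) * g r else 0) \<partial>lborel)
        \<le> ennreal (M powr (q - p) / (q - p + \<beta>)) * (g r * ennreal (1 / \<bar>r\<bar> powr (1 + s * p)))"
    proof eventually_elim
      case (elim r)
      \<comment> \<open>The largest level v at which \<open>r\<close> still lies in the interval of
        integration.\<close>
      define \<Lambda> where "\<Lambda> = M * \<bar>r\<bar> powr (- (1 / \<beta>))"
      have le_\<Lambda>: "v \<le> \<Lambda>" if "0 < v" "\<bar>r\<bar> \<le> (v / M) powr (- \<beta>)" for v
      proof -
        have "((v / M) powr (- \<beta>)) powr (- (1 / \<beta>)) \<le> \<bar>r\<bar> powr (- (1 / \<beta>))"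
          using that elim \<beta> by (intro powr_mono2') auto
        then have "v / M \<le> \<bar>r\<bar> powr (- (1 / \<beta>))"
          using \<beta> that assms(5) by (simp add: powr_powr)
        then show ?thesis
          using assms(5) by (simp add: \<Lambda>_def field_simps)
      qed
      have "(\<integral>\<^sup>+v. (if 0 < v \<and> \<bar>r\<bar> \<le> (v / M) powr (- \<beta>)
            then ennreal (v powr (q - 1 - p) * (v / M) powr \<beta>) * g r else 0) \<partial>lborel)
          \<le> (\<integral>\<^sup>+v. ennreal (M powr (- \<beta>)) * g r * (if 0 < v \<and> v \<le> \<Lambda> then ennreal (v powr ((q - p + \<beta>) - 1)) else 0) \<partial>lborel)"
      proof (intro nn_integral_mono)
        fix v :: real
        have "v powr (q - 1 - p) * (v / M) powr \<beta> = M powr (- \<beta>) * v powr ((q - p + \<beta>) - 1)" if "0 < v"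
        proof -
          have "(v / M) powr \<beta> = v powr \<beta> * M powr (- \<beta>)"
            using that assms(5) by (simp add: powr_divide powr_minus field_simps)
          moreover have "v powr (q - 1 - p) * v powr \<beta> = v powr ((q - p + \<beta>) - 1)"
            by (simp add: powr_add[symmetric] algebra_simps)
          ultimately show ?thesis by (simp add: mult.commute mult.left_commute)
        qed
        then show "(if 0 < v \<and> \<bar>r\<bar> \<le> (v / M) powr (- \<beta>)
            then ennreal (v powr (q - 1 - p) * (v / M) powr \<beta>) * g r else 0)
          \<le> ennreal (M powr (- \<beta>)) * g r * (if 0 < v \<and> v \<le> \<Lambda> then ennreal (v powr ((q - p + \<beta>) - 1)) else 0)"
          using le_\<Lambda>[of v] by (auto simp: ennreal_mult mult_ac)
      qed
      also have "\<dots> = ennreal (M powr (- \<beta>)) * g r * ennreal (\<Lambda> powr (q - p + \<beta>) / (q - p + \<beta>))"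
      proof (subst nn_integral_cmult)
        show "ennreal (M powr (- \<beta>)) * g r * (\<integral>\<^sup>+v. (if 0 < v \<and> v \<le> \<Lambda> then ennreal (v powr (q - p + \<beta> - 1)) else 0) \<partial>lborel)
            = ennreal (M powr (- \<beta>)) * g r * ennreal (\<Lambda> powr (q - p + \<beta>) / (q - p + \<beta>))"
          using assms(2-5) \<beta> by (subst nn_integral_powr_from_0) (auto simp: \<Lambda>_def)
      qed measurable
      also have "\<dots> = ennreal (M powr (- \<beta>) * (\<Lambda> powr (q - p + \<beta>) / (q - p + \<beta>))) * g r"
        using assms \<beta> by (subst ennreal_mult) (auto simp: mult_ac)
      also have "M powr (- \<beta>) * (\<Lambda> powr (q - p + \<beta>) / (q - p + \<beta>))
          = M powr (q - p) / (q - p + \<beta>) * (1 / \<bar>r\<bar> powr (1 + s * p))"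
      proof -
        \<comment> \<open>By the choice of \<beta> the quotient (q - p) / \<beta> is s p, and the
          extra \<beta> from the length of the interval supplies the 1 in 1 + s p.\<close>
        have "- (1 / \<beta>) * (q - p + \<beta>) = - (1 + s * p)"
          using \<beta> sp add_divide_distrib[of "q - p" \<beta> \<beta>] by simp
        then have "\<Lambda> powr (q - p + \<beta>) = M powr (q - p + \<beta>) * \<bar>r\<bar> powr (- (1 + s * p))"
          by (simp add: \<Lambda>_def powr_mult powr_powr)
        moreover have "M powr (- \<beta>) * M powr (q - p + \<beta>) = M powr (q - p)"
          by (simp add: powr_add[symmetric])
        moreover have "\<bar>r\<bar> powr (- (1 + s * p)) = 1 / \<bar>r\<bar> powr (1 + s * p)"
          by (simp only: powr_minus_divide)
        ultimately show ?thesis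
          by (simp add: field_simps)
      qed
      also have "ennreal (M powr (q - p) / (q - p + \<beta>) * (1 / \<bar>r\<bar> powr (1 + s * p))) * g r
          = ennreal (M powr (q - p) / (q - p + \<beta>)) * (g r * ennreal (1 / \<bar>r\<bar> powr (1 + s * p)))"
        using assms \<beta> by (subst ennreal_mult) (auto simp: mult_ac)
      finally show ?case .
    qed
  qed
  also have "\<dots> = ennreal (M powr (q - p) / (q - p + \<beta>)) * (\<integral>\<^sup>+r. g r * ennreal (1 / \<bar>r\<bar> powr (1 + s * p)) \<partial>lborel)"
    by (rule nn_integral_cmult) measurable
  finally show ?thesis .
qed

lemma nn_integral_powr_level:
  fixes u :: "'a::euclidean_space \<Rightarrow> real"
  assumes [measurable]: "u \<in> borel_measurable borel" and "0 < q"
  shows "(\<integral>\<^sup>+x. ennreal (\<bar>u x\<bar> powr q) \<partial>lborel)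
    = (\<integral>\<^sup>+v. (if 0 < v then ennreal (q * v powr (q - 1)) * emeasure lborel {x. v \<le> \<bar>u x\<bar>} else 0) \<partial>lborel)"
proof -
  have "(\<integral>\<^sup>+x. ennreal (\<bar>u x\<bar> powr q) \<partial>lborel)
      = (\<integral>\<^sup>+x. (\<integral>\<^sup>+v. (if 0 < v \<and> v \<le> \<bar>u x\<bar> then ennreal (q * v powr (q - 1)) else 0) \<partial>lborel) \<partial>lborel)"
  proof (intro nn_integral_cong)
    fix x
    have "(\<integral>\<^sup>+v. (if 0 < v \<and> v \<le> \<bar>u x\<bar> then ennreal (q * v powr (q - 1)) else 0) \<partial>lborel)
       = (\<integral>\<^sup>+v. ennreal q * (if 0 < v \<and> v \<le> \<bar>u x\<bar> then ennreal (v powr (q - 1)) else 0) \<partial>lborel)"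
      using assms by (intro nn_integral_cong) (auto simp: ennreal_mult)
    also have "\<dots> = ennreal q * ennreal (\<bar>u x\<bar> powr q / q)"
      using assms by (subst nn_integral_cmult) (auto simp: nn_integral_powr_from_0)
    also have "\<dots> = ennreal (\<bar>u x\<bar> powr q)"
      using assms by (subst ennreal_mult[symmetric]) auto
    finally show "ennreal (\<bar>u x\<bar> powr q)
      = (\<integral>\<^sup>+v. (if 0 < v \<and> v \<le> \<bar>u x\<bar> then ennreal (q * v powr (q - 1)) else 0) \<partial>lborel)" ..
  qed
  also have "\<dots> = (\<integral>\<^sup>+v. (\<integral>\<^sup>+x. (if 0 < v \<and> v \<le> \<bar>u x\<bar> then ennreal (q * v powr (q - 1)) else 0) \<partial>lborel) \<partial>lborel)"
    by (rule lborel_pair.Fubini') measurable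
  also have "\<dots> = (\<integral>\<^sup>+v. (if 0 < v then ennreal (q * v powr (q - 1)) * emeasure lborel {x. v \<le> \<bar>u x\<bar>} else 0) \<partial>lborel)"
  proof (intro nn_integral_cong)
    fix v :: real
    have "(\<integral>\<^sup>+x. ennreal (q * v powr (q - 1)) * indicator {x. v \<le> \<bar>u x\<bar>} x \<partial>lborel)
        = ennreal (q * v powr (q - 1)) * emeasure lborel {x. v \<le> \<bar>u x\<bar>}"
      by (rule nn_integral_cmult_indicator) simp
    moreover have "(\<integral>\<^sup>+x. (if 0 < v \<and> v \<le> \<bar>u x\<bar> then ennreal (q * v powr (q - 1)) else 0) \<partial>lborel)
        = (\<integral>\<^sup>+x. ennreal (q * v powr (q - 1)) * indicator {x. v \<le> \<bar>u x\<bar>} x \<partial>lborel)" if "0 < v"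
      using that by (intro nn_integral_cong) (auto simp: indicator_def)
    ultimately show "(\<integral>\<^sup>+x. (if 0 < v \<and> v \<le> \<bar>u x\<bar> then ennreal (q * v powr (q - 1)) else 0) \<partial>lborel)
      = (if 0 < v then ennreal (q * v powr (q - 1)) * emeasure lborel {x. v \<le> \<bar>u x\<bar>} else 0)"
      by simp
  qed
  finally show ?thesis .
qed

section \<open>Averages over boxes\<close>

text \<open>For positive \<open>l\<close> this is the mean of u over the box with corner x and sides
  \<open>l i\<close>: pulled back to the unit cube, which has volume 1, it needs no normalizing
  factor.\<close>

definition box_avg :: "('n::finite \<Rightarrow> real) \<Rightarrow> (real ^ 'n \<Rightarrow> real) \<Rightarrow> real ^ 'n \<Rightarrow> real" where
  "box_avg l u x = (LINT h|lborel. indicator (cbox 0 1) h * u (x + cscale l h))"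

lemma emeasure_cbox_01: "emeasure lborel (cbox 0 (1::real^'n::finite)) = 1"
proof -
  have "(\<Prod>b\<in>Basis. (1 - 0 :: real^'n) \<bullet> b) = 1"
    unfolding prod_Basis_cart by (simp add: inner_axis)
  then show ?thesis
    by (subst emeasure_lborel_cbox) (auto simp: Basis_vec_def inner_axis)
qed

text \<open>Takes the place of Hoelder's inequality on a box. If the volume of the box is a powr (-
  q), the two terms are a and a times the mass.\<close>

lemma box_abs_bound:
  fixes u :: "real ^ 'n::finite \<Rightarrow> real"
  assumes u: "u \<in> Lp lborel q" and q: "1 < q" and l: "\<And>i. 0 < l i" and a: "0 < a"
  shows "(\<integral>\<^sup>+h\<in>cbox 0 1. ennreal \<bar>u (x + cscale l h)\<bar> \<partial>lborel)
     \<le> ennreal (a + a powr (1 - q) / (\<Prod>i\<in>UNIV. l i) * (LINT x|lborel. \<bar>u x\<bar> powr q))"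
proof -
  have [measurable]: "u \<in> borel_measurable borel"
    using LpD(1)[OF u] by simp
  have pos: "0 < (\<Prod>i\<in>UNIV. l i)"
    using l by (intro prod_pos) auto
  have "(\<integral>\<^sup>+h\<in>cbox 0 1. ennreal \<bar>u (x + cscale l h)\<bar> \<partial>lborel)
      \<le> (\<integral>\<^sup>+h. ennreal a * indicator (cbox 0 (1::real^'n)) h
          + ennreal (a powr (1 - q)) * ennreal (\<bar>u (x + cscale l h)\<bar> powr q) \<partial>lborel)"
  proof (intro nn_integral_mono)
    fix h
    show "ennreal \<bar>u (x + cscale l h)\<bar> * indicator (cbox 0 1) h
      \<le> ennreal a * indicator (cbox 0 (1::real^'n)) h
          + ennreal (a powr (1 - q)) * ennreal (\<bar>u (x + cscale l h)\<bar> powr q)"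
      using le_add_powr[OF q abs_ge_zero a, of "u (x + cscale l h)"] a
      by (auto simp: indicator_def ennreal_mult[symmetric] ennreal_plus[symmetric] simp del: ennreal_plus intro!: ennreal_leI)
  qed
  also have "\<dots> = ennreal a + ennreal (a powr (1 - q)) *
      (ennreal (1 / (\<Prod>i\<in>UNIV. l i)) * (\<integral>\<^sup>+x. ennreal (\<bar>u x\<bar> powr q) \<partial>lborel))"
    by (simp add: nn_integral_add nn_integral_cmult emeasure_cbox_01 nn_integral_cmult_indicator
        nn_integral_cscale[OF l, of "\<lambda>x. ennreal (\<bar>u x\<bar> powr q)"])
  also have "(\<integral>\<^sup>+x. ennreal (\<bar>u x\<bar> powr q) \<partial>lborel) = ennreal (LINT x|lborel. \<bar>u x\<bar> powr q)"
    using LpD(2)[OF u] by (simp add: nn_integral_eq_integral)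
  also have "ennreal a + ennreal (a powr (1 - q)) *
      (ennreal (1 / (\<Prod>i\<in>UNIV. l i)) * ennreal (LINT x|lborel. \<bar>u x\<bar> powr q))
    = ennreal (a + a powr (1 - q) * (1 / (\<Prod>i\<in>UNIV. l i) * (LINT x|lborel. \<bar>u x\<bar> powr q)))"
    using pos a by (simp add: ennreal_mult[symmetric] ennreal_plus[symmetric] less_imp_le del: ennreal_plus)
  finally show ?thesis by simp
qed

lemma integrable_box_avg:
  fixes u :: "real ^ 'n::finite \<Rightarrow> real"
  assumes u: "u \<in> Lp lborel q" and q: "1 < q" and l: "\<And>i. 0 < l i"
  shows "integrable lborel (\<lambda>h. indicator (cbox 0 1) h * u (x + cscale l h))"
proof (rule integrableI_bounded)
  have [measurable]: "u \<in> borel_measurable borel"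
    using LpD(1)[OF u] by simp
  show "(\<lambda>h. indicator (cbox 0 1) h * u (x + cscale l h)) \<in> borel_measurable lborel"
    by measurable
  have "(\<integral>\<^sup>+h. ennreal (norm (indicator (cbox 0 1) h * u (x + cscale l h))) \<partial>lborel)
      = (\<integral>\<^sup>+h\<in>cbox 0 1. ennreal \<bar>u (x + cscale l h)\<bar> \<partial>lborel)"
    by (intro nn_integral_cong) (auto simp: indicator_def)
  also have "\<dots> < \<infinity>"
    using box_abs_bound[OF u q, of l 1 x] l by (simp add: le_less_trans)
  finally show "(\<integral>\<^sup>+h. ennreal (norm (indicator (cbox 0 1) h * u (x + cscale l h))) \<partial>lborel) < \<infinity>" .
qed

lemma box_avg_abs_le:
  fixes u :: "real ^ 'n::finite \<Rightarrow> real"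
  assumes u: "u \<in> Lp lborel q" and q: "1 < q" and l: "\<And>i. 0 < l i" and a: "0 < a"
  shows "\<bar>box_avg l u x\<bar> \<le> a + a powr (1 - q) / (\<Prod>i\<in>UNIV. l i) * (LINT x|lborel. \<bar>u x\<bar> powr q)"
proof -
  have pos: "0 < (\<Prod>i\<in>UNIV. l i)"
    using l by (intro prod_pos) auto
  have "ennreal \<bar>box_avg l u x\<bar> \<le> (\<integral>\<^sup>+h. ennreal (norm (indicator (cbox 0 1) h * u (x + cscale l h))) \<partial>lborel)"
    using integral_norm_bound_ennreal[OF integrable_box_avg[OF u q l]] by (simp add: box_avg_def)
  also have "\<dots> = (\<integral>\<^sup>+h\<in>cbox 0 1. ennreal \<bar>u (x + cscale l h)\<bar> \<partial>lborel)"
    by (intro nn_integral_cong) (auto simp: indicator_def)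
  also note box_abs_bound[OF u q l a]
  finally show ?thesis
    using a pos by (subst (asm) ennreal_le_iff) (auto simp: less_imp_le intro!: add_nonneg_nonneg mult_nonneg_nonneg divide_nonneg_nonneg)
qed

lemma box_avg_diff:
  fixes u :: "real ^ 'n::finite \<Rightarrow> real"
  assumes u: "u \<in> Lp lborel q" and q: "1 < q" and l: "\<And>i. 0 < l i"
  shows "ennreal \<bar>c - box_avg l u x\<bar> \<le> (\<integral>\<^sup>+h\<in>cbox 0 1. ennreal \<bar>c - u (x + cscale l h)\<bar> \<partial>lborel)"
proof -
  have "has_bochner_integral lborel (indicator (cbox 0 (1::real^'n)) :: _ \<Rightarrow> real) 1"
    using has_bochner_integral_real_indicator[of "cbox 0 (1::real^'n)" lborel]
    by (simp add: emeasure_cbox_01 measure_def)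
  from has_bochner_integral_mult_left[OF this, of c]
  have c: "has_bochner_integral lborel (\<lambda>h. indicator (cbox 0 (1::real^'n)) h * c) c"
    by simp
  note int = integrable_box_avg[OF u q l, of x]
  have "c - box_avg l u x = (LINT h|lborel. indicator (cbox 0 1) h * c - indicator (cbox 0 1) h * u (x + cscale l h))"
    unfolding box_avg_def
    using c int by (subst Bochner_Integration.integral_diff) (auto simp: has_bochner_integral_iff)
  then have "ennreal \<bar>c - box_avg l u x\<bar>
      \<le> (\<integral>\<^sup>+h. ennreal (norm (indicator (cbox 0 1) h * c - indicator (cbox 0 1) h * u (x + cscale l h))) \<partial>lborel)"
    using integral_norm_bound_ennreal[OF Bochner_Integration.integrable_diff[OF _ int]] c
    by (auto simp: has_bochner_integral_iff)
  also have "\<dots> = (\<integral>\<^sup>+h\<in>cbox 0 1. ennreal \<bar>c - u (x + cscale l h)\<bar> \<partial>lborel)"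
    by (intro nn_integral_cong) (auto simp: indicator_def)
  finally show ?thesis .
qed

section \<open>The refined Sobolev inequality\<close>

text \<open>Origin of the factors: q comes from the layer cake formula, 4 (4 n 2^n) powr (p - 1)
  from the choice of \<open>d\<close> at a given level, 2 ^ (n - 1) from
  \<open>nn_integral_cbox_component\<close>, and the last quotient from \<open>level_energy\<close>
  with 2 M in place of M.\<close>

definition Sobolev_const :: "real \<Rightarrow> real \<Rightarrow> real \<Rightarrow> 'n::finite \<Rightarrow> real" where
  "Sobolev_const q s p i = q * (4 * (4 * CARD('n) * 2 ^ CARD('n)) powr (p - 1)) * 2 ^ (CARD('n) - 1)
     * (2 powr (q - p) / (q - p + (q - p) / (s * p)))"

text \<open>The point is the factor M powr (q - p i). With M = 2 the estimate bounds the energy from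
  below at mass 1 (\<open>J_lower_bound\<close>); with M near 0 it excludes vanishing
  (\<open>nonvanishing\<close>).\<close>

lemma refined_Sobolev:
  fixes u :: "real ^ 'n::finite \<Rightarrow> real" and s p :: "'n \<Rightarrow> real"
  assumes u: "u \<in> Lp lborel q"
    and s: "\<And>i. 0 < s i" and p: "\<And>i. 1 < p i" and pq: "\<And>i. p i < q" and M: "0 < M"
    and avg: "\<And>a x. 0 < a \<Longrightarrow> \<bar>box_avg (\<lambda>i. a powr (- ((q - p i) / (s i * p i)))) u x\<bar> \<le> M * a"
  shows "(\<integral>\<^sup>+x. ennreal (\<bar>u x\<bar> powr q) \<partial>lborel)
       \<le> (\<Sum>i\<in>UNIV. ennreal (Sobolev_const q (s i) (p i) i * M powr (q - p i)) * dir_energy i (s i) (p i) u)"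
proof -
  have [measurable]: "u \<in> borel_measurable borel"
    using LpD(1)[OF u] by simp
  have q: "1 < q"
    using p pq less_trans by blast
  define \<beta> where "\<beta> i = (q - p i) / (s i * p i)" for i
  define N :: real where "N = CARD('n)"
  have N: "0 < N"
    by (simp add: N_def)
  \<comment> \<open>With d = v / D the constant terms d * 2 ^ n, summed over the n directions,
    amount to v / 4. This is half of the lower bound v / 2 for the distance of u to its box average,
    and the other half is left for the energy terms.\<close>
  define D where "D = 4 * N * 2 ^ CARD('n)"
  have D: "0 < D"
    using N by (simp add: D_def)
  define K where "K i = 4 * D powr (p i - 1)" for i
  have K: "0 \<le> K i" for i
    by (simp add: K_def)
  define I where "I i v = (\<integral>\<^sup>+t\<in>{-1..1}. dir_mod i (p i) u ((v / (2 * M)) powr (- \<beta> i) * t) \<partial>lborel)" for i v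
  have I_meas[measurable]: "I i \<in> borel_measurable borel" for i
    unfolding I_def by measurable
  have level: "emeasure lborel {x. v \<le> \<bar>u x\<bar>} \<le> (\<Sum>i\<in>UNIV. ennreal (K i * v powr (- p i)) * (2 ^ (CARD('n) - 1) * I i v))"
    if v: "0 < v" for v
  proof -
    define a where "a = v / (2 * M)"
    have a: "0 < a" "M * a = v / 2"
      using v M by (auto simp: a_def)
    define l where "l i = a powr (- \<beta> i)" for i
    have l: "0 < l i" for i
      using a by (simp add: l_def)
    obtain \<Phi> where \<Phi>_meas[measurable]: "\<And>i. \<Phi> i \<in> borel_measurable borel"
      and \<Phi>: "\<And>d x. 0 < d \<Longrightarrow> (\<integral>\<^sup>+h\<in>cbox (-1) 1. ennreal \<bar>u x - u (x + cscale l h)\<bar> \<partial>lborel)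
        \<le> (\<Sum>i\<in>UNIV. ennreal (d * 2 ^ CARD('n)) + ennreal (d powr (1 - p i)) * \<Phi> i x)"
      and \<Phi>_int: "\<And>i. (\<integral>\<^sup>+x. \<Phi> i x \<partial>lborel)
        = 2 ^ (CARD('n) - 1) * (\<integral>\<^sup>+t\<in>{-1..1}. dir_mod i (p i) u (l i * t) \<partial>lborel)"
      using box_average_telescope[of u p l] p by (auto 4 0)
    define d where "d = v / D"
    have d: "0 < d" and nd: "N * (d * 2 ^ CARD('n)) = v / 4"
      using v D N by (auto simp: d_def D_def)
    have "indicator {x. v \<le> \<bar>u x\<bar>} x \<le> (\<Sum>i\<in>UNIV. ennreal (K i * v powr (- p i)) * \<Phi> i x)" for x
    proof (cases "v \<le> \<bar>u x\<bar>")
      case True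
      have half: "ennreal (v / 2) = ennreal (v / 4) + ennreal (v / 4)"
        using v ennreal_plus[of "v / 4" "v / 4"] by simp
      have "\<bar>box_avg l u x\<bar> \<le> v / 2"
        using avg[OF a(1), of x] a(2) by (simp add: l_def[abs_def] \<beta>_def)
      then have "ennreal (v / 2) \<le> ennreal \<bar>u x - box_avg l u x\<bar>"
        using True by (intro ennreal_leI) linarith
      also have "\<dots> \<le> (\<integral>\<^sup>+h\<in>cbox 0 1. ennreal \<bar>u x - u (x + cscale l h)\<bar> \<partial>lborel)"
        by (rule box_avg_diff[OF u q l])
      also have "\<dots> \<le> (\<integral>\<^sup>+h\<in>cbox (-1) 1. ennreal \<bar>u x - u (x + cscale l h)\<bar> \<partial>lborel)"
      proof (intro nn_integral_mono mult_left_mono indicator_leI)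
        show "h \<in> cbox (-1) 1" if "h \<in> cbox 0 1" for h :: "real ^ 'n"
          using that by (auto simp: mem_box_cart) (meson order_trans neg_le_0_iff_le zero_le_one)
      qed simp
      also have "\<dots> \<le> (\<Sum>i\<in>UNIV. ennreal (d * 2 ^ CARD('n)) + ennreal (d powr (1 - p i)) * \<Phi> i x)"
        by (rule \<Phi>[OF d])
      also have "\<dots> = ennreal N * ennreal (d * 2 ^ CARD('n)) + (\<Sum>i\<in>UNIV. ennreal (d powr (1 - p i)) * \<Phi> i x)"
        by (simp add: sum.distrib N_def ennreal_of_nat_eq_real_of_nat)
      also have "ennreal N * ennreal (d * 2 ^ CARD('n)) = ennreal (v / 4)"
        using N d by (simp add: ennreal_mult[symmetric] nd)
      finally have "ennreal (v / 4) + ennreal (v / 4) \<le> ennreal (v / 4) + (\<Sum>i\<in>UNIV. ennreal (d powr (1 - p i)) * \<Phi> i x)"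
        using half by simp
      then have "ennreal (v / 4) \<le> (\<Sum>i\<in>UNIV. ennreal (d powr (1 - p i)) * \<Phi> i x)"
        by (subst (asm) ennreal_add_left_cancel_le) auto
      then have "ennreal (4 / v) * ennreal (v / 4) \<le> ennreal (4 / v) * (\<Sum>i\<in>UNIV. ennreal (d powr (1 - p i)) * \<Phi> i x)"
        by (rule mult_left_mono) simp
      also have "ennreal (4 / v) * ennreal (v / 4) = 1"
        using v by (simp add: ennreal_mult[symmetric])
      also have "ennreal (4 / v) * (\<Sum>i\<in>UNIV. ennreal (d powr (1 - p i)) * \<Phi> i x)
          = (\<Sum>i\<in>UNIV. ennreal (K i * v powr (- p i)) * \<Phi> i x)"
      proof (subst sum_distrib_left, rule sum.cong)
        fix i
        have "4 / v * d powr (1 - p i) = 4 * D powr (p i - 1) * (v powr (1 - p i) / v)"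
          using v D by (simp add: d_def powr_divide powr_diff field_simps)
        also have "v powr (1 - p i) / v = v powr (- p i)"
          using v by (simp add: powr_diff powr_minus divide_simps)
        finally have "4 / v * d powr (1 - p i) = K i * v powr (- p i)"
          by (simp add: K_def)
        then have "ennreal (4 / v) * ennreal (d powr (1 - p i)) = ennreal (K i * v powr (- p i))"
          using v by (simp add: ennreal_mult[symmetric])
        then show "ennreal (4 / v) * (ennreal (d powr (1 - p i)) * \<Phi> i x) = ennreal (K i * v powr (- p i)) * \<Phi> i x"
          by (simp add: mult.assoc[symmetric])
      qed simp
      finally show ?thesis
        using True by simp
    qed simp
    then have "(\<integral>\<^sup>+x. indicator {x. v \<le> \<bar>u x\<bar>} x \<partial>lborel)
        \<le> (\<integral>\<^sup>+x. (\<Sum>i\<in>UNIV. ennreal (K i * v powr (- p i)) * \<Phi> i x) \<partial>lborel)"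
      by (intro nn_integral_mono) auto
    also have "\<dots> = (\<Sum>i\<in>UNIV. ennreal (K i * v powr (- p i)) * (\<integral>\<^sup>+x. \<Phi> i x \<partial>lborel))"
      by (subst nn_integral_sum) (auto simp: nn_integral_cmult)
    also have "\<dots> = (\<Sum>i\<in>UNIV. ennreal (K i * v powr (- p i)) * (2 ^ (CARD('n) - 1) * I i v))"
      by (simp add: \<Phi>_int I_def l_def a_def)
    finally show ?thesis
      by simp
  qed
  have "(\<integral>\<^sup>+x. ennreal (\<bar>u x\<bar> powr q) \<partial>lborel)
    = (\<integral>\<^sup>+v. (if 0 < v then ennreal (q * v powr (q - 1)) * emeasure lborel {x. v \<le> \<bar>u x\<bar>} else 0) \<partial>lborel)"
    using q by (intro nn_integral_powr_level) auto
  also have "\<dots> \<le> (\<integral>\<^sup>+v. (\<Sum>i\<in>UNIV. ennreal (q * K i * 2 ^ (CARD('n) - 1)) *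
      (if 0 < v then ennreal (v powr (q - 1 - p i)) * I i v else 0)) \<partial>lborel)"
  proof (intro nn_integral_mono)
    fix v :: real
    show "(if 0 < v then ennreal (q * v powr (q - 1)) * emeasure lborel {x. v \<le> \<bar>u x\<bar>} else 0)
      \<le> (\<Sum>i\<in>UNIV. ennreal (q * K i * 2 ^ (CARD('n) - 1)) *
            (if 0 < v then ennreal (v powr (q - 1 - p i)) * I i v else 0))"
    proof (cases "0 < v")
      case True
      have "ennreal (q * v powr (q - 1)) * emeasure lborel {x. v \<le> \<bar>u x\<bar>}
         \<le> ennreal (q * v powr (q - 1)) * (\<Sum>i\<in>UNIV. ennreal (K i * v powr (- p i)) * (2 ^ (CARD('n) - 1) * I i v))"
        by (intro mult_left_mono level True) simp
      also have "\<dots> = (\<Sum>i\<in>UNIV. ennreal (q * K i * 2 ^ (CARD('n) - 1)) * (ennreal (v powr (q - 1 - p i)) * I i v))"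
      proof (subst sum_distrib_left, rule sum.cong)
        fix i
        have "v powr (q - 1 - p i) = v powr (q - 1) * v powr (- p i)"
          by (simp add: powr_add[symmetric])
        then show "ennreal (q * v powr (q - 1)) * (ennreal (K i * v powr (- p i)) * (2 ^ (CARD('n) - 1) * I i v))
           = ennreal (q * K i * 2 ^ (CARD('n) - 1)) * (ennreal (v powr (q - 1 - p i)) * I i v)"
          using K[of i] q by (simp add: ennreal_mult ennreal_power[symmetric] mult_ac)
      qed simp
      finally show ?thesis
        using True by simp
    qed simp
  qed
  also have "\<dots> = (\<Sum>i\<in>UNIV. ennreal (q * K i * 2 ^ (CARD('n) - 1)) *
      (\<integral>\<^sup>+v. (if 0 < v then ennreal (v powr (q - 1 - p i)) * I i v else 0) \<partial>lborel))"
    by (subst nn_integral_sum) (auto simp: nn_integral_cmult)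
  also have "\<dots> \<le> (\<Sum>i\<in>UNIV. ennreal (q * K i * 2 ^ (CARD('n) - 1)) *
      (ennreal ((2 * M) powr (q - p i) / (q - p i + \<beta> i)) * dir_energy i (s i) (p i) u))"
    unfolding I_def \<beta>_def dir_energy_def
    using s p pq M by (intro sum_mono mult_left_mono level_energy) auto
  also have "\<dots> = (\<Sum>i\<in>UNIV. ennreal (Sobolev_const q (s i) (p i) i * M powr (q - p i)) * dir_energy i (s i) (p i) u)"
  proof (rule sum.cong)
    fix i
    have "0 \<le> (2 * M) powr (q - p i) / (q - p i + \<beta> i)"
      using pq[of i] s[of i] p[of i] by (auto simp: \<beta>_def intro!: divide_nonneg_nonneg add_nonneg_nonneg)
    moreover have "q * K i * 2 ^ (CARD('n) - 1) * ((2 * M) powr (q - p i) / (q - p i + \<beta> i))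
        = Sobolev_const q (s i) (p i) i * M powr (q - p i)"
      using M by (simp add: Sobolev_const_def K_def D_def N_def \<beta>_def powr_mult)
    ultimately show "ennreal (q * K i * 2 ^ (CARD('n) - 1)) *
      (ennreal ((2 * M) powr (q - p i) / (q - p i + \<beta> i)) * dir_energy i (s i) (p i) u)
      = ennreal (Sobolev_const q (s i) (p i) i * M powr (q - p i)) * dir_energy i (s i) (p i) u"
      using K[of i] q by (simp add: mult.assoc[symmetric] ennreal_mult[symmetric])
  qed simp
  finally show ?thesis .
qed

section \<open>Almost everywhere compactness\<close>

text \<open>Tychonoff's theorem instead of a diagonal argument: the product of the intervals is
  compact, and over a countable index type this gives sequential compactness.\<close>

lemma pointwise_convergent_subseq:
  fixes f :: "nat \<Rightarrow> 'a::countable \<Rightarrow> real"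
  assumes "\<And>k z. \<bar>f k z\<bar> \<le> B z"
  obtains r where "strict_mono r" "\<And>z. convergent (\<lambda>k. f (r k) z)"
proof -
  have "compactin (product_topology (\<lambda>_::'a. euclidean) UNIV) (PiE UNIV (\<lambda>z. {- B z..B z}))"
    by (subst compactin_PiE) (auto simp: compactin_euclidean_iff)
  then have "compact (PiE UNIV (\<lambda>z. {- B z..B z}))"
    by (simp add: euclidean_product_topology compactin_euclidean_iff)
  then have "seq_compact (PiE UNIV (\<lambda>z. {- B z..B z}))"
    by (rule compact_imp_seq_compact)
  moreover have "f k z \<in> {- B z..B z}" for k z
    unfolding atLeastAtMost_iff using assms[of k z] by linarith
  then have "f k \<in> PiE UNIV (\<lambda>z. {- B z..B z})" for k
    by (intro PiE_I) auto
  ultimately obtain l r where lr: "strict_mono r" "(f \<circ> r) \<longlonglongrightarrow> l"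
    using seq_compactE by metis
  have "convergent (\<lambda>k. f (r k) z)" for z
  proof -
    have "continuous_on UNIV (\<lambda>x::'a \<Rightarrow> real. x z)"
      by (rule continuous_on_product_coordinates)
    then have "isCont (\<lambda>x::'a \<Rightarrow> real. x z) l"
      using continuous_on_eq_continuous_at[OF open_UNIV, of "\<lambda>x::'a \<Rightarrow> real. x z"] by blast
    from isCont_tendsto_compose[OF this lr(2)] show ?thesis
      by (auto simp: convergent_def)
  qed
  with lr(1) show thesis
    using that by blast
qed

text \<open>A subsequence whose successive weighted L^1 distances are at most 2^(-j) has absolutely
  summable increments almost everywhere. As \<open>w\<close> is positive everywhere, summability of
  the weighted increments at a point implies that of the increments themselves.\<close>

lemma AE_convergent_subseq:
  fixes f :: "nat \<Rightarrow> 'a \<Rightarrow> real" and w :: "'a \<Rightarrow> real"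
  assumes [measurable]: "\<And>k. f k \<in> borel_measurable M" "w \<in> borel_measurable M"
    and w: "\<And>x. 0 < w x"
    and Cauchy: "\<And>e. 0 < e \<Longrightarrow> \<exists>N. \<forall>k\<ge>N. \<forall>l\<ge>N. (\<integral>\<^sup>+x. ennreal (w x * \<bar>f k x - f l x\<bar>) \<partial>M) \<le> ennreal e"
  obtains r where "strict_mono (r :: nat \<Rightarrow> nat)" "AE x in M. convergent (\<lambda>k. f (r k) x)"
proof -
  have "\<forall>j. \<exists>N. \<forall>k\<ge>N. \<forall>l\<ge>N. (\<integral>\<^sup>+x. ennreal (w x * \<bar>f k x - f l x\<bar>) \<partial>M) \<le> ennreal ((1/2) ^ j)"
    by (intro allI Cauchy) simp
  then obtain N where N: "\<And>j k l. N j \<le> k \<Longrightarrow> N j \<le> l \<Longrightarrow>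
      (\<integral>\<^sup>+x. ennreal (w x * \<bar>f k x - f l x\<bar>) \<partial>M) \<le> ennreal ((1/2) ^ j)"
    by metis
  \<comment> \<open>The sum exceeds every \<open>N i\<close> with i <= j, so \<open>r j\<close> and
    \<open>r (Suc j)\<close> both lie beyond \<open>N j\<close>; the summand j makes
    \<open>r\<close> strictly increasing.\<close>
  define r where "r j = j + (\<Sum>i\<le>j. N i)" for j
  have r: "strict_mono r"
    by (auto simp: strict_mono_Suc_iff r_def)
  have N_le: "N j \<le> r j" "N j \<le> r (Suc j)" for j
    using member_le_sum[of j "{..j}" N] by (auto simp: r_def)
  define D where "D j x = w x * \<bar>f (r (Suc j)) x - f (r j) x\<bar>" for j x
  have [measurable]: "D j \<in> borel_measurable M" for j
    unfolding D_def by measurable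
  have "(\<integral>\<^sup>+x. (\<Sum>j. ennreal (D j x)) \<partial>M) = (\<Sum>j. \<integral>\<^sup>+x. ennreal (D j x) \<partial>M)"
    by (rule nn_integral_suminf) measurable
  also have "\<dots> \<le> (\<Sum>j. ennreal ((1/2) ^ j))"
    unfolding D_def by (intro suminf_le N N_le summableI)
  also have "\<dots> < \<infinity>"
    by (subst suminf_ennreal2) (auto intro!: summable_geometric)
  finally have "AE x in M. (\<Sum>j. ennreal (D j x)) \<noteq> \<infinity>"
    by (intro nn_integral_PInf_AE) auto
  then have "AE x in M. convergent (\<lambda>k. f (r k) x)"
  proof eventually_elim
    case (elim x)
    have "summable (\<lambda>j. D j x)"
      using elim w by (intro summable_suminf_not_top) (auto simp: D_def less_imp_le)
    then have "summable (\<lambda>j. \<bar>f (r (Suc j)) x - f (r j) x\<bar>)"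
      using summable_cmult_iff[of "w x" "\<lambda>j. \<bar>f (r (Suc j)) x - f (r j) x\<bar>"] w[of x]
      by (simp add: D_def)
    then have "summable (\<lambda>j. f (r (Suc j)) x - f (r j) x)"
      by (rule summable_rabs_cancel)
    then have "convergent (\<lambda>k. \<Sum>j<k. f (r (Suc j)) x - f (r j) x)"
      by (simp add: summable_iff_convergent)
    then have "convergent (\<lambda>k. f (r k) x - f (r 0) x)"
      by (simp add: sum_lessThan_telescope[of "\<lambda>j. f (r j) x"])
    from convergent_add[OF this convergent_const[of "f (r 0) x"]] show ?case
      by simp
  qed
  with r show thesis
    using that by blast
qed

text \<open>On |r| <= l the constant 1 / l is at most l powr (s p) times the kernel. Averages of the
  modulus over short steps are therefore small, uniformly on sets of bounded energy.\<close>

lemma dir_mod_average_le: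
  fixes u :: "real ^ 'n::finite \<Rightarrow> real"
  assumes [measurable]: "u \<in> borel_measurable borel" and "0 < s" "1 < p" "0 < l"
  shows "(\<integral>\<^sup>+t\<in>{-1..1}. dir_mod i p u (l * t) \<partial>lborel) \<le> ennreal (l powr (s * p)) * dir_energy i s p u"
proof -
  have "(\<integral>\<^sup>+t\<in>{-1..1}. dir_mod i p u (l * t) \<partial>lborel)
      = ennreal (1 / l) * (\<integral>\<^sup>+r\<in>{-l..l}. dir_mod i p u r \<partial>lborel)"
    by (intro nn_integral_interval_scale assms) measurable
  also have "\<dots> = (\<integral>\<^sup>+r. ennreal (1 / l) * (dir_mod i p u r * indicator {-l..l} r) \<partial>lborel)"
    by (rule nn_integral_cmult[symmetric]) measurable
  also have "\<dots> \<le> (\<integral>\<^sup>+r. ennreal (l powr (s * p)) * (dir_mod i p u r * ennreal (1 / \<bar>r\<bar> powr (1 + s * p))) \<partial>lborel)"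
  proof (rule nn_integral_mono_AE)
    have "AE r in lborel. r \<noteq> (0::real)"
      by (rule AE_lborel_singleton)
    then show "AE r in lborel. ennreal (1 / l) * (dir_mod i p u r * indicator {-l..l} r)
        \<le> ennreal (l powr (s * p)) * (dir_mod i p u r * ennreal (1 / \<bar>r\<bar> powr (1 + s * p)))"
    proof eventually_elim
      case (elim r)
      show ?case
      proof (cases "r \<in> {-l..l}")
        case True
        then have "\<bar>r\<bar> powr (1 + s * p) \<le> l powr (1 + s * p)"
          using assms by (intro powr_mono2) auto
        also have "\<dots> = l * l powr (s * p)"
          using assms by (simp add: powr_add)
        finally have "1 / l \<le> l powr (s * p) * (1 / \<bar>r\<bar> powr (1 + s * p))"
          using elim assms by (simp add: field_simps)
        then have "ennreal (1 / l) * dir_mod i p u r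
            \<le> ennreal (l powr (s * p) * (1 / \<bar>r\<bar> powr (1 + s * p))) * dir_mod i p u r"
          by (intro mult_right_mono ennreal_leI) auto
        also have "ennreal (l powr (s * p) * (1 / \<bar>r\<bar> powr (1 + s * p)))
            = ennreal (l powr (s * p)) * ennreal (1 / \<bar>r\<bar> powr (1 + s * p))"
          by (rule ennreal_mult) auto
        finally show ?thesis
          using True by (simp add: mult_ac)
      qed simp
    qed
  qed
  also have "\<dots> = ennreal (l powr (s * p)) * dir_energy i s p u"
    unfolding dir_energy_def by (rule nn_integral_cmult) measurable
  finally show ?thesis .
qed

lemma box_avg_measurable[measurable]:
  assumes [measurable]: "u \<in> borel_measurable borel"
  shows "box_avg l u \<in> borel_measurable borel"
  unfolding box_avg_def by measurable

section \<open>Averages over grid cells and convergence almost everywhere\<close>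

text \<open>Rounds x down to the corner of its cell in a mesh of width e. An average based at the
  corner is constant on the cell, so all cell averages of a function form a countable family of
  numbers.\<close>

definition grid :: "real \<Rightarrow> real ^ 'n::finite \<Rightarrow> real ^ 'n" where
  "grid e x = (\<chi> i. e * of_int \<lfloor>x $ i / e\<rfloor>)"

lemma grid_measurable[measurable]: "(grid e :: real ^ 'n::finite \<Rightarrow> real ^ 'n) \<in> borel_measurable borel"
proof (rule borel_measurable_euclidean_space[THEN iffD2], rule ballI)
  fix b :: "real ^ 'n" assume "b \<in> Basis"
  then obtain i where "b = axis i 1"
    by (auto simp: Basis_vec_def)
  then have "(\<lambda>x. grid e x \<bullet> b) = (\<lambda>x. e * of_int \<lfloor>x $ i / e\<rfloor>)"
    by (simp add: grid_def inner_axis)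
  also have "\<dots> \<in> borel_measurable borel"
    by measurable
  finally show "(\<lambda>x. grid e x \<bullet> b) \<in> borel_measurable borel" .
qed

lemma grid_average_diff:
  fixes u :: "real ^ 'n::finite \<Rightarrow> real"
  assumes u: "u \<in> Lp lborel q" and q: "1 < q" and e: "0 < e"
  shows "ennreal \<bar>u x - box_avg (\<lambda>_. e) u (grid e x)\<bar>
    \<le> (\<integral>\<^sup>+h\<in>cbox (-1) 1. ennreal \<bar>u x - u (x + cscale (\<lambda>_. e) h)\<bar> \<partial>lborel)"
proof -
  have [measurable]: "u \<in> borel_measurable borel"
    using LpD(1)[OF u] by simp
  \<comment> \<open>The corner of the cell relative to x, in units of e. Its entries lie in [-1, 0],
    so the cell is contained in the cube of half-width e around x.\<close>
  define t where "t = cscale (\<lambda>_. 1 / e) (grid e x - x)"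
  have shift: "grid e x + cscale (\<lambda>_. e) h = x + cscale (\<lambda>_. e) (h + t)" for h
    using e by (simp add: t_def cscale_add cscale_cscale) (simp add: cscale_def vec_eq_iff)
  have t: "- 1 \<le> t $ i \<and> t $ i \<le> 0" for i
  proof -
    have "t $ i = of_int \<lfloor>x $ i / e\<rfloor> - x $ i / e"
      using e by (simp add: t_def cscale_def grid_def field_simps)
    then show ?thesis
      by linarith
  qed
  have "ennreal \<bar>u x - box_avg (\<lambda>_. e) u (grid e x)\<bar>
      \<le> (\<integral>\<^sup>+h\<in>cbox 0 1. ennreal \<bar>u x - u (grid e x + cscale (\<lambda>_. e) h)\<bar> \<partial>lborel)"
    using e by (intro box_avg_diff[OF u q])
  also have "\<dots> \<le> (\<integral>\<^sup>+h. ennreal \<bar>u x - u (x + cscale (\<lambda>_. e) (h + t))\<bar> * indicator (cbox (-1) 1) (h + t) \<partial>lborel)"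
  proof (intro nn_integral_mono)
    fix h :: "real ^ 'n"
    have "h + t \<in> cbox (-1) 1" if "h \<in> cbox 0 1"
      unfolding mem_box_cart
    proof
      fix i
      show "(- 1 :: real^'n) $ i \<le> (h + t) $ i \<and> (h + t) $ i \<le> (1 :: real^'n) $ i"
        using that[unfolded mem_box_cart, rule_format, of i] t[of i] by simp
    qed
    then show "ennreal \<bar>u x - u (grid e x + cscale (\<lambda>_. e) h)\<bar> * indicator (cbox 0 1) h
        \<le> ennreal \<bar>u x - u (x + cscale (\<lambda>_. e) (h + t))\<bar> * indicator (cbox (-1) 1) (h + t)"
      by (auto simp: shift indicator_def)
  qed
  also have "\<dots> = (\<integral>\<^sup>+h\<in>cbox (-1) 1. ennreal \<bar>u x - u (x + cscale (\<lambda>_. e) h)\<bar> \<partial>lborel)"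
    by (rule nn_integral_translate[of "\<lambda>h. ennreal \<bar>u x - u (x + cscale (\<lambda>_. e) h)\<bar> * indicator (cbox (-1) 1) h" t]) measurable
  finally show ?thesis .
qed

text \<open>The constant d * 2 ^ n is not integrable over the whole space and is paid for by
  \<open>w\<close>, whereas the energy terms are integrated with just w <= 1. Taking first d and
  then e small makes the bound small, uniformly in all u with energies at most K.\<close>

lemma grid_average_weighted:
  fixes u :: "real ^ 'n::finite \<Rightarrow> real" and w :: "real ^ 'n \<Rightarrow> real"
  assumes u: "u \<in> Lp lborel q" and q: "1 < q" and e: "0 < e" and d: "0 < d"
    and s: "\<And>i. 0 < s i" and p: "\<And>i. 1 < p i" and K: "0 \<le> K"
    and en: "\<And>i. dir_energy i (s i) (p i) u \<le> ennreal K"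
    and w: "integrable lborel w" "\<And>x. 0 < w x" "\<And>x. w x \<le> 1"
  shows "(\<integral>\<^sup>+x. ennreal (w x * \<bar>u x - box_avg (\<lambda>_. e) u (grid e x)\<bar>) \<partial>lborel)
    \<le> ennreal (\<Sum>i\<in>UNIV. d * 2 ^ CARD('n) * (LINT x|lborel. w x)
         + d powr (1 - p i) * (2 ^ (CARD('n) - 1) * (e powr (s i * p i) * K)))"
proof -
  have [measurable]: "u \<in> borel_measurable borel"
    using LpD(1)[OF u] by simp
  have [measurable]: "w \<in> borel_measurable borel"
    using borel_measurable_integrable[OF w(1)] by simp
  obtain \<Phi> where \<Phi>_meas[measurable]: "\<And>i. \<Phi> i \<in> borel_measurable borel"
    and \<Phi>: "\<And>d x. 0 < d \<Longrightarrow> (\<integral>\<^sup>+h\<in>cbox (-1) 1. ennreal \<bar>u x - u (x + cscale (\<lambda>_. e) h)\<bar> \<partial>lborel)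
      \<le> (\<Sum>i\<in>UNIV. ennreal (d * 2 ^ CARD('n)) + ennreal (d powr (1 - p i)) * \<Phi> i x)"
    and \<Phi>_int: "\<And>i. (\<integral>\<^sup>+x. \<Phi> i x \<partial>lborel)
      = 2 ^ (CARD('n) - 1) * (\<integral>\<^sup>+t\<in>{-1..1}. dir_mod i (p i) u (e * t) \<partial>lborel)"
    using box_average_telescope[of u p "\<lambda>_. e"] p by (auto 4 0)
  have "(\<integral>\<^sup>+x. ennreal (w x * \<bar>u x - box_avg (\<lambda>_. e) u (grid e x)\<bar>) \<partial>lborel)
      \<le> (\<integral>\<^sup>+x. (\<Sum>i\<in>UNIV. ennreal (d * 2 ^ CARD('n)) * ennreal (w x) + ennreal (d powr (1 - p i)) * \<Phi> i x) \<partial>lborel)"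
  proof (intro nn_integral_mono)
    fix x
    have "ennreal (w x * \<bar>u x - box_avg (\<lambda>_. e) u (grid e x)\<bar>)
        = ennreal (w x) * ennreal \<bar>u x - box_avg (\<lambda>_. e) u (grid e x)\<bar>"
      using w(2)[of x] by (simp add: ennreal_mult)
    also have "\<dots> \<le> ennreal (w x) * (\<Sum>i\<in>UNIV. ennreal (d * 2 ^ CARD('n)) + ennreal (d powr (1 - p i)) * \<Phi> i x)"
      by (intro mult_left_mono order_trans[OF grid_average_diff[OF u q e] \<Phi>[OF d]]) simp
    also have "\<dots> = (\<Sum>i\<in>UNIV. ennreal (d * 2 ^ CARD('n)) * ennreal (w x) + ennreal (w x) * (ennreal (d powr (1 - p i)) * \<Phi> i x))"
      by (simp add: sum_distrib_left distrib_left mult_ac)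
    also have "\<dots> \<le> (\<Sum>i\<in>UNIV. ennreal (d * 2 ^ CARD('n)) * ennreal (w x) + ennreal (d powr (1 - p i)) * \<Phi> i x)"
    proof (intro sum_mono add_left_mono)
      fix i
      have "ennreal (w x) * (ennreal (d powr (1 - p i)) * \<Phi> i x) \<le> 1 * (ennreal (d powr (1 - p i)) * \<Phi> i x)"
        using w(3)[of x] by (intro mult_right_mono) auto
      then show "ennreal (w x) * (ennreal (d powr (1 - p i)) * \<Phi> i x) \<le> ennreal (d powr (1 - p i)) * \<Phi> i x"
        by simp
    qed
    finally show "ennreal (w x * \<bar>u x - box_avg (\<lambda>_. e) u (grid e x)\<bar>)
        \<le> (\<Sum>i\<in>UNIV. ennreal (d * 2 ^ CARD('n)) * ennreal (w x) + ennreal (d powr (1 - p i)) * \<Phi> i x)" .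
  qed
  also have "\<dots> = (\<Sum>i\<in>UNIV. ennreal (d * 2 ^ CARD('n)) * (\<integral>\<^sup>+x. ennreal (w x) \<partial>lborel)
      + ennreal (d powr (1 - p i)) * (\<integral>\<^sup>+x. \<Phi> i x \<partial>lborel))"
    by (subst nn_integral_sum) (auto simp: nn_integral_cmult nn_integral_add)
  also have "\<dots> \<le> (\<Sum>i\<in>UNIV. ennreal (d * 2 ^ CARD('n)) * ennreal (LINT x|lborel. w x)
      + ennreal (d powr (1 - p i)) * (2 ^ (CARD('n) - 1) * (ennreal (e powr (s i * p i)) * ennreal K)))"
  proof (intro sum_mono add_mono mult_left_mono)
    show "(\<integral>\<^sup>+x. ennreal (w x) \<partial>lborel) \<le> ennreal (LINT x|lborel. w x)"
      using w by (subst nn_integral_eq_integral) (auto simp: less_imp_le)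
    fix i
    have "(\<integral>\<^sup>+t\<in>{-1..1}. dir_mod i (p i) u (e * t) \<partial>lborel) \<le> ennreal (e powr (s i * p i)) * dir_energy i (s i) (p i) u"
      using s p e by (intro dir_mod_average_le) auto
    also have "\<dots> \<le> ennreal (e powr (s i * p i)) * ennreal K"
      by (intro mult_left_mono en) simp
    finally show "(\<integral>\<^sup>+x. \<Phi> i x \<partial>lborel) \<le> 2 ^ (CARD('n) - 1) * (ennreal (e powr (s i * p i)) * ennreal K)"
      unfolding \<Phi>_int by (intro mult_left_mono) auto
  qed auto
  also have "\<dots> = (\<Sum>i\<in>UNIV. ennreal (d * 2 ^ CARD('n) * (LINT x|lborel. w x)
         + d powr (1 - p i) * (2 ^ (CARD('n) - 1) * (e powr (s i * p i) * K))))"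
  proof (rule sum.cong)
    fix i
    have W: "0 \<le> (LINT x|lborel. w x)"
      using w by (intro Bochner_Integration.integral_nonneg) (auto simp: less_imp_le)
    show "ennreal (d * 2 ^ CARD('n)) * ennreal (LINT x|lborel. w x)
      + ennreal (d powr (1 - p i)) * (2 ^ (CARD('n) - 1) * (ennreal (e powr (s i * p i)) * ennreal K))
      = ennreal (d * 2 ^ CARD('n) * (LINT x|lborel. w x)
         + d powr (1 - p i) * (2 ^ (CARD('n) - 1) * (e powr (s i * p i) * K)))"
      using d K W by (simp add: ennreal_plus ennreal_mult ennreal_power[symmetric])
  qed simp
  also have "\<dots> = ennreal (\<Sum>i\<in>UNIV. d * 2 ^ CARD('n) * (LINT x|lborel. w x)
         + d powr (1 - p i) * (2 ^ (CARD('n) - 1) * (e powr (s i * p i) * K)))"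
    using d K w by (intro sum_ennreal add_nonneg_nonneg mult_nonneg_nonneg Bochner_Integration.integral_nonneg)
      (auto simp: less_imp_le)
  finally show ?thesis .
qed

text \<open>On a fine mesh u k is close to its cell averages uniformly in k, by the energy bound.
  The cell averages of a fixed mesh are bounded by the mass bound and converge at every point along
  one subsequence. Hence that subsequence is Cauchy in a weighted L^1 norm.\<close>

lemma AE_convergent_subseq_energy:
  fixes u :: "nat \<Rightarrow> real ^ 'n::finite \<Rightarrow> real" and s p :: "'n \<Rightarrow> real"
  assumes u: "\<And>k. u k \<in> Lp lborel q" and q: "1 < q"
    and s: "\<And>i. 0 < s i" and p: "\<And>i. 1 < p i" and K: "0 \<le> K"
    and mass: "\<And>k. (LINT x|lborel. \<bar>u k x\<bar> powr q) \<le> m"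
    and en: "\<And>k i. dir_energy i (s i) (p i) (u k) \<le> ennreal K"
  obtains r v where "strict_mono (r :: nat \<Rightarrow> nat)" "v \<in> borel_measurable borel"
    "AE x in lborel. (\<lambda>k. u (r k) x) \<longlonglongrightarrow> v x"
proof -
  have u_meas[measurable]: "u k \<in> borel_measurable borel" for k
    using LpD(1)[OF u[of k]] by simp
  have m: "0 \<le> m"
    using mass[of 0] by (meson Bochner_Integration.integral_nonneg order_trans powr_ge_zero)
  \<comment> \<open>The weight replaces Lebesgue measure by a finite measure with the same null
    sets.\<close>
  obtain w :: "real ^ 'n \<Rightarrow> real" where w_meas[measurable]: "w \<in> borel_measurable lborel"
    and w: "\<And>x. 0 < w x" "\<And>x. w x \<le> 1" "integrable lborel w"
    using sigma_finite_measure.obtain_positive_integrable_function[OF sigma_finite_lborel] by blast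
  define W where "W = (LINT x|lborel. w x)"
  have W: "0 \<le> W"
    unfolding W_def using w by (intro Bochner_Integration.integral_nonneg) (auto simp: less_imp_le)
  define e where "e N = 1 / (real N + 1)" for N
  have e: "0 < e N" for N
    by (simp add: e_def)
  define node :: "nat \<Rightarrow> ('n \<Rightarrow> int) \<Rightarrow> real ^ 'n" where "node N z = (\<chi> i. e N * of_int (z i))" for N z
  \<comment> \<open>The pairs of a mesh number and an integer node form a countable type, so one
    subsequence \<open>r0\<close> serves all meshes at once.\<close>
  define A where "A k = (\<lambda>(N, z). box_avg (\<lambda>_. e N) (u k) (node N z))" for k
  have A_bound: "\<bar>box_avg (\<lambda>_. e N) (u k) x\<bar> \<le> 1 + 1 / e N ^ CARD('n) * m" for k N x
  proof -
    have "\<bar>box_avg (\<lambda>_. e N) (u k) x\<bar>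
        \<le> 1 + 1 powr (1 - q) / (\<Prod>i\<in>(UNIV::'n set). e N) * (LINT x|lborel. \<bar>u k x\<bar> powr q)"
      by (rule box_avg_abs_le[OF u q e]) simp
    also have "\<dots> \<le> 1 + 1 / e N ^ CARD('n) * m"
      using mass[of k] e[of N] by (auto simp: divide_right_mono)
    finally show ?thesis .
  qed
  have "\<bar>A k Nz\<bar> \<le> 1 + 1 / e (fst Nz) ^ CARD('n) * m" for k Nz
    using A_bound by (auto simp: A_def split: prod.split)
  then obtain r0 where r0: "strict_mono r0" "\<And>Nz. convergent (\<lambda>k. A (r0 k) Nz)"
    using pointwise_convergent_subseq[of A "\<lambda>Nz. 1 + 1 / e (fst Nz) ^ CARD('n) * m"] by blast
  define P where "P N k x = box_avg (\<lambda>_. e N) (u (r0 k)) (grid (e N) x)" for N k x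
  have [measurable]: "P N k \<in> borel_measurable borel" for N k
    unfolding P_def by measurable
  have P_bound: "\<bar>P N k x\<bar> \<le> 1 + 1 / e N ^ CARD('n) * m" for N k x
    unfolding P_def by (rule A_bound)
  have P_conv: "convergent (\<lambda>k. P N k x)" for N x
  proof -
    have "grid (e N) x = node N (\<lambda>i. \<lfloor>x $ i / e N\<rfloor>)"
      by (simp add: grid_def node_def)
    then show ?thesis
      using r0(2)[of "(N, \<lambda>i. \<lfloor>x $ i / e N\<rfloor>)"] by (simp add: A_def P_def)
  qed
  have P_L1: "\<exists>k0. \<forall>k\<ge>k0. (\<integral>\<^sup>+x. ennreal (w x * \<bar>P N k x - lim (\<lambda>k. P N k x)\<bar>) \<partial>lborel) \<le> ennreal a"
    if a_pos: "0 < a" for N a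
  proof -
    define g where "g x = lim (\<lambda>k. P N k x)" for x
    have [measurable]: "g \<in> borel_measurable borel"
      unfolding g_def by (rule borel_measurable_lim_metric) measurable
    define B where "B = 1 + 1 / e N ^ CARD('n) * m"
    have lim: "(\<lambda>k. P N k x) \<longlonglongrightarrow> g x" for x
      using P_conv by (simp add: g_def convergent_LIMSEQ_iff)
    have g_bound: "\<bar>g x\<bar> \<le> B" for x
      using tendsto_rabs[OF lim[of x]] P_bound unfolding B_def
      by (intro LIMSEQ_le_const2) auto
    have bound: "norm (w x * \<bar>P N k x - g x\<bar>) \<le> 2 * B * w x" for x k
    proof -
      have "\<bar>P N k x - g x\<bar> \<le> 2 * B"
        using P_bound[of N k x, folded B_def] g_bound[of x] by linarith
      then show ?thesis
        using w(1)[of x] by (simp add: abs_mult mult.commute mult_left_mono)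
    qed
    have "(\<lambda>k. LINT x|lborel. w x * \<bar>P N k x - g x\<bar>) \<longlonglongrightarrow> (LINT x|(lborel :: (real^'n) measure). 0)"
    proof (rule integral_dominated_convergence)
      show "integrable lborel (\<lambda>x. 2 * B * w x)"
        using w(3) by simp
      show "AE x in lborel. (\<lambda>k. w x * \<bar>P N k x - g x\<bar>) \<longlonglongrightarrow> 0"
        using lim by (intro AE_I2 tendsto_mult_right_zero tendsto_rabs_zero) (simp add: LIM_zero)
      show "AE x in lborel. norm (w x * \<bar>P N k x - g x\<bar>) \<le> 2 * B * w x" for k
        using bound by auto
    qed measurable
    then obtain k0 where k0: "\<And>k. k \<ge> k0 \<Longrightarrow> norm ((LINT x|lborel. w x * \<bar>P N k x - g x\<bar>) - 0) < a"
      using LIMSEQ_D[of "\<lambda>k. LINT x|lborel. w x * \<bar>P N k x - g x\<bar>" 0 a] a_pos by auto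
    have int: "integrable lborel (\<lambda>x. w x * \<bar>P N k x - g x\<bar>)" for k
      by (rule Bochner_Integration.integrable_bound[OF integrable_mult_right[OF w(3), of "2 * B"]])
         (use order_trans[OF bound abs_ge_self] in auto)
    show ?thesis
    proof (intro exI allI impI)
      fix k assume "k \<ge> k0"
      then have "(LINT x|lborel. w x * \<bar>P N k x - g x\<bar>) \<le> a"
        using k0[of k] by auto
      then show "(\<integral>\<^sup>+x. ennreal (w x * \<bar>P N k x - lim (\<lambda>k. P N k x)\<bar>) \<partial>lborel) \<le> ennreal a"
        using int w(1) by (subst nn_integral_eq_integral) (auto simp: g_def[symmetric] less_imp_le ennreal_leI)
    qed
  qed
  have approx: "\<exists>N. \<forall>k. (\<integral>\<^sup>+x. ennreal (w x * \<bar>u (r0 k) x - P N k x\<bar>) \<partial>lborel) \<le> ennreal a"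
    if a_pos: "0 < a" for a
  proof -
    \<comment> \<open>First \<open>d\<close> is fixed so that the constant terms of all directions
      add up to at most a / 2; then the mesh is chosen for this \<open>d\<close>. The summand 1
      keeps the denominator positive.\<close>
    define c where "c = CARD('n) * (2 ^ CARD('n) * W) + 1"
    have pos: "0 < c"
      unfolding c_def using W by (simp add: add_nonneg_pos)
    define d where "d = a / (2 * c)"
    have d: "0 < d"
      using a_pos pos by (simp add: d_def)
    have "CARD('n) * (2 ^ CARD('n) * W) * d \<le> c * d"
      using d by (intro mult_right_mono) (auto simp: c_def)
    also have "\<dots> = a / 2"
      using pos by (simp add: d_def)
    finally have d2: "CARD('n) * (d * 2 ^ CARD('n) * W) \<le> a / 2"
      by (simp add: mult_ac)
    define S where "S N = (\<Sum>i\<in>UNIV. d powr (1 - p i) * (2 ^ (CARD('n) - 1) * (e N powr (s i * p i) * K)))" for N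
    have "e \<longlonglongrightarrow> 0"
      unfolding e_def using LIMSEQ_inverse_real_of_nat by (simp add: inverse_eq_divide add.commute)
    then have "S \<longlonglongrightarrow> (\<Sum>i\<in>UNIV. d powr (1 - p i) * (2 ^ (CARD('n) - 1) * (0 powr (s i * p i) * K)))"
      unfolding S_def using s p e less_trans[OF zero_less_one p]
      by (intro tendsto_intros tendsto_powr') (auto simp: less_imp_le)
    then have "S \<longlonglongrightarrow> 0"
      by simp
    from LIMSEQ_D[OF this, of "a / 2"] obtain N where N: "\<bar>S N\<bar> < a / 2"
      using a_pos by auto
    have "(\<integral>\<^sup>+x. ennreal (w x * \<bar>u (r0 k) x - P N k x\<bar>) \<partial>lborel) \<le> ennreal a" for k
    proof -
      have "(\<integral>\<^sup>+x. ennreal (w x * \<bar>u (r0 k) x - P N k x\<bar>) \<partial>lborel)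
        \<le> ennreal (\<Sum>i\<in>UNIV. d * 2 ^ CARD('n) * (LINT x|lborel. w x)
         + d powr (1 - p i) * (2 ^ (CARD('n) - 1) * (e N powr (s i * p i) * K)))"
        unfolding P_def by (rule grid_average_weighted[OF u q e d s p K en w(3) w(1) w(2)])
      also have "(\<Sum>i\<in>UNIV. d * 2 ^ CARD('n) * (LINT x|lborel. w x)
         + d powr (1 - p i) * (2 ^ (CARD('n) - 1) * (e N powr (s i * p i) * K))) = CARD('n) * (d * 2 ^ CARD('n) * W) + S N"
        by (simp add: sum.distrib S_def W_def)
      also have "\<dots> \<le> a"
        using d2 N by linarith
      finally show ?thesis
        by (simp add: ennreal_leI)
    qed
    then show ?thesis by blast
  qed
  have Cauchy: "\<exists>N. \<forall>k\<ge>N. \<forall>l\<ge>N. (\<integral>\<^sup>+x. ennreal (w x * \<bar>u (r0 k) x - u (r0 l) x\<bar>) \<partial>lborel) \<le> ennreal a"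
    if a_pos: "0 < a" for a
  proof -
    \<comment> \<open>Four errors occur: the distance to the cell averages and that of the cell
      averages to their limit, for each of the two indices.\<close>
    have a4: "0 < a / 4" using a_pos by simp
    obtain N where N: "\<And>k. (\<integral>\<^sup>+x. ennreal (w x * \<bar>u (r0 k) x - P N k x\<bar>) \<partial>lborel) \<le> ennreal (a / 4)"
      using approx[OF a4] by blast
    obtain k0 where k0: "\<And>k. k \<ge> k0 \<Longrightarrow>
        (\<integral>\<^sup>+x. ennreal (w x * \<bar>P N k x - lim (\<lambda>k. P N k x)\<bar>) \<partial>lborel) \<le> ennreal (a / 4)"
      using P_L1[OF a4] by blast
    have [measurable]: "(\<lambda>x. lim (\<lambda>k. P N k x)) \<in> borel_measurable borel"
      by (rule borel_measurable_lim_metric) measurable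
    have "(\<integral>\<^sup>+x. ennreal (w x * \<bar>u (r0 k) x - u (r0 l) x\<bar>) \<partial>lborel) \<le> ennreal a"
      if "k \<ge> k0" "l \<ge> k0" for k l
    proof -
      define g where "g x = lim (\<lambda>k. P N k x)" for x
      have [measurable]: "g \<in> borel_measurable borel"
        unfolding g_def by measurable
      have "(\<integral>\<^sup>+x. ennreal (w x * \<bar>u (r0 k) x - u (r0 l) x\<bar>) \<partial>lborel)
        \<le> (\<integral>\<^sup>+x. (ennreal (w x * \<bar>u (r0 k) x - P N k x\<bar>) + ennreal (w x * \<bar>P N k x - g x\<bar>))
            + (ennreal (w x * \<bar>u (r0 l) x - P N l x\<bar>) + ennreal (w x * \<bar>P N l x - g x\<bar>)) \<partial>lborel)"
      proof (intro nn_integral_mono)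
        fix x
        have "w x * \<bar>u (r0 k) x - u (r0 l) x\<bar>
          \<le> w x * ((\<bar>u (r0 k) x - P N k x\<bar> + \<bar>P N k x - g x\<bar>) + (\<bar>u (r0 l) x - P N l x\<bar> + \<bar>P N l x - g x\<bar>))"
          using w(1)[of x] by (intro mult_left_mono) linarith+
        then show "ennreal (w x * \<bar>u (r0 k) x - u (r0 l) x\<bar>)
          \<le> (ennreal (w x * \<bar>u (r0 k) x - P N k x\<bar>) + ennreal (w x * \<bar>P N k x - g x\<bar>))
            + (ennreal (w x * \<bar>u (r0 l) x - P N l x\<bar>) + ennreal (w x * \<bar>P N l x - g x\<bar>))"
          using w(1)[of x] by (simp add: ennreal_plus[symmetric] distrib_left ennreal_leI less_imp_le del: ennreal_plus)
      qed
      also have "\<dots> = ((\<integral>\<^sup>+x. ennreal (w x * \<bar>u (r0 k) x - P N k x\<bar>) \<partial>lborel)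
          + (\<integral>\<^sup>+x. ennreal (w x * \<bar>P N k x - g x\<bar>) \<partial>lborel))
          + ((\<integral>\<^sup>+x. ennreal (w x * \<bar>u (r0 l) x - P N l x\<bar>) \<partial>lborel)
          + (\<integral>\<^sup>+x. ennreal (w x * \<bar>P N l x - g x\<bar>) \<partial>lborel))"
        by (simp add: nn_integral_add)
      also have "\<dots> \<le> (ennreal (a / 4) + ennreal (a / 4)) + (ennreal (a / 4) + ennreal (a / 4))"
        using k0[OF that(1)] k0[OF that(2)] N by (intro add_mono) (auto simp: g_def)
      also have "\<dots> = ennreal a"
        using a4 by (simp add: ennreal_plus[symmetric] del: ennreal_plus)
      finally show ?thesis .
    qed
    then show ?thesis by blast
  qed
  obtain r1 where r1: "strict_mono (r1 :: nat \<Rightarrow> nat)" "AE x in lborel. convergent (\<lambda>k. u (r0 (r1 k)) x)"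
    by (rule AE_convergent_subseq[of "\<lambda>k. u (r0 k)" lborel w]) (use w(1) Cauchy in auto)
  show thesis
  proof
    show "strict_mono (r0 \<circ> r1)"
      using r0(1) r1(1) by (rule strict_mono_o)
    show "(\<lambda>x. lim (\<lambda>k. u (r0 (r1 k)) x)) \<in> borel_measurable borel"
      by (rule borel_measurable_lim_metric) measurable
    show "AE x in lborel. (\<lambda>k. u ((r0 \<circ> r1) k) x) \<longlonglongrightarrow> lim (\<lambda>k. u (r0 (r1 k)) x)"
      using r1(2) by (auto simp: convergent_LIMSEQ_iff)
  qed
qed

section \<open>Energies as \<open>L\<^sup>p\<close> norms of difference quotients\<close>

text \<open>
  The weight is placed so that \<open>quot\<close> is linear in \<open>u\<close> and its \<open>L\<^sup>p\<close> norm on the product space is the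
  energy; at \<open>h = 0\<close> the quotient is 0, in accordance with the integrand of \<open>aniso_energy\<close>.
\<close>

definition quot :: "'n::finite \<Rightarrow> real \<Rightarrow> real \<Rightarrow> (real ^ 'n \<Rightarrow> real) \<Rightarrow> (real ^ 'n) \<times> real \<Rightarrow> real" where
  "quot i s p u z = (u (fst z) - u (fst z + snd z *\<^sub>R axis i 1)) / \<bar>snd z\<bar> powr ((1 + s * p) / p)"

lemma quot_measurable[measurable]:
  assumes [measurable]: "u \<in> borel_measurable borel"
  shows "quot i s p u \<in> borel_measurable (lborel \<Otimes>\<^sub>M lborel)"
  unfolding quot_def by measurable

lemma abs_quot_powr:
  assumes "1 < p"
  shows "\<bar>quot i s p u (x, h)\<bar> powr p
    = \<bar>u x - u (x + h *\<^sub>R axis i 1)\<bar> powr p * (1 / \<bar>h\<bar> powr (1 + s * p))"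
  using assms by (simp add: quot_def abs_divide powr_divide powr_powr)

lemma nn_integral_quot:
  fixes u :: "real ^ 'n::finite \<Rightarrow> real"
  assumes [measurable]: "u \<in> borel_measurable borel" and p: "1 < p"
  shows "(\<integral>\<^sup>+z. ennreal (\<bar>quot i s p u z\<bar> powr p) \<partial>(lborel \<Otimes>\<^sub>M lborel)) = dir_energy i s p u"
proof -
  have "(\<integral>\<^sup>+z. ennreal (\<bar>quot i s p u z\<bar> powr p) \<partial>(lborel \<Otimes>\<^sub>M lborel))
      = (\<integral>\<^sup>+h. \<integral>\<^sup>+x. ennreal (\<bar>quot i s p u (x, h)\<bar> powr p) \<partial>lborel \<partial>lborel)"
    by (rule lborel_pair.nn_integral_snd[symmetric]) measurable
  also have "\<dots> = dir_energy i s p u"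
    unfolding dir_energy_def dir_mod_def
    by (intro nn_integral_cong) (simp add: abs_quot_powr[OF p] ennreal_mult nn_integral_multc del: times_divide_eq_right mult_1_right)
  finally show ?thesis .
qed

lemma aniso_energy_eq:
  assumes u[measurable]: "u \<in> borel_measurable borel"
    and p: "\<And>i. 1 < p i" and s: "\<And>i. 0 < s i \<and> s i < 1"
  shows "aniso_energy s p u = (\<Sum>i\<in>UNIV. ennreal (s i * (1 - s i)) * dir_energy i (s i) (p i) u)"
  unfolding aniso_energy_def
proof (rule sum.cong)
  fix i
  have c: "0 \<le> s i * (1 - s i)"
    using s[of i] by simp
  have "(\<integral>\<^sup>+x. \<integral>\<^sup>+h. ennreal (s i * (1 - s i) * (\<bar>u x - u (x + h *\<^sub>R axis i 1)\<bar> powr p i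
        / \<bar>h\<bar> powr (1 + s i * p i))) \<partial>lborel \<partial>lborel)
      = (\<integral>\<^sup>+x. \<integral>\<^sup>+h. ennreal (s i * (1 - s i)) * ennreal (\<bar>quot i (s i) (p i) u (x, h)\<bar> powr p i) \<partial>lborel \<partial>lborel)"
    by (intro nn_integral_cong, subst abs_quot_powr[OF p])
       (use c in \<open>simp only: ennreal_mult[symmetric] powr_ge_zero times_divide_eq_right mult_1_right divide_nonneg_nonneg\<close>)
  also have "\<dots> = (\<integral>\<^sup>+z. ennreal (s i * (1 - s i)) * ennreal (\<bar>quot i (s i) (p i) u z\<bar> powr p i) \<partial>(lborel \<Otimes>\<^sub>M lborel))"
    by (rule lborel.nn_integral_fst) measurable
  also have "\<dots> = ennreal (s i * (1 - s i)) * dir_energy i (s i) (p i) u"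
    by (subst nn_integral_cmult) (measurable, simp add: nn_integral_quot[OF u p])
  finally show "(\<integral>\<^sup>+x. \<integral>\<^sup>+h. ennreal (s i * (1 - s i) * (\<bar>u x - u (x + h *\<^sub>R axis i 1)\<bar> powr p i
        / \<bar>h\<bar> powr (1 + s i * p i))) \<partial>lborel \<partial>lborel)
      = ennreal (s i * (1 - s i)) * dir_energy i (s i) (p i) u" .
qed simp

lemma quot_Lp_iff:
  assumes [measurable]: "u \<in> borel_measurable borel" and p: "1 < p"
  shows "quot i s p u \<in> Lp (lborel \<Otimes>\<^sub>M lborel) p \<longleftrightarrow> dir_energy i s p u < \<infinity>"
  by (simp add: Lp_def integrable_iff_bounded nn_integral_quot[OF assms])

text \<open>In this form the space is given by \<open>Lp\<close> conditions on u and on its linear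
  images \<open>quot\<close>, so Fatou's lemma, the Brezis-Lieb lemma and differentiation apply to
  each of them.\<close>

lemma aniso_space_iff:
  assumes p: "\<And>i. 1 < p i" and s: "\<And>i. 0 < s i \<and> s i < 1"
  shows "u \<in> aniso_space s p \<longleftrightarrow>
    u \<in> Lp lborel (p_star s p) \<and> (\<forall>i. quot i (s i) (p i) u \<in> Lp (lborel \<Otimes>\<^sub>M lborel) (p i))"
proof (cases "u \<in> borel_measurable borel")
  case True
  have c: "0 < s i * (1 - s i)" for i
    using s[of i] by simp
  have "ennreal (s i * (1 - s i)) * dir_energy i (s i) (p i) u < \<infinity> \<longleftrightarrow> dir_energy i (s i) (p i) u < \<infinity>" for i
    using c[of i] by (auto simp: ennreal_mult_less_top ennreal_eq_0_iff)
  then have "aniso_energy s p u < \<infinity> \<longleftrightarrow> (\<forall>i. dir_energy i (s i) (p i) u < \<infinity>)"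
    unfolding aniso_energy_eq[OF True p s] by simp
  then show ?thesis
    using True by (simp add: aniso_space_def Lq_def Lp_def[of lborel] quot_Lp_iff[OF True p])
next
  case False
  then show ?thesis
    by (simp add: aniso_space_def Lq_def Lp_def[of lborel])
qed

lemma signed_power_quot:
  assumes "1 < p"
  shows "signed_power p (quot i s p u (x, h)) * quot i s p v (x, h)
    = signed_power p (u x - u (x + h *\<^sub>R axis i 1)) * (v x - v (x + h *\<^sub>R axis i 1)) / \<bar>h\<bar> powr (1 + s * p)"
proof (cases "h = 0")
  case False
  define c where "c = (1 + s * p) / p"
  have "(\<bar>h\<bar> powr c) powr (p - 2) * \<bar>h\<bar> powr c * \<bar>h\<bar> powr c = \<bar>h\<bar> powr (c * (p - 2) + c + c)"
    by (simp only: powr_powr powr_add)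
  \<comment> \<open>The weight occurs p - 2 times in the power and once in each of the two linear
    factors, hence p times in all.\<close>
  also have "c * (p - 2) + c + c = 1 + s * p"
    using assms by (simp add: c_def field_simps)
  finally have *: "\<bar>h\<bar> powr (1 + s * p) = (\<bar>h\<bar> powr c) powr (p - 2) * \<bar>h\<bar> powr c * \<bar>h\<bar> powr c" ..
  show ?thesis
    unfolding * by (simp add: signed_power_def quot_def c_def[symmetric] abs_divide powr_divide)
qed (simp add: quot_def signed_power_def)

text \<open>Integrability on the product space, from \<open>integrable_signed_power_mult\<close>,
  turns the iterated integral of the weak formulation into an integral over pairs.\<close>

lemma aniso_form_eq:
  fixes s p :: "'n::finite \<Rightarrow> real"
  assumes p: "\<And>i. 1 < p i"
    and u: "\<And>i. quot i (s i) (p i) u \<in> Lp (lborel \<Otimes>\<^sub>M lborel) (p i)"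
    and v: "\<And>i. quot i (s i) (p i) v \<in> Lp (lborel \<Otimes>\<^sub>M lborel) (p i)"
  shows "aniso_form s p u v = (\<Sum>i\<in>UNIV. s i * (1 - s i) / 2 *
    (LINT z|(lborel \<Otimes>\<^sub>M lborel). signed_power (p i) (quot i (s i) (p i) u z) * quot i (s i) (p i) v z))"
  unfolding aniso_form_def
proof (intro sum.cong arg_cong2[where f = "(*)"])
  fix i
  show "(LINT x|lborel. LINT h|lborel.
          signed_power (p i) (u x - u (x + h *\<^sub>R axis i 1)) * (v x - v (x + h *\<^sub>R axis i 1))
          / \<bar>h\<bar> powr (1 + s i * p i))
      = (LINT z|(lborel \<Otimes>\<^sub>M lborel). signed_power (p i) (quot i (s i) (p i) u z) * quot i (s i) (p i) v z)"
    using lborel_pair.integral_fst'[OF integrable_signed_power_mult[OF u v p, of i]]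
    by (simp add: signed_power_quot[OF p])
qed auto

text \<open>For each fixed h, the x for which x + h e_i lies in a null set form a translate of that
  set, so the exceptional pairs are a null set by Tonelli's theorem.\<close>

lemma AE_pair_shift:
  fixes P :: "real ^ 'n::finite \<Rightarrow> bool"
  assumes "AE x in lborel. P x"
  shows "AE z in lborel \<Otimes>\<^sub>M lborel. P (fst z) \<and> P (fst z + (snd z :: real) *\<^sub>R axis i 1)"
proof -
  obtain N where N: "{x. \<not> P x} \<subseteq> N" "N \<in> null_sets lborel"
    using assms by (auto elim!: AE_E simp: null_sets_def)
  have N_meas[measurable]: "N \<in> sets borel"
    using N by auto
  \<comment> \<open>The cases c = 0 and c = 1 treat both points of the difference at once.\<close>
  have shift: "AE z in lborel \<Otimes>\<^sub>M lborel. fst z + (c * snd z) *\<^sub>R axis i 1 \<notin> N" for c :: real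
  proof (rule AE_I')
    let ?A = "{z. fst z + (c * snd z) *\<^sub>R axis i 1 \<in> N} :: ((real^'n) \<times> real) set"
    have A: "?A \<in> sets (lborel \<Otimes>\<^sub>M lborel)"
    proof -
      have "(\<lambda>z. fst z + (c * snd z) *\<^sub>R axis i 1) \<in> borel_measurable (lborel \<Otimes>\<^sub>M (lborel :: real measure))"
        by measurable
      from measurable_sets[OF this N_meas] show ?thesis
        by (simp add: vimage_def space_pair_measure)
    qed
    have "emeasure (lborel \<Otimes>\<^sub>M lborel) ?A = (\<integral>\<^sup>+z. indicator N (fst z + (c * snd z) *\<^sub>R axis i 1) \<partial>(lborel \<Otimes>\<^sub>M lborel))"
      using nn_integral_indicator[OF A] by (simp add: indicator_def)
    also have "\<dots> = (\<integral>\<^sup>+h. \<integral>\<^sup>+x. indicator N (x + (c * h) *\<^sub>R axis i 1) \<partial>lborel \<partial>lborel)"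
      by (subst lborel_pair.nn_integral_snd[symmetric]) auto
    also have "\<dots> = (\<integral>\<^sup>+(h::real). \<integral>\<^sup>+x. indicator N x \<partial>lborel \<partial>lborel)"
      by (intro nn_integral_cong nn_integral_translate) simp
    also have "\<dots> = 0"
      using N by (simp add: null_sets_def)
    finally show "?A \<in> null_sets (lborel \<Otimes>\<^sub>M lborel)"
      using A by (auto simp: null_sets_def)
  qed auto
  have "P (fst z) \<and> P (fst z + snd z *\<^sub>R axis i 1)"
    if "fst z + (0 * snd z) *\<^sub>R axis i 1 \<notin> N" "fst z + (1 * snd z) *\<^sub>R axis i 1 \<notin> N" for z
    using that N(1) by auto
  with shift[of 0] shift[of 1] show ?thesis
    by (auto intro: AE_mp)
qed

lemma AE_quot_tendsto:
  fixes u :: "nat \<Rightarrow> real ^ 'n::finite \<Rightarrow> real"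
  assumes "AE x in lborel. (\<lambda>k. u k x) \<longlonglongrightarrow> v x"
  shows "AE z in lborel \<Otimes>\<^sub>M lborel. (\<lambda>k. quot i s p (u k) z) \<longlonglongrightarrow> quot i s p v z"
  using AE_pair_shift[OF assms, of i]
proof eventually_elim
  case (elim z)
  then show ?case
    unfolding quot_def by (cases "snd z = 0") (auto intro!: tendsto_intros)
qed

lemma quot_lincomb: "quot i s p (\<lambda>x. u x + c * v x) = (\<lambda>z. quot i s p u z + c * quot i s p v z)"
  by (auto simp: quot_def fun_eq_iff add_divide_distrib[symmetric] right_diff_distrib)

lemma quot_diff: "quot i s p (\<lambda>x. u x - v x) = (\<lambda>z. quot i s p u z - quot i s p v z)"
  by (auto simp: quot_def fun_eq_iff diff_divide_distrib[symmetric])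

lemma abs_quot_abs_le: "\<bar>quot i s p (\<lambda>x. \<bar>u x\<bar>) z\<bar> \<le> \<bar>quot i s p u z\<bar>"
  unfolding quot_def abs_divide by (intro divide_right_mono) auto

section \<open>Behaviour under dilations and translations\<close>

text \<open>The substitution in x contributes the inverse of the product of all \<open>b j\<close>;
  in h the kernel contributes b i powr (1 + s p) and the measure 1 / b i.\<close>

lemma dir_energy_rescale:
  fixes u :: "real ^ 'n::finite \<Rightarrow> real"
  assumes [measurable]: "u \<in> borel_measurable borel" and b: "\<And>j. 0 < b j" and a: "0 < a" and p: "1 < p"
  shows "dir_energy i s p (\<lambda>x. a * u (t + cscale b x))
    = ennreal (a powr p * b i powr (s * p) / (\<Prod>j\<in>UNIV. b j)) * dir_energy i s p u"
proof -
  define \<pi> where "\<pi> = (\<Prod>j\<in>UNIV. b j)"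
  have \<pi>: "0 < \<pi>"
    unfolding \<pi>_def using b by (intro prod_pos) auto
  have mod_eq: "dir_mod i p (\<lambda>x. a * u (t + cscale b x)) h
      = ennreal (a powr p / \<pi>) * dir_mod i p u (b i * h)" for h
  proof -
    have "dir_mod i p (\<lambda>x. a * u (t + cscale b x)) h
      = (\<integral>\<^sup>+x. ennreal (a powr p) * ennreal (\<bar>u (t + cscale b x) - u ((t + cscale b x) + (b i * h) *\<^sub>R axis i 1)\<bar> powr p) \<partial>lborel)"
      unfolding dir_mod_def
    proof (intro nn_integral_cong)
      fix x
      have "\<bar>a * u (t + cscale b x) - a * u (t + cscale b (x + h *\<^sub>R axis i 1))\<bar>
          = a * \<bar>u (t + cscale b x) - u ((t + cscale b x) + (b i * h) *\<^sub>R axis i 1)\<bar>"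
        using a by (simp add: cscale_add cscale_axis add.assoc right_diff_distrib[symmetric] abs_mult)
      then show "ennreal (\<bar>a * u (t + cscale b x) - a * u (t + cscale b (x + h *\<^sub>R axis i 1))\<bar> powr p)
          = ennreal (a powr p) * ennreal (\<bar>u (t + cscale b x) - u ((t + cscale b x) + (b i * h) *\<^sub>R axis i 1)\<bar> powr p)"
        using a by (simp add: powr_mult ennreal_mult)
    qed
    also have "\<dots> = ennreal (a powr p) * (ennreal (1 / \<pi>) * dir_mod i p u (b i * h))"
      unfolding dir_mod_def \<pi>_def
      by (subst nn_integral_cmult)
         (auto simp: nn_integral_cscale[OF b, of "\<lambda>x. ennreal (\<bar>u x - u (x + (b i * h) *\<^sub>R axis i 1)\<bar> powr p)" t])
    also have "ennreal (a powr p) * (ennreal (1 / \<pi>) * dir_mod i p u (b i * h))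
        = ennreal (a powr p / \<pi>) * dir_mod i p u (b i * h)"
      using \<pi> by (simp add: mult.assoc[symmetric] ennreal_mult[symmetric])
    finally show ?thesis .
  qed
  have "dir_energy i s p u
      = ennreal \<bar>b i\<bar> * (\<integral>\<^sup>+h. dir_mod i p u (0 + b i * h) * ennreal (1 / \<bar>0 + b i * h\<bar> powr (1 + s * p)) \<partial>lborel)"
    unfolding dir_energy_def using b[of i] by (intro nn_integral_real_affine) auto
  also have "\<dots> = ennreal (b i) * (\<integral>\<^sup>+h. ennreal (1 / b i powr (1 + s * p)) * (dir_mod i p u (b i * h) * ennreal (1 / \<bar>h\<bar> powr (1 + s * p))) \<partial>lborel)"
  proof -
    have "dir_mod i p u (0 + b i * h) * ennreal (1 / \<bar>0 + b i * h\<bar> powr (1 + s * p))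
        = ennreal (1 / b i powr (1 + s * p)) * (dir_mod i p u (b i * h) * ennreal (1 / \<bar>h\<bar> powr (1 + s * p)))" for h
    proof -
      have "ennreal (1 / \<bar>0 + b i * h\<bar> powr (1 + s * p))
          = ennreal (1 / b i powr (1 + s * p)) * ennreal (1 / \<bar>h\<bar> powr (1 + s * p))"
        using b[of i] by (subst ennreal_mult[symmetric]) (auto simp: abs_mult powr_mult)
      then show ?thesis
        by (simp add: mult_ac)
    qed
    then show ?thesis
      using b[of i] by simp
  qed
  also have "\<dots> = ennreal (b i) * (ennreal (1 / b i powr (1 + s * p)) *
      (\<integral>\<^sup>+h. dir_mod i p u (b i * h) * ennreal (1 / \<bar>h\<bar> powr (1 + s * p)) \<partial>lborel))"
    by (subst nn_integral_cmult) auto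
  also have "\<dots> = ennreal (1 / b i powr (s * p)) *
      (\<integral>\<^sup>+h. dir_mod i p u (b i * h) * ennreal (1 / \<bar>h\<bar> powr (1 + s * p)) \<partial>lborel)"
  proof -
    have "b i * (1 / b i powr (1 + s * p)) = 1 / b i powr (s * p)"
      using b[of i] by (simp add: powr_add)
    then show ?thesis
      using b[of i] by (simp add: mult.assoc[symmetric] ennreal_mult[symmetric] less_imp_le)
  qed
  finally have E: "dir_energy i s p u = ennreal (1 / b i powr (s * p)) *
      (\<integral>\<^sup>+h. dir_mod i p u (b i * h) * ennreal (1 / \<bar>h\<bar> powr (1 + s * p)) \<partial>lborel)" .
  have "dir_energy i s p (\<lambda>x. a * u (t + cscale b x))
      = ennreal (a powr p / \<pi>) * (\<integral>\<^sup>+h. dir_mod i p u (b i * h) * ennreal (1 / \<bar>h\<bar> powr (1 + s * p)) \<partial>lborel)"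
    unfolding dir_energy_def[of i s p "\<lambda>x. a * u (t + cscale b x)"] mod_eq mult.assoc
    by (rule nn_integral_cmult) measurable
  also have "a powr p / \<pi> = (a powr p * b i powr (s * p) / \<pi>) * (1 / b i powr (s * p))"
    using b[of i] by simp
  also have "ennreal ((a powr p * b i powr (s * p) / \<pi>) * (1 / b i powr (s * p)))
      = ennreal (a powr p * b i powr (s * p) / \<pi>) * ennreal (1 / b i powr (s * p))"
    using \<pi> by (intro ennreal_mult) auto
  finally show ?thesis
    by (simp add: E \<pi>_def mult.assoc)
qed

lemma Lp_rescale:
  fixes u :: "real ^ 'n::finite \<Rightarrow> real"
  assumes u: "u \<in> Lp lborel q" and b: "\<And>j. 0 < b j" and a: "0 < a"
  shows "(\<lambda>x. a * u (t + cscale b x)) \<in> Lp lborel q"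
    "(LINT x|lborel. \<bar>a * u (t + cscale b x)\<bar> powr q) = a powr q / (\<Prod>j\<in>UNIV. b j) * (LINT x|lborel. \<bar>u x\<bar> powr q)"
proof -
  have [measurable]: "u \<in> borel_measurable borel"
    using LpD(1)[OF u] by simp
  have pos: "0 < (\<Prod>j\<in>UNIV. b j)"
    using b by (intro prod_pos) auto
  have "(\<integral>\<^sup>+x. ennreal (\<bar>a * u (t + cscale b x)\<bar> powr q) \<partial>lborel)
      = (\<integral>\<^sup>+x. ennreal (a powr q) * ennreal (\<bar>u (t + cscale b x)\<bar> powr q) \<partial>lborel)"
    using a by (intro nn_integral_cong) (simp add: abs_mult powr_mult ennreal_mult)
  also have "\<dots> = ennreal (a powr q) * (ennreal (1 / (\<Prod>j\<in>UNIV. b j)) * (\<integral>\<^sup>+x. ennreal (\<bar>u x\<bar> powr q) \<partial>lborel))"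
    by (subst nn_integral_cmult) (auto simp: nn_integral_cscale[OF b, of "\<lambda>x. ennreal (\<bar>u x\<bar> powr q)"])
  also have "(\<integral>\<^sup>+x. ennreal (\<bar>u x\<bar> powr q) \<partial>lborel) = ennreal (LINT x|lborel. \<bar>u x\<bar> powr q)"
    using LpD(2)[OF u] by (simp add: nn_integral_eq_integral)
  also have "ennreal (a powr q) * (ennreal (1 / (\<Prod>j\<in>UNIV. b j)) * ennreal (LINT x|lborel. \<bar>u x\<bar> powr q))
      = ennreal (a powr q / (\<Prod>j\<in>UNIV. b j) * (LINT x|lborel. \<bar>u x\<bar> powr q))"
    using pos by (simp add: ennreal_mult[symmetric] less_imp_le)
  finally have eq: "(\<integral>\<^sup>+x. ennreal (\<bar>a * u (t + cscale b x)\<bar> powr q) \<partial>lborel)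
      = ennreal (a powr q / (\<Prod>j\<in>UNIV. b j) * (LINT x|lborel. \<bar>u x\<bar> powr q))" .
  show "(\<lambda>x. a * u (t + cscale b x)) \<in> Lp lborel q"
    using eq by (auto simp: Lp_def integrable_iff_bounded)
  show "(LINT x|lborel. \<bar>a * u (t + cscale b x)\<bar> powr q) = a powr q / (\<Prod>j\<in>UNIV. b j) * (LINT x|lborel. \<bar>u x\<bar> powr q)"
    using pos by (subst integral_eq_nn_integral) (auto simp: eq)
qed

section \<open>A function of finite energy; vanishing of averages\<close>

text \<open>A Lipschitz function with compact support; since every s i < 1, this is regular enough
  for finite energy. It shows that \<open>S\<close> is the infimum of a nonempty set.\<close>

definition tent :: "'a::euclidean_space \<Rightarrow> real" where
  "tent x = max 0 (1 - norm x)"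

lemma tent_measurable[measurable]: "tent \<in> borel_measurable borel"
  unfolding tent_def by measurable

lemma tent_nonneg: "0 \<le> tent x" and tent_le: "tent x \<le> indicator (cball 0 1) x"
  by (auto simp: tent_def indicator_def)

lemma tent_diff_le: "\<bar>tent x - tent (x + y)\<bar>
    \<le> min (norm y) 1 * (indicator (cball 0 1) x + indicator (cball 0 1) (x + y))"
proof -
  have "\<bar>tent x - tent (x + y)\<bar> \<le> norm y"
    using norm_triangle_ineq2[of x "x + y"] norm_triangle_ineq2[of "x + y" x]
    by (auto simp: tent_def norm_minus_commute)
  moreover have "\<bar>tent x - tent (x + y)\<bar> \<le> 1"
  proof -
    have "0 \<le> tent x" "tent x \<le> 1" "0 \<le> tent (x + y)" "tent (x + y) \<le> 1"
      by (auto simp: tent_def)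
    then show ?thesis
      by linarith
  qed
  moreover have "tent x = 0" if "x \<notin> cball 0 1" for x :: 'a
    using that by (simp add: tent_def)
  ultimately show ?thesis
    by (auto simp: indicator_def)
qed

lemma tent_Lp:
  assumes "0 < q"
  shows "tent \<in> Lp (lborel :: 'a::euclidean_space measure) q"
    and "0 < (LINT x|(lborel :: 'a measure). \<bar>tent x\<bar> powr q)"
proof -
  have int: "integrable (lborel :: 'a measure) (\<lambda>x. \<bar>tent x\<bar> powr q)"
  proof (rule Bochner_Integration.integrable_bound)
    show "integrable lborel (indicator (cball 0 1) :: 'a \<Rightarrow> real)"
      using emeasure_lborel_cball_finite[of "0::'a" 1] by (simp add: less_top)
    show "AE x::'a in lborel. norm (\<bar>tent x\<bar> powr q) \<le> norm (indicator (cball 0 1) x :: real)"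
    proof (intro AE_I2)
      fix x :: 'a
      have "\<bar>tent x\<bar> powr q \<le> indicator (cball 0 1) x powr q"
        using tent_nonneg[of x] tent_le[of x] assms by (intro powr_mono2) auto
      then show "norm (\<bar>tent x\<bar> powr q) \<le> norm (indicator (cball 0 1) x :: real)"
        using assms by (auto simp: indicator_def split: if_splits)
    qed
  qed measurable
  then show "tent \<in> Lp (lborel :: 'a measure) q"
    by (simp add: Lp_def)
  have "(LINT x|(lborel :: 'a measure). \<bar>tent x\<bar> powr q) \<noteq> 0"
  proof
    assume "(LINT x|(lborel :: 'a measure). \<bar>tent x\<bar> powr q) = 0"
    then have "AE x::'a in lborel. \<bar>tent x\<bar> powr q = 0"
      using int by (subst (asm) integral_nonneg_eq_0_iff_AE) auto
    then have "AE x::'a in lborel. x \<notin> ball 0 1"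
      by eventually_elim (auto simp: tent_def)
    then have "emeasure lborel (ball 0 1 :: 'a set) = 0"
      by (subst (asm) AE_iff_measurable[of "ball 0 1"]) auto
    then show False
      using content_ball_pos[of 1 "0::'a"] by (simp add: measure_def)
  qed
  moreover have "0 \<le> (LINT x|(lborel :: 'a measure). \<bar>tent x\<bar> powr q)"
    by simp
  ultimately show "0 < (LINT x|(lborel :: 'a measure). \<bar>tent x\<bar> powr q)"
    by linarith
qed

lemma nn_integral_even_kernel:
  fixes F :: "real \<Rightarrow> ennreal"
  assumes [measurable]: "F \<in> borel_measurable borel"
  shows "(\<integral>\<^sup>+h. F \<bar>h\<bar> \<partial>lborel) = 2 * (\<integral>\<^sup>+h. F h * indicator {0<..} h \<partial>lborel)"
proof -
  have "(\<integral>\<^sup>+h. F \<bar>h\<bar> \<partial>lborel)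
      = (\<integral>\<^sup>+h. F h * indicator {0<..} h + F (- h) * indicator {0<..} (- h) \<partial>lborel)"
  proof (rule nn_integral_cong_AE)
    have "AE h in lborel. h \<noteq> (0::real)"
      by (rule AE_lborel_singleton)
    then show "AE h in lborel. F \<bar>h\<bar> = F h * indicator {0<..} h + F (- h) * indicator {0<..} (- h)"
      by eventually_elim (auto simp: indicator_def)
  qed
  also have "\<dots> = (\<integral>\<^sup>+h. F h * indicator {0<..} h \<partial>lborel) + (\<integral>\<^sup>+h. F (- h) * indicator {0<..} (- h) \<partial>lborel)"
    by (rule nn_integral_add) measurable
  also have "(\<integral>\<^sup>+h. F (- h) * indicator {0<..} (- h) \<partial>lborel) = (\<integral>\<^sup>+h. F h * indicator {0<..} h \<partial>lborel)"
    by (subst (2) nn_integral_real_affine[where c = "-1" and t = 0]) auto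
  finally show ?thesis
    by (simp add: mult_2)
qed

text \<open>Near 0 the integrand is |h| powr (p - s p - 1), integrable because s < 1; for |h| > 1 it
  is |h| powr (- 1 - s p), integrable because s p > 0.\<close>

lemma nn_integral_min_powr_kernel:
  assumes "0 < s" "s < 1" "1 < (p::real)"
  shows "(\<integral>\<^sup>+h. ennreal (min \<bar>h\<bar> 1 powr p * (1 / \<bar>h\<bar> powr (1 + s * p))) \<partial>lborel) < \<infinity>"
proof -
  define F where "F h = ennreal (min h 1 powr p * (1 / h powr (1 + s * p)))" for h :: real
  have [measurable]: "F \<in> borel_measurable borel"
    unfolding F_def by measurable
  have sp: "0 < s * p" "s * p < p"
    using assms by auto
  have split: "F h * indicator {0<..} h \<le> (if 0 < h \<and> h \<le> 1 then ennreal (h powr ((p - s * p) - 1)) else 0)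
      + ennreal (indicator {1..} h * h powr (- 1 - s * p))" for h
  proof -
    consider "h \<le> 0" | "0 < h" "h \<le> 1" | "1 < h" by linarith
    then show ?thesis
    proof cases
      case 2
      then have "min h 1 powr p * (1 / h powr (1 + s * p)) = h powr ((p - s * p) - 1)"
        by (simp add: powr_diff[symmetric] algebra_simps)
      then show ?thesis
        using 2 by (simp add: F_def)
    next
      case 3
      then have "1 / h powr (1 + s * p) = h powr (- 1 - s * p)"
        by (simp add: powr_minus_divide[symmetric])
      then show ?thesis
        using 3 by (simp add: F_def)
    qed auto
  qed
  have tail: "((\<lambda>h. h powr (- 1 - s * p)) has_integral - (1 powr ((- 1 - s * p) + 1)) / ((- 1 - s * p) + 1)) {1::real..}"
    using sp by (intro has_integral_powr_to_inf) auto
  have "(\<integral>\<^sup>+h. F h * indicator {0<..} h \<partial>lborel)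
      \<le> (\<integral>\<^sup>+h. (if 0 < h \<and> h \<le> 1 then ennreal (h powr ((p - s * p) - 1)) else 0)
          + ennreal (indicator {1..} h * h powr (- 1 - s * p)) \<partial>lborel)"
    by (intro nn_integral_mono split)
  also have "\<dots> = (\<integral>\<^sup>+h. (if 0 < h \<and> h \<le> 1 then ennreal (h powr ((p - s * p) - 1)) else 0) \<partial>lborel)
      + (\<integral>\<^sup>+h. ennreal (indicator {1..} h * h powr (- 1 - s * p)) \<partial>lborel)"
    by (rule nn_integral_add) measurable
  also have "\<dots> < \<infinity>"
    using sp by (subst nn_integral_powr_from_0, simp, simp, subst nn_integral_has_integral_lebesgue[OF _ tail]) auto
  finally have "(\<integral>\<^sup>+h. F h * indicator {0<..} h \<partial>lborel) < \<infinity>" .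
  then have "(\<integral>\<^sup>+h. F \<bar>h\<bar> \<partial>lborel) < \<infinity>"
    by (subst nn_integral_even_kernel) (auto simp: ennreal_mult_less_top)
  then show ?thesis
    by (simp add: F_def)
qed

lemma dir_energy_tent:
  assumes "0 < s" "s < 1" "1 < p"
  shows "dir_energy i s p (tent :: real ^ 'n::finite \<Rightarrow> real) < \<infinity>"
proof -
  define V where "V = emeasure lborel (cball 0 1 :: (real ^ 'n) set)"
  have V: "V < \<infinity>"
    unfolding V_def by (rule emeasure_lborel_cball_finite)
  have mod_le: "dir_mod i p (tent :: real ^ 'n \<Rightarrow> real) h
      \<le> ennreal (2 powr p) * (2 * V) * ennreal (min \<bar>h\<bar> 1 powr p)" for h
  proof -
    let ?y = "h *\<^sub>R axis i 1 :: real ^ 'n"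
    have "dir_mod i p (tent :: real ^ 'n \<Rightarrow> real) h
      \<le> (\<integral>\<^sup>+x. ennreal (2 powr p * min \<bar>h\<bar> 1 powr p) *
           (indicator (cball 0 (1::real)) x + indicator (cball 0 1) (x + ?y)) \<partial>lborel)"
      unfolding dir_mod_def
    proof (intro nn_integral_mono)
      fix x :: "real ^ 'n"
      let ?a = "indicator (cball 0 1) x :: real" and ?b = "indicator (cball 0 1) (x + ?y) :: real"
      have "\<bar>tent x - tent (x + ?y)\<bar> powr p \<le> (min \<bar>h\<bar> 1 * (?a + ?b)) powr p"
        using tent_diff_le[of x ?y] assms by (intro powr_mono2) auto
      also have "\<dots> = min \<bar>h\<bar> 1 powr p * (?a + ?b) powr p"
        by (simp add: powr_mult)
      also have "\<dots> \<le> min \<bar>h\<bar> 1 powr p * (2 powr p * (?a powr p + ?b powr p))"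
        using powr_abs_add_le[of p ?a ?b] assms by (intro mult_left_mono) auto
      also have "?a powr p + ?b powr p = ?a + ?b"
        by (auto simp: indicator_def)
      finally have "\<bar>tent x - tent (x + ?y)\<bar> powr p \<le> 2 powr p * min \<bar>h\<bar> 1 powr p * (?a + ?b)"
        by (simp add: mult_ac)
      then have "ennreal (\<bar>tent x - tent (x + ?y)\<bar> powr p) \<le> ennreal (2 powr p * min \<bar>h\<bar> 1 powr p * (?a + ?b))"
        by (rule ennreal_leI)
      also have "\<dots> = ennreal (2 powr p * min \<bar>h\<bar> 1 powr p) * ennreal (?a + ?b)"
        by (rule ennreal_mult) auto
      also have "ennreal (?a + ?b) = indicator (cball 0 1) x + indicator (cball 0 1) (x + ?y)"
        by (simp add: ennreal_plus ennreal_indicator)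
      finally show "ennreal (\<bar>tent x - tent (x + ?y)\<bar> powr p) \<le> ennreal (2 powr p * min \<bar>h\<bar> 1 powr p) *
          (indicator (cball 0 1) x + indicator (cball 0 1) (x + ?y))" .
    qed
    also have "\<dots> = ennreal (2 powr p * min \<bar>h\<bar> 1 powr p) * (V + V)"
    proof -
      define I :: "real ^ 'n \<Rightarrow> ennreal" where "I = indicator (cball 0 1)"
      have I[measurable]: "I \<in> borel_measurable borel"
        unfolding I_def by (intro borel_measurable_indicator) simp
      have "(\<integral>\<^sup>+x. ennreal (2 powr p * min \<bar>h\<bar> 1 powr p) * (I x + I (x + ?y)) \<partial>lborel)
          = ennreal (2 powr p * min \<bar>h\<bar> 1 powr p) * ((\<integral>\<^sup>+x. I x \<partial>lborel) + (\<integral>\<^sup>+x. I (x + ?y) \<partial>lborel))"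
        by (simp add: nn_integral_cmult nn_integral_add)
      also have "(\<integral>\<^sup>+x. I (x + ?y) \<partial>lborel) = (\<integral>\<^sup>+x. I x \<partial>lborel)"
        by (rule nn_integral_translate[OF I])
      also have "(\<integral>\<^sup>+x. I x \<partial>lborel) = V"
        by (simp add: I_def V_def)
      finally show ?thesis
        by (simp add: I_def)
    qed
    also have "\<dots> = ennreal (2 powr p) * (2 * V) * ennreal (min \<bar>h\<bar> 1 powr p)"
      by (simp add: ennreal_mult mult_ac mult_2 distrib_left distrib_right)
    finally show ?thesis .
  qed
  have "dir_energy i s p (tent :: real ^ 'n \<Rightarrow> real)
      \<le> (\<integral>\<^sup>+h. ennreal (2 powr p) * (2 * V) * ennreal (min \<bar>h\<bar> 1 powr p * (1 / \<bar>h\<bar> powr (1 + s * p))) \<partial>lborel)"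
    unfolding dir_energy_def
  proof (intro nn_integral_mono)
    fix h :: real
    have "dir_mod i p (tent :: real ^ 'n \<Rightarrow> real) h * ennreal (1 / \<bar>h\<bar> powr (1 + s * p))
        \<le> ennreal (2 powr p) * (2 * V) * ennreal (min \<bar>h\<bar> 1 powr p) * ennreal (1 / \<bar>h\<bar> powr (1 + s * p))"
      by (intro mult_right_mono mod_le) simp
    also have "\<dots> = ennreal (2 powr p) * (2 * V) * ennreal (min \<bar>h\<bar> 1 powr p * (1 / \<bar>h\<bar> powr (1 + s * p)))"
      by (subst ennreal_mult) (auto simp: mult.assoc)
    finally show "dir_mod i p (tent :: real ^ 'n \<Rightarrow> real) h * ennreal (1 / \<bar>h\<bar> powr (1 + s * p))
        \<le> ennreal (2 powr p) * (2 * V) * ennreal (min \<bar>h\<bar> 1 powr p * (1 / \<bar>h\<bar> powr (1 + s * p)))" .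
  qed
  also have "\<dots> = ennreal (2 powr p) * (2 * V) * (\<integral>\<^sup>+h. ennreal (min \<bar>h\<bar> 1 powr p * (1 / \<bar>h\<bar> powr (1 + s * p))) \<partial>lborel)"
    by (rule nn_integral_cmult) measurable
  also have "\<dots> < \<infinity>"
    using V nn_integral_min_powr_kernel[OF assms] by (simp add: ennreal_mult_less_top)
  finally show ?thesis .
qed

text \<open>Pointwise convergence alone would permit concentration. The bound in L^q with q > 1
  gives uniform integrability: the part of |u k| above R costs at most R powr (1 - q) times
  \<open>m\<close>, and the truncated part tends to 0 by dominated convergence.\<close>

lemma box_avg_tendsto_0:
  fixes u :: "nat \<Rightarrow> real ^ 'n::finite \<Rightarrow> real"
  assumes u: "\<And>k. u k \<in> Lp lborel q" and q: "1 < q"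
    and mass: "\<And>k. (LINT x|lborel. \<bar>u k x\<bar> powr q) \<le> m"
    and lim: "AE x in lborel. (\<lambda>k. u k x) \<longlonglongrightarrow> 0"
  shows "(\<lambda>k. box_avg (\<lambda>_. 1) (u k) 0) \<longlonglongrightarrow> 0"
proof (rule LIMSEQ_I)
  fix e :: real assume e: "0 < e"
  have [measurable]: "u k \<in> borel_measurable borel" for k
    using LpD(1)[OF u[of k]] by simp
  have m: "0 \<le> m"
    using mass[of 0] by (meson Bochner_Integration.integral_nonneg order_trans powr_ge_zero)
  define d where "d = e / (2 * (m + 1))"
  have d: "0 < d"
    using e m by (simp add: d_def)
  have dm: "d * m < e / 2"
  proof -
    have "d * m < d * (m + 1)"
      using d by simp
    also have "d * (m + 1) = e / 2"
    proof -
      have "e / (2 * c) * c = e / 2" if "0 < c" for c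
        using that by simp
      from this[of "m + 1"] show ?thesis
        using m by (simp add: d_def)
    qed
    finally show ?thesis .
  qed
  \<comment> \<open>Solves R powr (1 - q) = d, so that \<open>le_add_powr\<close> with R has the
    coefficient d in front of |u|^q.\<close>
  define R where "R = d powr (1 / (1 - q))"
  have R: "0 < R" "R powr (1 - q) = d"
    using d q by (auto simp: R_def powr_powr)
  let ?B = "cbox 0 (1::real^'n)"
  have B: "integrable lborel (indicator ?B :: _ \<Rightarrow> real)"
    by (simp add: emeasure_cbox_01)
  have cut_int: "integrable lborel (\<lambda>x. indicator ?B x * min \<bar>u k x\<bar> R)" for k
    by (rule Bochner_Integration.integrable_bound[OF integrable_mult_left[OF B, of R]])
       (use R in \<open>auto simp: indicator_def\<close>)
  have "(\<lambda>k. LINT x|lborel. indicator ?B x * min \<bar>u k x\<bar> R) \<longlonglongrightarrow> (LINT x|(lborel :: (real^'n) measure). 0)"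
  proof (rule integral_dominated_convergence)
    show "integrable lborel (\<lambda>x. indicator ?B x * R)"
      by (rule integrable_mult_left[OF B])
    show "AE x in lborel. (\<lambda>k. indicator ?B x * min \<bar>u k x\<bar> R) \<longlonglongrightarrow> 0"
      using lim
    proof eventually_elim
      case (elim x)
      then have "(\<lambda>k. min \<bar>u k x\<bar> R) \<longlonglongrightarrow> min \<bar>0\<bar> R"
        by (intro tendsto_intros)
      then show ?case
        using R by (intro tendsto_mult_right_zero) simp
    qed
    show "AE x in lborel. norm (indicator ?B x * min \<bar>u k x\<bar> R) \<le> indicator ?B x * R" for k
      using R by (auto simp: indicator_def)
  qed measurable
  then obtain k0 where k0: "\<And>k. k \<ge> k0 \<Longrightarrow> norm ((LINT x|lborel. indicator ?B x * min \<bar>u k x\<bar> R) - 0) < e / 2"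
    using LIMSEQ_D[of "\<lambda>k. LINT x|lborel. indicator ?B x * min \<bar>u k x\<bar> R" 0 "e / 2"] e by auto
  show "\<exists>k0. \<forall>k\<ge>k0. norm (box_avg (\<lambda>_. 1) (u k) 0 - 0) < e"
  proof (intro exI allI impI)
    fix k assume k: "k \<ge> k0"
    have cs: "cscale (\<lambda>_. 1) h = h" for h :: "real ^ 'n"
      by (simp add: cscale_def)
    have int: "integrable lborel (\<lambda>x. indicator ?B x * u k x)"
      using integrable_box_avg[OF u[of k] q, of "\<lambda>_. 1" 0] by (simp add: cs)
    have "\<bar>box_avg (\<lambda>_. 1) (u k) 0\<bar> \<le> (LINT x|lborel. \<bar>indicator ?B x * u k x\<bar>)"
      unfolding box_avg_def by (simp add: cs integral_abs_bound)
    also have "\<dots> \<le> (LINT x|lborel. indicator ?B x * min \<bar>u k x\<bar> R + d * \<bar>u k x\<bar> powr q)"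
    proof (intro integral_mono integrable_abs int Bochner_Integration.integrable_add cut_int integrable_mult_right LpD(2)[OF u])
      fix x
      have "\<bar>u k x\<bar> \<le> min \<bar>u k x\<bar> R + d * \<bar>u k x\<bar> powr q"
        using le_add_powr[OF q abs_ge_zero R(1), of "u k x"] d by (auto simp: R min_def)
      then show "\<bar>indicator ?B x * u k x\<bar> \<le> indicator ?B x * min \<bar>u k x\<bar> R + d * \<bar>u k x\<bar> powr q"
        using d by (auto simp: indicator_def)
    qed
    also have "\<dots> = (LINT x|lborel. indicator ?B x * min \<bar>u k x\<bar> R) + d * (LINT x|lborel. \<bar>u k x\<bar> powr q)"
      using cut_int LpD(2)[OF u[of k]] by simp
    also have "\<dots> \<le> (LINT x|lborel. indicator ?B x * min \<bar>u k x\<bar> R) + d * m"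
      using d mass[of k] by simp
    also have "\<dots> < e"
      using k0[OF k] dm by auto
    finally show "norm (box_avg (\<lambda>_. 1) (u k) 0 - 0) < e"
      by simp
  qed
qed

section \<open>The variational problem\<close>

locale aniso_exponents =
  fixes s p :: "'n::finite \<Rightarrow> real"
  assumes s: "\<And>i. 0 < s i \<and> s i < 1"
    and p: "\<And>i. 1 < p i"
    and sp_less: "sp_bar s p < real CARD('n)"
    and pmax_less: "p_max p < p_star s p"
begin

abbreviation q :: real where "q \<equiv> p_star s p"

abbreviation Q :: "'n \<Rightarrow> (real ^ 'n \<Rightarrow> real) \<Rightarrow> (real ^ 'n) \<times> real \<Rightarrow> real" where
  "Q i \<equiv> quot i (s i) (p i)"

abbreviation PM :: "((real ^ 'n) \<times> real) measure" where "PM \<equiv> lborel \<Otimes>\<^sub>M lborel"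

text \<open>\<open>\<alpha>\<close> is \<open>n\<close> divided by \<open>sp_bar\<close>, and \<open>\<theta>\<close> is the homogeneity of the infimum of \<open>J\<close> in the mass.\<close>

definition \<alpha> :: real where "\<alpha> = (\<Sum>i\<in>UNIV. 1 / (s i * p i))"

definition \<theta> :: real where "\<theta> = 1 - 1 / \<alpha>"

definition mass :: "(real ^ 'n \<Rightarrow> real) \<Rightarrow> real" where
  "mass u = (LINT x|lborel. \<bar>u x\<bar> powr q)"

definition E :: "'n \<Rightarrow> (real ^ 'n \<Rightarrow> real) \<Rightarrow> real" where
  "E i u = (LINT z|PM. \<bar>Q i u z\<bar> powr p i)"

text \<open>Differentiating |.|^p_i produces a factor p_i, so the weights become the s_i (1 - s_i) /
  2 of \<open>aniso_form\<close>.\<close>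

definition J :: "(real ^ 'n \<Rightarrow> real) \<Rightarrow> real" where
  "J u = (\<Sum>i\<in>UNIV. s i * (1 - s i) / (2 * p i) * E i u)"

lemma pq: "p i < q"
proof -
  have "p i \<le> p_max p"
    unfolding p_max_def by (rule Max_ge) auto
  then show ?thesis
    using pmax_less by simp
qed

lemma q_gt_1: "1 < q"
  using p pq less_trans by blast

lemma p_pos: "0 < p i"
  using p[of i] by simp

lemma sp_pos: "0 < s i * p i"
  using s[of i] p_pos[of i] by simp

lemma \<alpha>_gt_1: "1 < \<alpha>"
proof -
  have pos: "0 < \<alpha>"
    unfolding \<alpha>_def using sp_pos by (intro sum_pos) auto
  have "sp_bar s p = CARD('n) / \<alpha>"
    by (simp add: sp_bar_def \<alpha>_def)
  then have "CARD('n) / \<alpha> < CARD('n)"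
    using sp_less by simp
  then show ?thesis
    using pos by (simp add: field_simps)
qed

lemma \<theta>: "0 < \<theta>" "\<theta> < 1"
  using \<alpha>_gt_1 by (auto simp: \<theta>_def)

text \<open>The formula for \<open>p_star\<close> amounts to q (\<alpha> - 1) being the sum of all 1
  / s i. In the present form it says that the boxes with sides a powr (- (q - p i) / (s i * p i))
  have volume a powr (- q).\<close>

lemma exponent_sum: "(\<Sum>i\<in>UNIV. (q - p i) / (s i * p i)) = q"
proof -
  define B where "B = (\<Sum>i\<in>UNIV. 1 / s i)"
  define n :: real where "n = CARD('n)"
  have n: "0 < n"
    by (simp add: n_def)
  have B: "0 < B"
    unfolding B_def using s by (intro sum_pos) auto
  have "q = (n * (n / \<alpha>) / (n / B)) / (n - n / \<alpha>)"
    by (simp add: p_star_def sp_bar_def s_bar_def \<alpha>_def B_def n_def)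
  also have "\<dots> = B / (\<alpha> - 1)"
    using n B \<alpha>_gt_1 by (simp add: divide_simps) (simp add: algebra_simps)
  finally have "q * (\<alpha> - 1) = B"
    using \<alpha>_gt_1 by simp
  moreover have "(\<Sum>i\<in>UNIV. (q - p i) / (s i * p i)) = q * \<alpha> - B"
  proof -
    have "(q - p i) / (s i * p i) = q * (1 / (s i * p i)) - 1 / s i" for i
      using p_pos[of i] s[of i] by (simp add: diff_divide_distrib)
    then show ?thesis
      by (simp only: sum_subtractf sum_distrib_left[symmetric] \<alpha>_def B_def)
  qed
  ultimately show ?thesis
    by (simp add: algebra_simps)
qed

lemma space_iff: "u \<in> aniso_space s p \<longleftrightarrow> u \<in> Lp lborel q \<and> (\<forall>i. Q i u \<in> Lp PM (p i))"
  using aniso_space_iff[OF p s] .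

lemma spaceD:
  assumes "u \<in> aniso_space s p"
  shows "u \<in> Lp lborel q" "Q i u \<in> Lp PM (p i)" "u \<in> borel_measurable borel"
  using assms LpD(1)[of u lborel q] by (auto simp: space_iff)

lemma dir_energy_eq:
  assumes "u \<in> aniso_space s p"
  shows "dir_energy i (s i) (p i) u = ennreal (E i u)"
  using LpD(2)[OF spaceD(2)[OF assms, of i]] nn_integral_quot[OF spaceD(3)[OF assms] p[of i], of i "s i"]
  by (simp add: E_def nn_integral_eq_integral)

lemma spaceI:
  assumes "u \<in> Lp lborel q" "\<And>i. dir_energy i (s i) (p i) u < \<infinity>"
  shows "u \<in> aniso_space s p"
proof -
  have "u \<in> borel_measurable borel"
    using LpD(1)[OF assms(1)] by simp
  then show ?thesis
    using assms by (auto simp: space_iff quot_Lp_iff p)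
qed

lemma E_nonneg: "0 \<le> E i u"
  by (simp add: E_def)

lemma weight_pos: "0 < s i * (1 - s i) / (2 * p i)"
  using s[of i] p_pos[of i] by simp

lemma J_nonneg: "0 \<le> J u"
  unfolding J_def using weight_pos E_nonneg by (intro sum_nonneg mult_nonneg_nonneg) (auto intro: less_imp_le)

lemma mass_nonneg: "0 \<le> mass u"
  by (simp add: mass_def)

lemma E_le_J: "E i u \<le> J u / (s i * (1 - s i) / (2 * p i))"
proof -
  have "s i * (1 - s i) / (2 * p i) * E i u \<le> J u"
    unfolding J_def using weight_pos E_nonneg by (intro member_le_sum mult_nonneg_nonneg) (auto intro: less_imp_le)
  then show ?thesis
    using weight_pos[of i] by (simp only: pos_le_divide_eq mult.commute)
qed

lemma space_lincomb:
  assumes "u \<in> aniso_space s p" "v \<in> aniso_space s p"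
  shows "(\<lambda>x. u x + c * v x) \<in> aniso_space s p"
  using assms q_gt_1 p_pos by (auto simp: space_iff quot_lincomb intro!: Lp_lincomb)

lemma space_diff:
  assumes "u \<in> aniso_space s p" "v \<in> aniso_space s p"
  shows "(\<lambda>x. u x - v x) \<in> aniso_space s p"
  using space_lincomb[OF assms, of "-1"] by simp

lemma rescale:
  assumes u: "u \<in> aniso_space s p" and b: "\<And>j. 0 < b j" and a: "0 < a"
  shows "(\<lambda>x. a * u (t + cscale b x)) \<in> aniso_space s p"
    and "mass (\<lambda>x. a * u (t + cscale b x)) = a powr q / (\<Prod>j\<in>UNIV. b j) * mass u"
    and "E i (\<lambda>x. a * u (t + cscale b x)) = a powr p i * b i powr (s i * p i) / (\<Prod>j\<in>UNIV. b j) * E i u"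
proof -
  have pos: "0 < (\<Prod>j\<in>UNIV. b j)"
    using b by (intro prod_pos) auto
  have en: "dir_energy i (s i) (p i) (\<lambda>x. a * u (t + cscale b x))
      = ennreal (a powr p i * b i powr (s i * p i) / (\<Prod>j\<in>UNIV. b j) * E i u)" for i
    using dir_energy_rescale[OF spaceD(3)[OF u] b a p, of i "s i" i t] pos E_nonneg[of i u]
    by (simp add: dir_energy_eq[OF u] ennreal_mult[symmetric])
  show v: "(\<lambda>x. a * u (t + cscale b x)) \<in> aniso_space s p"
    by (intro spaceI Lp_rescale(1)[OF spaceD(1)[OF u] b a]) (simp add: en)
  show "mass (\<lambda>x. a * u (t + cscale b x)) = a powr q / (\<Prod>j\<in>UNIV. b j) * mass u"
    unfolding mass_def by (rule Lp_rescale(2)[OF spaceD(1)[OF u] b a])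
  show "E i (\<lambda>x. a * u (t + cscale b x)) = a powr p i * b i powr (s i * p i) / (\<Prod>j\<in>UNIV. b j) * E i u"
    using dir_energy_eq[OF v, of i] pos E_nonneg[of i] unfolding en by (subst (asm) ennreal_inj) auto
qed

lemma normalize:
  assumes u: "u \<in> aniso_space s p" and m: "0 < mass u" "0 < m"
  obtains b where "(\<lambda>x. u (cscale b x)) \<in> aniso_space s p"
    "mass (\<lambda>x. u (cscale b x)) = m"
    "J (\<lambda>x. u (cscale b x)) = (m / mass u) powr \<theta> * J u"
proof -
  \<comment> \<open>The dilation by \<open>b\<close> divides the mass by t powr \<alpha>;
    \<open>t\<close> is solved from the requirement that the new mass is \<open>m\<close>.\<close>
  define t where "t = (mass u / m) powr (1 / \<alpha>)"
  define b where "b i = t powr (1 / (s i * p i))" for i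
  have t: "0 < t"
    using m by (simp add: t_def)
  have b: "0 < b i" for i
    using t by (simp add: b_def)
  have prod_b: "(\<Prod>i\<in>UNIV. b i) = t powr \<alpha>"
    using t by (simp add: b_def \<alpha>_def powr_sum)
  have t_alpha: "t powr \<alpha> = mass u / m"
    using m \<alpha>_gt_1 by (simp add: t_def powr_powr)
  have bsp: "b i powr (s i * p i) = t" for i
    using t s[of i] p_pos[of i] by (simp add: b_def powr_powr)
  have ratio: "t / (mass u / m) = (m / mass u) powr \<theta>"
  proof -
    have "t / (mass u / m) = t powr 1 / t powr \<alpha>"
      using t by (simp add: t_alpha)
    also have "\<dots> = t powr (1 - \<alpha>)"
      by (simp add: powr_diff)
    also have "\<dots> = (mass u / m) powr (- \<theta>)"
    proof -
      have "1 / \<alpha> * (1 - \<alpha>) = - \<theta>"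
        using \<alpha>_gt_1 by (simp add: \<theta>_def field_simps)
      then show ?thesis
        by (simp add: t_def powr_powr)
    qed
    also have "\<dots> = (m / mass u) powr \<theta>"
      using m by (simp add: powr_minus powr_divide field_simps)
    finally show ?thesis .
  qed
  note resc = rescale[OF u b zero_less_one, where t = 0, simplified]
  show thesis
  proof
    show "(\<lambda>x. u (cscale b x)) \<in> aniso_space s p"
      by (rule resc(1))
    show "mass (\<lambda>x. u (cscale b x)) = m"
      using m by (simp add: resc(2) prod_b t_alpha)
    have "E i (\<lambda>x. u (cscale b x)) = (m / mass u) powr \<theta> * E i u" for i
      by (simp only: resc(3) prod_b t_alpha bsp times_divide_eq_left[symmetric] ratio)
    then show "J (\<lambda>x. u (cscale b x)) = (m / mass u) powr \<theta> * J u"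
      by (simp add: J_def sum_distrib_left mult_ac)
  qed
qed

text \<open>The sides for which \<open>u (x + cscale (box_side a) y) / a\<close> has the same mass and the same energies as \<open>u\<close>.\<close>

definition box_side :: "real \<Rightarrow> 'n \<Rightarrow> real" where
  "box_side a i = a powr (- ((q - p i) / (s i * p i)))"

lemma box_side_pos: "0 < a \<Longrightarrow> 0 < box_side a i"
  by (simp add: box_side_def)

lemma prod_box_side: "0 < a \<Longrightarrow> (\<Prod>i\<in>UNIV. box_side a i) = a powr (- q)"
proof -
  assume a: "0 < a"
  have "(\<Prod>i\<in>UNIV. box_side a i) = a powr (\<Sum>i\<in>UNIV. - ((q - p i) / (s i * p i)))"
    using a by (simp add: box_side_def powr_sum)
  then show ?thesis
    by (simp add: sum_negf exponent_sum)
qed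

text \<open>Carries an arbitrary box of the family to the unit cube at 0. In the mass the amplitude
  1 / a offsets the Jacobian; in each energy the remaining factor a powr (q - p i) is offset by the
  side in direction i.\<close>

lemma rescale_invariant:
  fixes x :: "real ^ 'n"
  assumes u: "u \<in> aniso_space s p" and a: "0 < a"
  defines "v \<equiv> \<lambda>y. 1 / a * u (x + cscale (box_side a) y)"
  shows "v \<in> aniso_space s p" "mass v = mass u" "E i v = E i u"
    "box_avg (\<lambda>_. 1) v 0 = box_avg (box_side a) u x / a"
proof -
  have inv: "0 < 1 / a"
    using a by simp
  note resc = rescale[where b = "box_side a" and t = x, OF u box_side_pos[OF a] inv, folded v_def]
  show "v \<in> aniso_space s p"
    by (rule resc(1))
  show "mass v = mass u"
    using a by (simp add: resc(2) prod_box_side powr_divide powr_minus field_simps)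
  have "box_side a i powr (s i * p i) = a powr (p i - q)"
    using s[of i] p_pos[of i] by (simp add: box_side_def powr_powr)
  also have "\<dots> = a powr p i * a powr (- q)"
    by (simp add: powr_add[symmetric])
  finally have "(1 / a) powr p i * box_side a i powr (s i * p i) / (\<Prod>j\<in>UNIV. box_side a j) = 1"
    using a by (simp add: prod_box_side powr_divide)
  then show "E i v = E i u"
    by (simp only: resc(3) mult_1_left)
  have "cscale (\<lambda>_. 1) h = h" for h :: "real ^ 'n"
    by (simp add: cscale_def)
  then show "box_avg (\<lambda>_. 1) v 0 = box_avg (box_side a) u x / a"
    by (simp add: box_avg_def v_def)
qed

lemma Sobolev_const_nonneg: "0 \<le> Sobolev_const q (s i) (p i) i"
  unfolding Sobolev_const_def using q_gt_1 pq[of i] s[of i] p_pos[of i]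
  by (intro mult_nonneg_nonneg divide_nonneg_nonneg add_nonneg_nonneg) auto

lemma Sobolev_E:
  assumes u: "u \<in> aniso_space s p" and m: "mass u = 1" and M: "0 < M"
    and avg: "\<And>a x. 0 < a \<Longrightarrow> \<bar>box_avg (box_side a) u x\<bar> \<le> M * a"
  shows "1 \<le> (\<Sum>i\<in>UNIV. Sobolev_const q (s i) (p i) i * M powr (q - p i) * E i u)"
proof -
  note C = Sobolev_const_nonneg
  have "ennreal 1 = (\<integral>\<^sup>+x. ennreal (\<bar>u x\<bar> powr q) \<partial>lborel)"
    using LpD(2)[OF spaceD(1)[OF u]] m by (simp add: nn_integral_eq_integral mass_def)
  also have "\<dots> \<le> (\<Sum>i\<in>UNIV. ennreal (Sobolev_const q (s i) (p i) i * M powr (q - p i)) * dir_energy i (s i) (p i) u)"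
    using s by (intro refined_Sobolev spaceD(1)[OF u] p pq M avg[unfolded box_side_def]) auto
  also have "\<dots> = (\<Sum>i\<in>UNIV. ennreal (Sobolev_const q (s i) (p i) i * M powr (q - p i) * E i u))"
    using C E_nonneg by (simp add: dir_energy_eq[OF u] ennreal_mult)
  also have "\<dots> = ennreal (\<Sum>i\<in>UNIV. Sobolev_const q (s i) (p i) i * M powr (q - p i) * E i u)"
    using C E_nonneg by (intro sum_ennreal) auto
  finally show ?thesis
    using C E_nonneg by (subst (asm) ennreal_le_iff) (auto intro!: sum_nonneg)
qed

text \<open>With the parameter \<open>a\<close> in \<open>box_avg_abs_le\<close> both terms are
  equal to a at mass 1. So M = 2 is always admissible in \<open>Sobolev_E\<close>.\<close>

lemma box_avg_le:
  assumes u: "u \<in> aniso_space s p" and m: "mass u = 1" and a: "0 < a"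
  shows "\<bar>box_avg (box_side a) u x\<bar> \<le> 2 * a"
proof -
  have "\<bar>box_avg (box_side a) u x\<bar> \<le> a + a powr (1 - q) / (\<Prod>i\<in>UNIV. box_side a i) * mass u"
    unfolding mass_def by (intro box_avg_abs_le spaceD(1)[OF u] q_gt_1 box_side_pos a)
  also have "a powr (1 - q) / (\<Prod>i\<in>UNIV. box_side a i) = a"
    using a by (simp add: prod_box_side powr_diff[symmetric])
  finally show ?thesis
    using m by simp
qed

lemma J_lower_bound: "\<exists>c>0. \<forall>u\<in>aniso_space s p. mass u = 1 \<longrightarrow> c \<le> J u"
proof -
  define C where "C = (\<Sum>i\<in>UNIV. Sobolev_const q (s i) (p i) i * 2 powr (q - p i) / (s i * (1 - s i) / (2 * p i)))"
  have le: "1 \<le> C * J u" if "u \<in> aniso_space s p" "mass u = 1" for u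
  proof -
    have "1 \<le> (\<Sum>i\<in>UNIV. Sobolev_const q (s i) (p i) i * 2 powr (q - p i) * E i u)"
      using that by (intro Sobolev_E box_avg_le) auto
    also have "\<dots> \<le> (\<Sum>i\<in>UNIV. Sobolev_const q (s i) (p i) i * 2 powr (q - p i) * (J u / (s i * (1 - s i) / (2 * p i))))"
      using Sobolev_const_nonneg by (intro sum_mono mult_left_mono E_le_J) auto
    also have "\<dots> = C * J u"
      unfolding C_def sum_distrib_right by (intro sum.cong) auto
    finally show ?thesis .
  qed
  \<comment> \<open>The maximum with 1 guarantees a positive denominator, hence a positive lower
    bound.\<close>
  have "1 / max 1 C \<le> J u" if "u \<in> aniso_space s p" "mass u = 1" for u
  proof -
    have "1 \<le> C * J u"
      by (rule le[OF that])
    also have "\<dots> \<le> max 1 C * J u"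
      using J_nonneg by (intro mult_right_mono) auto
    finally show ?thesis
      by (simp add: divide_le_eq mult.commute)
  qed
  then show ?thesis
    by (intro exI[of _ "1 / max 1 C"]) auto
qed

text \<open>If M bounded all averages, mass 1 would force 1 <= g M. As p i < q, g M tends to 0 with
  M, so some M fails to be such a bound, and it depends on K but not on u.\<close>

lemma nonvanishing:
  assumes K: "0 \<le> K"
  shows "\<exists>c>0. \<forall>u\<in>aniso_space s p. mass u = 1 \<longrightarrow> (\<forall>i. E i u \<le> K) \<longrightarrow>
    (\<exists>a>0. \<exists>x. c * a < \<bar>box_avg (box_side a) u x\<bar>)"
proof -
  define g where "g M = (\<Sum>i\<in>UNIV. Sobolev_const q (s i) (p i) i * M powr (q - p i) * K)" for M
  have "(g \<longlongrightarrow> (\<Sum>i\<in>UNIV. Sobolev_const q (s i) (p i) i * 0 powr (q - p i) * K)) (at_right 0)"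
    unfolding g_def using pq
    by (intro tendsto_intros tendsto_powr') (auto simp: eventually_at_right_less intro: eventually_mono[OF eventually_at_right_less])
  then have "(g \<longlongrightarrow> 0) (at_right 0)"
    by simp
  then have "\<forall>\<^sub>F M in at_right 0. g M < 1"
    by (rule order_tendstoD) simp
  then have "\<forall>\<^sub>F M in at_right (0::real). 0 < M \<and> g M < 1"
    using eventually_at_right_less[of 0] by eventually_elim auto
  then obtain M where M: "0 < M" "g M < 1"
    using eventually_happens[of _ "at_right (0::real)"] by auto
  have "\<exists>a>0. \<exists>x. M * a < \<bar>box_avg (box_side a) u x\<bar>"
    if u: "u \<in> aniso_space s p" "mass u = 1" "\<forall>i. E i u \<le> K" for u
  proof (rule ccontr)
    assume "\<not> ?thesis"
    then have "\<bar>box_avg (box_side a) u x\<bar> \<le> M * a" if "0 < a" for a x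
      using that by (meson not_less)
    then have "1 \<le> (\<Sum>i\<in>UNIV. Sobolev_const q (s i) (p i) i * M powr (q - p i) * E i u)"
      using u M by (intro Sobolev_E) auto
    also have "\<dots> \<le> g M"
      unfolding g_def using u Sobolev_const_nonneg by (intro sum_mono mult_left_mono) auto
    finally show False
      using M by simp
  qed
  then show ?thesis
    using M(1) by blast
qed

end

section \<open>Existence of a minimizer\<close>

text \<open>Applied to the mass of the limit and to the mass lost in the limit, this makes any
  splitting strictly more expensive than S.\<close>

lemma powr_gt_self:
  fixes m t :: real
  assumes "0 < m" "m < 1" "t < 1"
  shows "m < m powr t"
  using powr_less_mono'[of m t 1] assms by simp

context aniso_exponents
begin

definition S :: real where "S = Inf {J u |u. u \<in> aniso_space s p \<and> mass u = 1}"

lemma exists_mass_1: "\<exists>u\<in>aniso_space s p. mass u = 1"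
proof -
  have "(tent :: real ^ 'n \<Rightarrow> real) \<in> aniso_space s p"
    using q_gt_1 s p by (intro spaceI tent_Lp dir_energy_tent) auto
  moreover have "0 < mass tent"
    unfolding mass_def using q_gt_1 by (intro tent_Lp) auto
  ultimately show ?thesis
    using normalize[of tent 1] by (metis zero_less_one)
qed

lemma S_bdd: "bdd_below {J u |u. u \<in> aniso_space s p \<and> mass u = 1}"
  using J_nonneg by (auto intro!: bdd_belowI[of _ 0])

lemma S_pos: "0 < S"
proof -
  obtain c where c: "0 < c" "\<forall>u\<in>aniso_space s p. mass u = 1 \<longrightarrow> c \<le> J u"
    using J_lower_bound by blast
  have "c \<le> S"
    unfolding S_def using exists_mass_1 c by (intro cInf_greatest) auto
  then show ?thesis
    using c by simp
qed

lemma S_le: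
  assumes "u \<in> aniso_space s p"
  shows "S * mass u powr \<theta> \<le> J u"
\<comment> \<open>Functions of mass 0 cannot be normalized; for them the left-hand side is 0 because
  0 powr \<theta> is 0.\<close>
proof (cases "mass u = 0")
  case False
  then have m: "0 < mass u"
    using mass_nonneg[of u] by simp
  obtain b where b: "(\<lambda>x. u (cscale b x)) \<in> aniso_space s p"
    "mass (\<lambda>x. u (cscale b x)) = 1"
    "J (\<lambda>x. u (cscale b x)) = (1 / mass u) powr \<theta> * J u"
    using normalize[OF assms m zero_less_one] by blast
  have "S \<le> J (\<lambda>x. u (cscale b x))"
    unfolding S_def using b by (intro cInf_lower S_bdd) blast
  then have "S \<le> (1 / mass u) powr \<theta> * J u"
    by (simp only: b(3))
  then show ?thesis
    using m by (simp add: powr_divide field_simps)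
qed (use J_nonneg in simp)

lemma minimizing_sequence:
  obtains w c where "\<And>k. w k \<in> aniso_space s p" "\<And>k. mass (w k) = 1"
    "\<And>k. J (w k) < S + 1 / (real k + 1)" "0 < c" "\<And>k. c < \<bar>box_avg (\<lambda>_. 1) (w k) 0\<bar>"
proof -
  \<comment> \<open>The sum of the bounds for the single directions is one bound for all of them, as
    \<open>nonvanishing\<close> requires.\<close>
  define K where "K = (\<Sum>i\<in>UNIV. (S + 1) / (s i * (1 - s i) / (2 * p i)))"
  have nn: "0 \<le> (S + 1) / (s i * (1 - s i) / (2 * p i))" for i
    using S_pos weight_pos[of i] by (intro divide_nonneg_pos) auto
  then have K: "0 \<le> K"
    unfolding K_def by (intro sum_nonneg) auto
  have E_le_K: "E i u \<le> K" if "J u \<le> S + 1" for i u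
  proof -
    have "E i u \<le> J u / (s i * (1 - s i) / (2 * p i))"
      by (rule E_le_J)
    also have "\<dots> \<le> (S + 1) / (s i * (1 - s i) / (2 * p i))"
      using that weight_pos[of i] by (intro divide_right_mono) auto
    also have "\<dots> \<le> K"
      unfolding K_def using nn by (intro member_le_sum) auto
    finally show ?thesis .
  qed
  obtain c where c: "0 < c" and nonvan: "\<And>u. u \<in> aniso_space s p \<Longrightarrow> mass u = 1 \<Longrightarrow> \<forall>i. E i u \<le> K \<Longrightarrow>
    \<exists>a>0. \<exists>x. c * a < \<bar>box_avg (box_side a) u x\<bar>"
    using nonvanishing[OF K] by blast
  have "\<exists>v. v \<in> aniso_space s p \<and> mass v = 1 \<and> J v < S + 1 / (real k + 1) \<and> c < \<bar>box_avg (\<lambda>_. 1) v 0\<bar>" for k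
  proof -
    have "S < S + 1 / (real k + 1)"
      by simp
    then obtain u where u: "u \<in> aniso_space s p" "mass u = 1" "J u < S + 1 / (real k + 1)"
      unfolding S_def using cInf_lessD[of "{J u |u. u \<in> aniso_space s p \<and> mass u = 1}"] exists_mass_1 by blast
    have "1 / (real k + 1) \<le> 1"
      by simp
    then have "J u \<le> S + 1"
      using u(3) by linarith
    then obtain a x where a: "0 < a" and x: "c * a < \<bar>box_avg (box_side a) u x\<bar>"
      using nonvan[OF u(1,2)] E_le_K by blast
    define v where "v = (\<lambda>y. 1 / a * u (x + cscale (box_side a) y))"
    note inv = rescale_invariant[where x = x, OF u(1) a, folded v_def]
    have "J v = J u"
      by (simp add: J_def inv(3))
    moreover have "c < \<bar>box_avg (\<lambda>_. 1) v 0\<bar>"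
      using x a by (simp add: inv(4) field_simps)
    ultimately show ?thesis
      using inv u by auto
  qed
  then obtain w where w: "\<And>k. w k \<in> aniso_space s p \<and> mass (w k) = 1 \<and> J (w k) < S + 1 / (real k + 1)
      \<and> c < \<bar>box_avg (\<lambda>_. 1) (w k) 0\<bar>"
    by metis
  show thesis
    by (rule that[of w c]) (use w c in auto)
qed

lemma minimizer_exists: "\<exists>u\<in>aniso_space s p. mass u = 1 \<and> J u = S"
proof -
  obtain w c where w: "\<And>k. w k \<in> aniso_space s p" "\<And>k. mass (w k) = 1"
    "\<And>k. J (w k) < S + 1 / (real k + 1)" and c: "0 < c" "\<And>k. c < \<bar>box_avg (\<lambda>_. 1) (w k) 0\<bar>"
    using minimizing_sequence by blast
  have Jw_le: "J (w k) \<le> S + 1" for k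
  proof -
    have "1 / (real k + 1) \<le> 1"
      by simp
    then show ?thesis
      using w(3)[of k] by linarith
  qed
  define K where "K i = (S + 1) / (s i * (1 - s i) / (2 * p i))" for i
  have K: "0 \<le> K i" for i
    unfolding K_def using S_pos weight_pos[of i] by (intro divide_nonneg_pos) auto
  have Ew_le: "E i (w k) \<le> K i" for i k
    using E_le_J[of i "w k"] divide_right_mono[OF Jw_le[of k], of "s i * (1 - s i) / (2 * p i)"] weight_pos[of i]
    unfolding K_def by linarith
  have en: "dir_energy i (s i) (p i) (w k) \<le> ennreal (\<Sum>i\<in>UNIV. K i)" for k i
  proof -
    have "K i \<le> (\<Sum>i\<in>UNIV. K i)"
      using K by (intro member_le_sum) auto
    then show ?thesis
      unfolding dir_energy_eq[OF w(1)] using Ew_le[of i k] by (intro ennreal_leI) linarith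
  qed
  obtain r v where r: "strict_mono (r :: nat \<Rightarrow> nat)" and v_meas: "v \<in> borel_measurable borel"
    and lim: "AE x in lborel. (\<lambda>k. w (r k) x) \<longlonglongrightarrow> v x"
  proof (rule AE_convergent_subseq_energy[of w q s p "\<Sum>i\<in>UNIV. K i" 1])
    show "w k \<in> Lp lborel q" for k
      by (rule spaceD(1)[OF w(1)])
    show "(LINT x|lborel. \<bar>w k x\<bar> powr q) \<le> 1" for k
      using w(2)[of k] by (simp add: mass_def)
  qed (use q_gt_1 s p K en in \<open>auto intro: sum_nonneg\<close>)
  define u where "u k = w (r k)" for k
  have u: "u k \<in> aniso_space s p" "mass (u k) = 1" "E i (u k) \<le> K i" for k i
    using w Ew_le by (auto simp: u_def)
  have u_lim: "AE x in lborel. (\<lambda>k. u k x) \<longlonglongrightarrow> v x"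
    using lim by (simp add: u_def)
  have Ju_lim: "(\<lambda>k. J (u k)) \<longlonglongrightarrow> S"
  proof (rule tendsto_sandwich)
    have "S \<le> J (u k)" for k
      using S_le[OF u(1)[of k]] u(2)[of k] by simp
    then show "\<forall>\<^sub>F k in sequentially. S \<le> J (u k)"
      by simp
    have "J (u k) \<le> S + 1 / (real k + 1)" for k
    proof -
      \<comment> \<open>A subsequence has r k >= k, so the rate of the minimizing sequence is
        inherited.\<close>
      have "1 / (real (r k) + 1) \<le> 1 / (real k + 1)"
        using seq_suble[OF r, of k] by (intro divide_left_mono) auto
      then show ?thesis
        using w(3)[of "r k"] unfolding u_def by linarith
    qed
    then show "\<forall>\<^sub>F k in sequentially. J (u k) \<le> S + 1 / (real k + 1)"
      by simp
    have "(\<lambda>k. S + 1 / (real k + 1)) \<longlonglongrightarrow> S + 0"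
      using LIMSEQ_inverse_real_of_nat by (intro tendsto_intros) (simp add: inverse_eq_divide add.commute)
    then show "(\<lambda>k. S + 1 / (real k + 1)) \<longlonglongrightarrow> S"
      by simp
  qed auto
  have v_Lp: "v \<in> Lp lborel q" and v_mass: "mass v \<le> 1"
    using Lp_Fatou[of u lborel q v 1] spaceD(1)[OF u(1)] v_meas q_gt_1 u_lim u(2)
    by (auto simp: mass_def)
  have Q_lim: "AE z in PM. (\<lambda>k. Q i (u k) z) \<longlonglongrightarrow> Q i v z" for i
    by (rule AE_quot_tendsto[OF u_lim])
  have "Q i v \<in> Lp PM (p i)" for i
    by (rule Lp_Fatou(1)[of "\<lambda>k. Q i (u k)" PM "p i" "Q i v" "K i"])
       (use spaceD(2)[OF u(1)] v_meas p_pos Q_lim u(3) in \<open>auto simp: E_def\<close>)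
  then have v: "v \<in> aniso_space s p"
    using v_Lp by (simp add: space_iff)
  \<comment> \<open>Otherwise u k would tend to 0 almost everywhere, hence so would its averages
    over the unit cube, against their lower bound \<open>c\<close>.\<close>
  have v_pos: "0 < mass v"
  proof (rule ccontr)
    assume "\<not> 0 < mass v"
    then have "(LINT x|lborel. \<bar>v x\<bar> powr q) = 0"
      using mass_nonneg[of v] unfolding mass_def by linarith
    then have "AE x in lborel. \<bar>v x\<bar> powr q = 0"
      using LpD(2)[OF v_Lp] by (subst (asm) integral_nonneg_eq_0_iff_AE) auto
    then have "AE x in lborel. (\<lambda>k. u k x) \<longlonglongrightarrow> 0"
      using u_lim by eventually_elim auto
    then have "(\<lambda>k. box_avg (\<lambda>_. 1) (u k) 0) \<longlonglongrightarrow> 0"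
      using spaceD(1)[OF u(1)] u(2) q_gt_1 by (intro box_avg_tendsto_0[of u q 1]) (auto simp: mass_def)
    from LIMSEQ_D[OF this c(1)] obtain k where "\<bar>box_avg (\<lambda>_. 1) (u k) 0\<bar> < c"
      by auto
    then show False
      using c(2)[of "r k"] by (simp add: u_def)
  qed
  \<comment> \<open>The remainder carries what is lost in the limit: its mass tends to 1 - mass v
    and its J to S - J v.\<close>
  define d where "d k = (\<lambda>x. u k x - v x)" for k
  have d: "d k \<in> aniso_space s p" for k
    unfolding d_def by (rule space_diff[OF u(1) v])
  have mass_split: "(\<lambda>k. mass (u k) - mass (d k)) \<longlonglongrightarrow> mass v"
    unfolding mass_def d_def
    by (rule Brezis_Lieb[of u lborel q v 1])
       (use spaceD(1)[OF u(1)] v_Lp q_gt_1 u_lim u(2) in \<open>auto simp: mass_def\<close>)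
  have E_split: "(\<lambda>k. E i (u k) - E i (d k)) \<longlonglongrightarrow> E i v" for i
    unfolding E_def d_def quot_diff
    by (rule Brezis_Lieb[of "\<lambda>k. Q i (u k)" PM "p i" "Q i v" "K i"])
       (use spaceD(2)[OF u(1)] spaceD(2)[OF v] p Q_lim u(3) in \<open>auto simp: E_def\<close>)
  have J_split: "(\<lambda>k. J (u k) - J (d k)) \<longlonglongrightarrow> J v"
  proof -
    have "(\<lambda>k. \<Sum>i\<in>UNIV. s i * (1 - s i) / (2 * p i) * (E i (u k) - E i (d k))) \<longlonglongrightarrow> J v"
      unfolding J_def by (intro tendsto_sum tendsto_mult tendsto_const E_split)
    then show ?thesis
      by (simp add: J_def sum_subtractf right_diff_distrib)
  qed
  have mass_d: "(\<lambda>k. mass (d k)) \<longlonglongrightarrow> 1 - mass v"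
    using tendsto_diff[OF tendsto_const[of 1] mass_split] by (simp add: u(2))
  have J_d: "(\<lambda>k. J (d k)) \<longlonglongrightarrow> S - J v"
    using tendsto_diff[OF Ju_lim J_split] by simp
  \<comment> \<open>\<open>S_le\<close> for the remainder passes to the limit and bounds from below
    the part of S that v does not use.\<close>
  have "(\<lambda>k. S * mass (d k) powr \<theta>) \<longlonglongrightarrow> S * (1 - mass v) powr \<theta>"
    using mass_d \<theta> mass_nonneg by (intro tendsto_intros tendsto_powr') auto
  then have "S * (1 - mass v) powr \<theta> \<le> S - J v"
    by (rule LIMSEQ_le[OF _ J_d]) (use S_le[OF d] in auto)
  moreover have "S * mass v powr \<theta> \<le> J v"
    by (rule S_le[OF v])
  ultimately have le: "S * (mass v powr \<theta> + (1 - mass v) powr \<theta>) \<le> S * 1"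
    by (simp add: distrib_left)
  then have le1: "mass v powr \<theta> + (1 - mass v) powr \<theta> \<le> 1"
    using S_pos by (simp only: mult_le_cancel_left_pos)
  have "mass v = 1"
  proof (rule ccontr)
    assume "mass v \<noteq> 1"
    then have "mass v < mass v powr \<theta>" "1 - mass v < (1 - mass v) powr \<theta>"
      using v_mass v_pos \<theta> by (auto intro!: powr_gt_self)
    then show False
      using le1 by linarith
  qed
  moreover have "J v \<le> S"
    using \<open>S * (1 - mass v) powr \<theta> \<le> S - J v\<close> S_pos
    by (smt (verit) mult_nonneg_nonneg powr_ge_zero)
  moreover have "S \<le> J v"
    using \<open>S * mass v powr \<theta> \<le> J v\<close> \<open>mass v = 1\<close> by simp
  ultimately show ?thesis
    using v by (intro bexI[of _ v]) auto
qed

section \<open>From a minimizer to a weak solution\<close>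

text \<open>By \<open>S_le\<close> the function \<open>G\<close> is nonnegative on the whole line,
  and it vanishes at 0, so its derivative there is 0. Thus the multiplier comes out explicitly from
  an unconstrained minimum. Positive mass makes the power \<theta> < 1 differentiable, and assuming
  equality in \<open>S_le\<close> instead of mass 1 admits dilated minimizers.\<close>

lemma Euler_Lagrange:
  assumes u: "u \<in> aniso_space s p" and m: "0 < mass u" and min: "J u = S * mass u powr \<theta>"
    and f: "f \<in> aniso_space s p"
  shows "aniso_form s p u f
    = S * \<theta> * q * mass u powr (\<theta> - 1) * (LINT x|lborel. signed_power q (u x) * f x)"
proof -
  let ?I = "LINT x|lborel. signed_power q (u x) * f x"
  let ?F = "\<lambda>i. LINT z|PM. signed_power (p i) (Q i u z) * Q i f z"
  define G where "G t = J (\<lambda>x. u x + t * f x) - S * mass (\<lambda>x. u x + t * f x) powr \<theta>" for t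
  have mass': "((\<lambda>t. mass (\<lambda>x. u x + t * f x)) has_real_derivative q * ?I) (at 0)"
    unfolding mass_def
    by (rule has_real_derivative_integral_abs_powr[OF spaceD(1)[OF u] spaceD(1)[OF f] q_gt_1])
  have E': "((\<lambda>t. E i (\<lambda>x. u x + t * f x)) has_real_derivative p i * ?F i) (at 0)" for i
    unfolding E_def quot_lincomb
    by (rule has_real_derivative_integral_abs_powr[OF spaceD(2)[OF u] spaceD(2)[OF f] p])
  have J': "((\<lambda>t. J (\<lambda>x. u x + t * f x)) has_real_derivative
      (\<Sum>i\<in>UNIV. s i * (1 - s i) / (2 * p i) * (p i * ?F i))) (at 0)"
    unfolding J_def by (intro DERIV_sum DERIV_cmult E')
  have "(\<Sum>i\<in>UNIV. s i * (1 - s i) / (2 * p i) * (p i * ?F i)) = aniso_form s p u f"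
    unfolding aniso_form_eq[OF p spaceD(2)[OF u] spaceD(2)[OF f]]
    using p_pos by (intro sum.cong) (auto simp: less_imp_neq[symmetric])
  with J' have J'': "((\<lambda>t. J (\<lambda>x. u x + t * f x)) has_real_derivative aniso_form s p u f) (at 0)"
    by simp
  have "((\<lambda>x. x powr \<theta>) has_real_derivative \<theta> * mass u powr (\<theta> - 1)) (at (mass (\<lambda>x. u x + 0 * f x)))"
    using has_real_derivative_powr[OF m] by simp
  from DERIV_chain2[OF this mass'] DERIV_cmult[of _ _ 0 UNIV S] DERIV_diff[OF J'']
  have G': "(G has_real_derivative
      aniso_form s p u f - S * (\<theta> * mass u powr (\<theta> - 1) * (q * ?I))) (at 0)"
    unfolding G_def by blast
  have "0 \<le> G t" for t
    unfolding G_def using S_le[OF space_lincomb[OF u f]] by simp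
  moreover have "G 0 = 0"
    by (simp add: G_def min)
  ultimately have "aniso_form s p u f - S * (\<theta> * mass u powr (\<theta> - 1) * (q * ?I)) = 0"
    using DERIV_local_min[OF G', of 1] by simp
  then show ?thesis
    by (simp add: mult_ac)
qed

text \<open>The increments of |u| are at most those of u in absolute value, so passing to |u| keeps
  the mass and cannot raise J, which is already minimal.\<close>

lemma abs_minimizer:
  assumes u: "u \<in> aniso_space s p" "mass u = 1" "J u = S"
  shows "(\<lambda>x. \<bar>u x\<bar>) \<in> aniso_space s p" "mass (\<lambda>x. \<bar>u x\<bar>) = 1" "J (\<lambda>x. \<bar>u x\<bar>) = S"
proof -
  have [measurable]: "u \<in> borel_measurable borel"
    by (rule spaceD(3)[OF u(1)])
  have le: "\<bar>Q i (\<lambda>x. \<bar>u x\<bar>) z\<bar> powr p i \<le> \<bar>Q i u z\<bar> powr p i" for i z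
    using abs_quot_abs_le[of i "s i" "p i" u z] p_pos[of i] by (intro powr_mono2) auto
  have "Q i (\<lambda>x. \<bar>u x\<bar>) \<in> Lp PM (p i)" for i
    unfolding Lp_def
    using le by (auto intro!: Bochner_Integration.integrable_bound[OF LpD(2)[OF spaceD(2)[OF u(1), of i]]])
  moreover have "(\<lambda>x. \<bar>u x\<bar>) \<in> Lp lborel q"
    using spaceD(1)[OF u(1)] by (simp add: Lp_def)
  ultimately show v: "(\<lambda>x. \<bar>u x\<bar>) \<in> aniso_space s p"
    by (simp add: space_iff)
  show m: "mass (\<lambda>x. \<bar>u x\<bar>) = 1"
    using u(2) by (simp add: mass_def)
  have "E i (\<lambda>x. \<bar>u x\<bar>) \<le> E i u" for i
    unfolding E_def by (intro integral_mono LpD(2) spaceD(2) u(1) v le)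
  then have "J (\<lambda>x. \<bar>u x\<bar>) \<le> J u"
    unfolding J_def using weight_pos by (intro sum_mono mult_left_mono) (auto intro: less_imp_le)
  then show "J (\<lambda>x. \<bar>u x\<bar>) = S"
    using S_le[OF v] m u(3) by simp
qed

lemma nonneg_solution_exists:
  "\<exists>u. weak_solution s p u \<and> \<not> (AE x in lborel. u x = 0) \<and> (AE x in lborel. 0 \<le> u x)"
proof -
  obtain w where w0: "w \<in> aniso_space s p" "mass w = 1" "J w = S"
    using minimizer_exists by blast
  define v where "v = (\<lambda>x. \<bar>w x\<bar>)"
  note v = abs_minimizer[OF w0, folded v_def]
  \<comment> \<open>The mass at which the multiplier S \<theta> q m powr (\<theta> - 1) of
    \<open>Euler_Lagrange\<close> equals 1; it exists because \<theta> is not 1.\<close>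
  define m where "m = (S * \<theta> * q) powr (1 / (1 - \<theta>))"
  have c: "0 < S * \<theta> * q"
    using S_pos \<theta> q_gt_1 by simp
  have m: "0 < m"
    using c unfolding m_def powr_gt_zero by linarith
  have "m powr (\<theta> - 1) = (S * \<theta> * q) powr (1 / (1 - \<theta>) * (\<theta> - 1))"
    by (simp add: m_def powr_powr)
  also have "1 / (1 - \<theta>) * (\<theta> - 1) = - 1"
    using \<theta> by (simp add: field_simps)
  also have "(S * \<theta> * q) powr - 1 = 1 / (S * \<theta> * q)"
    using c by (rule powr_neg_one)
  finally have "m powr (\<theta> - 1) = 1 / (S * \<theta> * q)" .
  moreover have "C * (1 / C) = 1" if "0 < C" for C :: real
    using that by simp
  ultimately have m_eq: "S * \<theta> * q * m powr (\<theta> - 1) = 1"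
    using c by metis
  \<comment> \<open>A dilation to mass \<open>m\<close> keeps equality in \<open>S_le\<close>,
    because J is multiplied by the \<theta>-th power of the ratio of the masses; it also keeps
    nonnegativity.\<close>
  obtain b where b: "(\<lambda>x. v (cscale b x)) \<in> aniso_space s p"
    "mass (\<lambda>x. v (cscale b x)) = m"
    "J (\<lambda>x. v (cscale b x)) = (m / mass v) powr \<theta> * J v"
    using normalize[OF v(1) _ m] v(2) by (metis zero_less_one)
  define u where "u = (\<lambda>x. v (cscale b x))"
  have u: "u \<in> aniso_space s p" "mass u = m" "J u = S * mass u powr \<theta>"
    using b v by (auto simp: u_def)
  have "aniso_form s p u f = (LINT x|lborel. signed_power q (u x) * f x)" if "f \<in> aniso_space s p" for f
    using Euler_Lagrange[OF u(1) _ u(3) that] u(2) m m_eq by simp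
  then have "weak_solution s p u"
    using u(1) by (simp add: weak_solution_def)
  moreover have "\<not> (AE x in lborel. u x = 0)"
  proof
    assume "AE x in lborel. u x = 0"
    then have "mass u = (LINT x|(lborel :: (real^'n) measure). 0)"
      unfolding mass_def using spaceD(3)[OF u(1)] by (intro integral_cong_AE) auto
    then show False
      using u(2) m by simp
  qed
  moreover have "AE x in lborel. 0 \<le> u x"
    by (simp add: u_def v_def)
  ultimately show ?thesis
    by blast
qed

end

theorem corollary1p3:
  fixes s p :: "'n::finite \<Rightarrow> real"
  assumes "\<And>i. 0 < s i \<and> s i < 1"
    and "\<And>i. 1 < p i"
    and "sp_bar s p < real CARD('n)"
    and "p_max p < p_star s p"
  shows "\<exists>u :: real ^ 'n \<Rightarrow> real.
           weak_solution s p u \<and>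
           \<not> (AE x in lborel. u x = 0) \<and>
           (AE x in lborel. 0 \<le> u x)"
proof -
  interpret aniso_exponents s p
    using assms by unfold_locales
  show ?thesis
    by (rule nonneg_solution_exists)
qed

end
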